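(* Let $n\geq 1$ and let $\mathcal{A}$ be the cluster algebra of type $A_n$. (1) Choose any cluster of $\mathcal{A}$ as the initial cluster and specialise some of its cluster variables to values in $\{1,-1\}$ in such a way that the resulting specialised cluster algebra is polyamorous. Specialise further the remaining initial cluster variables to any values from $\mathbb{Z}$. Then the resulting values of the cluster variables of $\mathcal{A}$ form a tame frieze pattern over $\mathbb{Z}$ (with $n$ nontrivial rows). (2) Moreover, any tame frieze pattern over $\mathbb{Z}$ with $n$ nontrivial rows arises in this way, for some choice of initial cluster, of polyamorous specialisation of some of its variables to $\pm1$, and of integer values of the remaining variables.
   Context: Cluster algebra of type $A_n$. For a finite quiver $Q$ without loops or oriented 2-cycles and with vertices $1,\ldots,n$, a seed consists of a quiver on $\{1,\ldots,n\}$ and an $n$-tuple (cluster) of elements of $\mathbb{Q}(x_1,\ldots,x_n)$; the initial seed is $(Q,(x_1,\ldots,x_n))$. Mutation at $j$ changes the quiver by standard Fomin–Zelevinsky quiver mutation and replaces the $j$-th cluster variable $x_j$ by $x_j'=\bigl(\prod_{i\to j}x_i+\prod_{j\to i}x_i\bigr)/x_j$ (products over arrows into and out of $j$). $\mathcal{A}_Q$ is the $\mathbb{Z}$-algebra generated by all cluster variables in all clusters obtained by finite sequences of mutations. The cluster algebra of type $A_n$ is $\mathcal{A}_Q$ for $Q$ a path with $n$ vertices with any orientation of its arrows. Any cluster can be taken as the initial one; by the Laurent phenomenon every element of the algebra is a Laurent polynomial with integer coefficients in the variables of any chosen cluster. Polygon model (standard). Let $N=n+3$ and consider a convex $N$-gon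 with vertices numbered cyclically modulo $N$. The cluster variables of the type $A_n$ cluster algebra are in bijection with the diagonals of the polygon, and its clusters (up to ordering) with the triangulations of the polygon. Writing $x_{ab}=x_{ba}$ for the cluster variable of the diagonal joining $a$ and $b$, and setting $x_{ab}=1$ if $ab$ is a side and $x_{aa}=0$, the mutation relations are the Ptolemy relations $x_{ac}x_{bd}=x_{ab}x_{cd}+x_{ad}x_{bc}$ for vertices $a,b,c,d$ in cyclic order. For a choice of initial cluster, i.e. of a triangulation $T$, all $x_{ab}$ are expressed through the initial variables $x_{ab}$, $ab\in T$, by these relations. Specialisation. Having chosen an initial cluster, specialisation relations $\sigma$ assign to some (possibly none, possibly all) of the initial cluster variables values in $\{1,-1\}$. The specialised cluster algebra is the ring of Laurent polynomials obtained from elements of $\mathcal{A}$, expressed as Laurent polynomials in the initial cluster variables, by substituting the assigned values. Its variables are the non-specialised initial cluster variables. It is polyamorous if every element of it is polynomial (no negative powers) in each of its variables; in that case the variables can be further specialised to arbitrary integers. Tame frieze patterns. A tame frieze pattern over $\mathbb{Z}$ with $n$ nontrivial rows is an array of integers $m_{i,j}$, indexed by integers $i\le j\le i+n+3$ (the row of $m_{i,j}$ being determined by $j-i$, with consecutive rows shifted relative to each other), such that: $m_{i,i}=m_{i,i+n+3}=0$ and $m_{i,i+1}=m_{i,i+n+2}=1$ for all $i$; the diamond rule $m_{i,j}m_{i+1,j+1}-m_{i+1,j}m_{i,j+1}=1$ holds whenever all four entries belong to the array; and (tameness) $\det(m_{i+p,j+q})_{0\le p,q\le 2}=0$ whenever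 all nine entries belong to the array. The nontrivial rows are those with $2\le j-i\le n+1$; entries there are arbitrary integers (zero and negative entries allowed). Forming a frieze from values of cluster variables. Values of the cluster variables $x_{ab}$ form the array $m_{i,j}=x_{\bar\imath\,\bar\jmath}$ for $i\le j\le i+n+3$, where $\bar\imath,\bar\jmath$ denote residues modulo $N=n+3$ (with $x_{ab}=1$ for sides and $x_{aa}=0$). For instance, for $n=2$ the cluster variables are arranged with $m_{1,3},m_{2,4},m_{3,5}$ equal to $\frac{1+x_2}{x_1},\,x_1,\,\frac{1+x_1+x_2}{x_1x_2}$ in one row and $m_{1,4},m_{2,5}$ equal to $x_2,\frac{1+x_1}{x_2}$ in the next. *)

theory Defs
  imports
    "HOL-Analysis.Analysis"
    "HOL-Library.Poly_Mapping"
    "HOL-Computational_Algebra.Fraction_Field"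
begin

(* Q(x_0, x_1, ...) as the fraction field of Z[x_0, x_1, ...].  An exponent vector is a finitely
   supported function on the indices.  A rank n cluster algebra only involves x_0, ..., x_(n-1);
   indices of quiver vertices and of cluster variables run over {..<n}. *)
type_synonym ratfun = "((nat \<Rightarrow>\<^sub>0 nat) \<Rightarrow>\<^sub>0 int) fract"

definition var :: "nat \<Rightarrow> ratfun" where
  "var i = Fract (Poly_Mapping.single (Poly_Mapping.single i 1) 1) 1"


(* Q i j is the number of arrows from i to j. *)
type_synonym quiver = "nat \<Rightarrow> nat \<Rightarrow> nat"

type_synonym seed = "quiver \<times> (nat \<Rightarrow> ratfun)"

definition path_quiver :: "nat \<Rightarrow> quiver \<Rightarrow> bool" where
  "path_quiver n Q \<longleftrightarrow>
     (\<forall>i<n. \<forall>j<n. if j = Suc i then Q i j + Q j i = 1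
                  else i \<noteq> Suc j \<longrightarrow> Q i j = 0)"

(* Arrows at j are reversed, each path i -> j -> k contributes an arrow i -> k, and the truncated
   subtraction cancels the resulting oriented 2-cycles. *)
definition mutate_quiver :: "nat \<Rightarrow> quiver \<Rightarrow> quiver" where
  "mutate_quiver j Q = (\<lambda>i k.
     if i = j \<or> k = j then Q k i
     else (Q i k + Q i j * Q j k) - (Q k i + Q k j * Q j i))"

definition mutate_seed :: "nat \<Rightarrow> nat \<Rightarrow> seed \<Rightarrow> seed" where
  "mutate_seed n j = (\<lambda>(Q, x).
     (mutate_quiver j Q,
      x(j := ((\<Prod>i<n. x i ^ Q i j) + (\<Prod>i<n. x i ^ Q j i)) / x j)))"

inductive_set seeds :: "nat \<Rightarrow> quiver \<Rightarrow> seed set" for n :: nat and Q :: quiver where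
  initial: "(Q, var) \<in> seeds n Q"
| mutate: "s \<in> seeds n Q \<Longrightarrow> j < n \<Longrightarrow> mutate_seed n j s \<in> seeds n Q"

definition clusters :: "nat \<Rightarrow> quiver \<Rightarrow> ratfun set set" where
  "clusters n Q = (\<lambda>(R, y). y ` {..<n}) ` seeds n Q"

inductive_set int_algebra_generated :: "'a::comm_ring_1 set \<Rightarrow> 'a set" for G :: "'a set" where
  gen: "a \<in> G \<Longrightarrow> a \<in> int_algebra_generated G"
| one: "1 \<in> int_algebra_generated G"
| diff: "a \<in> int_algebra_generated G \<Longrightarrow> b \<in> int_algebra_generated G
           \<Longrightarrow> a - b \<in> int_algebra_generated G"
| mult: "a \<in> int_algebra_generated G \<Longrightarrow> b \<in> int_algebra_generated G
           \<Longrightarrow> a * b \<in> int_algebra_generated G"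

definition cluster_algebra :: "nat \<Rightarrow> quiver \<Rightarrow> ratfun set" where
  "cluster_algebra n Q = int_algebra_generated (\<Union> (clusters n Q))"


(* The vertices of the (n+3)-gon are 0, ..., n+2, and the diagonal joining a and b is
   represented by the pair (a, b) with a < b. *)
definition diagonals :: "nat \<Rightarrow> (int \<times> int) set" where
  "diagonals n = {(a, b). 0 \<le> a \<and> a + 2 \<le> b \<and> b < int n + 3 \<and> (a, b) \<noteq> (0, int n + 2)}"

definition crossing :: "int \<times> int \<Rightarrow> int \<times> int \<Rightarrow> bool" where
  "crossing = (\<lambda>(a, b) (c, d). (a < c \<and> c < b \<and> b < d) \<or> (c < a \<and> a < d \<and> d < b))"

definition triangulation :: "nat \<Rightarrow> (int \<times> int) set \<Rightarrow> bool" where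
  "triangulation n T \<longleftrightarrow>
     T \<subseteq> diagonals n \<and>
     (\<forall>d\<in>T. \<forall>e\<in>T. \<not> crossing d e) \<and>
     (\<forall>d\<in>diagonals n - T. \<exists>e\<in>T. crossing d e)"

(* X a b is the cluster variable x_ab of the diagonal ab.  The Ptolemy relation is
   invariant under cyclic rotation of a, b, c, d, so a < b < c < d covers all
   quadruples in cyclic order. *)
definition polygon_model :: "nat \<Rightarrow> quiver \<Rightarrow> (int \<Rightarrow> int \<Rightarrow> ratfun) \<Rightarrow> bool" where
  "polygon_model n Q X \<longleftrightarrow>
     (\<forall>a\<in>{0..<int n + 3}. \<forall>b\<in>{0..<int n + 3}. X a b = X b a) \<and>
     (\<forall>a\<in>{0..<int n + 3}. X a a = 0 \<and> X a ((a + 1) mod (int n + 3)) = 1) \<and>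
     bij_betw (case_prod X) (diagonals n) (\<Union> (clusters n Q)) \<and>
     clusters n Q = {case_prod X ` T | T. triangulation n T} \<and>
     (\<forall>a b c d. 0 \<le> a \<and> a < b \<and> b < c \<and> c < d \<and> d < int n + 3 \<longrightarrow>
        X a c * X b d = X a b * X c d + X a d * X b c)"


type_synonym laurent = "(nat \<Rightarrow>\<^sub>0 int) \<Rightarrow>\<^sub>0 int"

definition in_vars :: "nat \<Rightarrow> laurent \<Rightarrow> bool" where
  "in_vars n L \<longleftrightarrow> (\<forall>m\<in>Poly_Mapping.keys L. Poly_Mapping.keys m \<subseteq> {..<n})"

definition laurent_eval :: "(nat \<Rightarrow> ratfun) \<Rightarrow> laurent \<Rightarrow> ratfun" where
  "laurent_eval y L = (\<Sum>m\<in>Poly_Mapping.keys L. of_int (Poly_Mapping.lookup L m) *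
     (\<Prod>i\<in>Poly_Mapping.keys m. y i powi Poly_Mapping.lookup m i))"

(* The expansion of an element of a cluster algebra in the variables of a cluster y: it exists by
   the Laurent phenomenon and is unique since cluster variables of one cluster are
   algebraically independent. *)
definition laurent_expansion :: "nat \<Rightarrow> (nat \<Rightarrow> ratfun) \<Rightarrow> ratfun \<Rightarrow> laurent" where
  "laurent_expansion n y a = (THE L. in_vars n L \<and> laurent_eval y L = a)"

(* The i-th variable of the initial cluster is specialised iff i is in the domain of \<sigma>. *)
definition specialisation :: "nat \<Rightarrow> (nat \<rightharpoonup> int) \<Rightarrow> bool" where
  "specialisation n \<sigma> \<longleftrightarrow> dom \<sigma> \<subseteq> {..<n} \<and> ran \<sigma> \<subseteq> {1, -1}"

(* Since 1 and -1 are their own inverses, the power s^k for a possibly negative k is s^|k|. *)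
definition specialise :: "(nat \<rightharpoonup> int) \<Rightarrow> laurent \<Rightarrow> laurent" where
  "specialise \<sigma> L = (\<Sum>m\<in>Poly_Mapping.keys L. of_int (Poly_Mapping.lookup L m) *
     (\<Prod>i\<in>Poly_Mapping.keys m. case \<sigma> i of
          Some s \<Rightarrow> of_int (s ^ nat \<bar>Poly_Mapping.lookup m i\<bar>)
        | None \<Rightarrow> Poly_Mapping.single (Poly_Mapping.single i (Poly_Mapping.lookup m i)) 1))"

definition specialised_algebra ::
  "nat \<Rightarrow> quiver \<Rightarrow> (nat \<Rightarrow> ratfun) \<Rightarrow> (nat \<rightharpoonup> int) \<Rightarrow> laurent set" where
  "specialised_algebra n Q y \<sigma> =
     (\<lambda>a. specialise \<sigma> (laurent_expansion n y a)) ` cluster_algebra n Q"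

definition polyamorous ::
  "nat \<Rightarrow> quiver \<Rightarrow> (nat \<Rightarrow> ratfun) \<Rightarrow> (nat \<rightharpoonup> int) \<Rightarrow> bool" where
  "polyamorous n Q y \<sigma> \<longleftrightarrow>
     (\<forall>f\<in>specialised_algebra n Q y \<sigma>. \<forall>m\<in>Poly_Mapping.keys f.
        \<forall>i\<in>{..<n} - dom \<sigma>. 0 \<le> Poly_Mapping.lookup m i)"

(* Only meaningful if no negative exponents occur in f. *)
definition poly_eval :: "(nat \<Rightarrow> int) \<Rightarrow> laurent \<Rightarrow> int" where
  "poly_eval t f = (\<Sum>m\<in>Poly_Mapping.keys f. Poly_Mapping.lookup f m *
     (\<Prod>i\<in>Poly_Mapping.keys m. t i ^ nat (Poly_Mapping.lookup m i)))"

(* The value of a when the initial cluster y is specialised by \<sigma> and the remaining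
   variables are given the values t. *)
definition cluster_value ::
  "nat \<Rightarrow> (nat \<Rightarrow> ratfun) \<Rightarrow> (nat \<rightharpoonup> int) \<Rightarrow> (nat \<Rightarrow> int) \<Rightarrow> ratfun \<Rightarrow> int" where
  "cluster_value n y \<sigma> t a = poly_eval t (specialise \<sigma> (laurent_expansion n y a))"


definition in_array :: "nat \<Rightarrow> int \<Rightarrow> int \<Rightarrow> bool" where
  "in_array n i j \<longleftrightarrow> i \<le> j \<and> j \<le> i + int n + 3"

(* Only the entries m i j with in_array n i j matter; m is arbitrary elsewhere. *)
definition tame_frieze :: "nat \<Rightarrow> (int \<Rightarrow> int \<Rightarrow> int) \<Rightarrow> bool" where
  "tame_frieze n m \<longleftrightarrow>
     (\<forall>i. m i i = 0 \<and> m i (i + int n + 3) = 0 \<and> m i (i + 1) = 1 \<and> m i (i + int n + 2) = 1) \<and>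
     (\<forall>i j. in_array n i j \<and> in_array n (i + 1) (j + 1) \<and>
            in_array n (i + 1) j \<and> in_array n i (j + 1) \<longrightarrow>
        m i j * m (i + 1) (j + 1) - m (i + 1) j * m i (j + 1) = 1) \<and>
     (\<forall>i j. (\<forall>p\<in>{0..2}. \<forall>q\<in>{0..2}. in_array n (i + p) (j + q)) \<longrightarrow>
        det (vector [vector [m i j,       m i (j + 1),       m i (j + 2)],
                     vector [m (i + 1) j, m (i + 1) (j + 1), m (i + 1) (j + 2)],
                     vector [m (i + 2) j, m (i + 2) (j + 1), m (i + 2) (j + 2)]] :: int^3^3) = 0)"

definition value_array ::
  "nat \<Rightarrow> (int \<Rightarrow> int \<Rightarrow> ratfun) \<Rightarrow> (ratfun \<Rightarrow> int) \<Rightarrow> int \<Rightarrow> int \<Rightarrow> int" where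
  "value_array n X v = (\<lambda>i j. v (X (i mod (int n + 3)) (j mod (int n + 3))))"

end

theory Submission
  imports Defs
begin

text \<open>Clusters of type A correspond to triangulations of a polygon: mutation is a flip, the exchange
  relation is a Ptolemy relation, and the vertices can be represented by plane vectors whose
  determinants are the cluster variables. Expanding in the variables of a triangulation \<open>T\<close> uses
  Ptolemy relations with respect to diagonals of \<open>T\<close>, which lower the number of crossings with \<open>T\<close>.

  Under a polyamorous specialisation, evaluation is a ring homomorphism on the cluster algebra, so
  the values satisfy the Ptolemy relations. These contain the diamond rule and show that each column
  depends linearly on its two neighbours, with the same coefficients in all rows, hence tameness.

  Conversely, tameness propagates the linear recurrence of the columns, so the entries of a tame
  frieze are again determinants and satisfy the Ptolemy relations. If all ears of a polygon with
  sides 1 and -1 had absolute value at least 2, the entries of a row would grow in absolute value;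
  so some ear is 0, 1 or -1. An ear 1 or -1 is cut off. Next to an ear 0 there is a diagonal of value
  1 or -1 that cuts off a quadrilateral. This dissects the polygon by diagonals of value 1 and -1
  into triangles and quadrilaterals having a diagonal of value 0. Specialising the dissecting diagonals
  and leaving free in each quadrilateral the diagonal opposite to the zero yields the frieze; no
  denominators arise, since the diagonal of value 0 becomes the zero polynomial.\<close>

section \<open>Linear extensions of monoid maps\<close>

text \<open>\<open>laurent_expansion\<close> is a definite description, so nothing can be computed
  before the variables of a seed are known to be algebraically independent. Positivity supplies
  this: exchange relations contain no subtraction, so arbitrary positive real values can be
  prescribed for the variables of any seed and carried back to the initial ones without a
  denominator vanishing. In the second half the remaining variables may take the value 0, so one
  cannot expand over all of \<open>T\<close> and clear denominators afterwards. Crossings are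
  resolved only with the dissecting set \<open>S\<close>, whose values 1 and -1 are units, until a
  diagonal crosses no element of \<open>S\<close>. Such a diagonal is a side, a member of
  \<open>T\<close>, or the diagonal of value 0 in a quadrilateral; in the last case the specialised
  Ptolemy relation reads \<open>special (X p r) * special (X q s) = 0\<close>, where one factor is a
  variable. Absolute values appear in the search for ears because cutting along a diagonal of value
  -1 leaves a polygon with a side -1.\<close>

definition lin_ext :: "('m \<Rightarrow> 'a) \<Rightarrow> ('m \<Rightarrow>\<^sub>0 int) \<Rightarrow> 'a::comm_ring_1" where
  "lin_ext \<phi> p = (\<Sum>m\<in>Poly_Mapping.keys p. of_int (Poly_Mapping.lookup p m) * \<phi> m)"

lemma lin_ext_superset:
  assumes "finite A" "Poly_Mapping.keys p \<subseteq> A"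
  shows "lin_ext \<phi> p = (\<Sum>m\<in>A. of_int (Poly_Mapping.lookup p m) * \<phi> m)"
  unfolding lin_ext_def
  by (rule sum.mono_neutral_left) (use assms in \<open>auto simp: in_keys_iff\<close>)

lemma lin_ext_add: "lin_ext \<phi> (p + q) = lin_ext \<phi> p + lin_ext \<phi> q"
proof -
  let ?A = "Poly_Mapping.keys p \<union> Poly_Mapping.keys q"
  have "lin_ext \<phi> (p + q) = (\<Sum>m\<in>?A. of_int (Poly_Mapping.lookup (p + q) m) * \<phi> m)"
    using Poly_Mapping.keys_add[of p q] by (intro lin_ext_superset) auto
  moreover have "lin_ext \<phi> p = (\<Sum>m\<in>?A. of_int (Poly_Mapping.lookup p m) * \<phi> m)"
    "lin_ext \<phi> q = (\<Sum>m\<in>?A. of_int (Poly_Mapping.lookup q m) * \<phi> m)"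
    by (intro lin_ext_superset; auto)+
  ultimately show ?thesis
    by (simp add: lookup_add algebra_simps sum.distrib)
qed

lemma lin_ext_0 [simp]: "lin_ext \<phi> 0 = 0"
  by (simp add: lin_ext_def)

lemma lin_ext_uminus: "lin_ext \<phi> (- p) = - lin_ext \<phi> p"
  using lin_ext_add[of \<phi> "- p" p] by (simp add: eq_neg_iff_add_eq_0)

lemma lin_ext_diff: "lin_ext \<phi> (p - q) = lin_ext \<phi> p - lin_ext \<phi> q"
  using lin_ext_add[of \<phi> p "- q"] by (simp add: lin_ext_uminus)

lemma lin_ext_sum: "lin_ext \<phi> (sum f A) = (\<Sum>x\<in>A. lin_ext \<phi> (f x))"
  by (induction A rule: infinite_finite_induct) (auto simp: lin_ext_add)

lemma lin_ext_single [simp]: "lin_ext \<phi> (Poly_Mapping.single m c) = of_int c * \<phi> m"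
  by (simp add: lin_ext_def)

lemma lin_ext_of_int:
  fixes \<phi> :: "'m::monoid_add \<Rightarrow> 'a::comm_ring_1"
  shows "lin_ext \<phi> (of_int c) = of_int c * \<phi> 0"
  by (subst single_of_int[symmetric], subst lin_ext_single) simp

lemma lin_ext_1:
  fixes \<phi> :: "'m::monoid_add \<Rightarrow> 'a::comm_ring_1"
  shows "lin_ext \<phi> 1 = \<phi> 0"
  using lin_ext_of_int[of \<phi> 1] by simp

lemma poly_mapping_sum_single:
  fixes p :: "'m \<Rightarrow>\<^sub>0 'b::comm_monoid_add"
  shows "p = (\<Sum>m\<in>Poly_Mapping.keys p. Poly_Mapping.single m (Poly_Mapping.lookup p m))"
  by (rule poly_mapping_eqI) (auto simp: lookup_sum lookup_single when_def in_keys_iff)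

text \<open>Multiplicativity of the monomial map is asked only on the two supports: Laurent
  evaluation needs nonzero variables, and \<open>poly_eval\<close>, which truncates exponents by
  \<open>nat\<close>, needs nonnegative ones, so neither is a monoid map on all exponents.\<close>

lemma lin_ext_mult:
  fixes p q :: "'m::comm_monoid_add \<Rightarrow>\<^sub>0 int"
  assumes "\<And>a b. a \<in> Poly_Mapping.keys p \<Longrightarrow> b \<in> Poly_Mapping.keys q \<Longrightarrow> \<phi> (a + b) = \<phi> a * \<phi> b"
  shows "lin_ext \<phi> (p * q) = lin_ext \<phi> p * lin_ext \<phi> q"
proof -
  have "p * q = (\<Sum>a\<in>Poly_Mapping.keys p. \<Sum>b\<in>Poly_Mapping.keys q.
      Poly_Mapping.single (a + b) (Poly_Mapping.lookup p a * Poly_Mapping.lookup q b))"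
    by (rule trans[OF arg_cong2[OF poly_mapping_sum_single[of p] poly_mapping_sum_single[of q], of "(*)"]])
      (simp only: sum_product mult_single)
  then have "lin_ext \<phi> (p * q) = (\<Sum>a\<in>Poly_Mapping.keys p. \<Sum>b\<in>Poly_Mapping.keys q.
      of_int (Poly_Mapping.lookup p a * Poly_Mapping.lookup q b) * \<phi> (a + b))"
    by (simp add: lin_ext_sum)
  also have "\<dots> = (\<Sum>a\<in>Poly_Mapping.keys p. \<Sum>b\<in>Poly_Mapping.keys q.
      (of_int (Poly_Mapping.lookup p a) * \<phi> a) * (of_int (Poly_Mapping.lookup q b) * \<phi> b))"
    by (intro sum.cong refl) (simp add: assms algebra_simps)
  finally show ?thesis
    by (simp add: lin_ext_def sum_product)
qed

definition monomial_map :: "('i \<Rightarrow> 'e \<Rightarrow> 'a) \<Rightarrow> ('i \<Rightarrow>\<^sub>0 'e::zero) \<Rightarrow> 'a::comm_monoid_mult" where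
  "monomial_map h m = (\<Prod>i\<in>Poly_Mapping.keys m. h i (Poly_Mapping.lookup m i))"

lemma monomial_map_superset:
  assumes "\<And>i. h i 0 = 1" "finite A" "Poly_Mapping.keys m \<subseteq> A"
  shows "monomial_map h m = (\<Prod>i\<in>A. h i (Poly_Mapping.lookup m i))"
  unfolding monomial_map_def
  by (rule prod.mono_neutral_left) (use assms in \<open>auto simp: in_keys_iff\<close>)

lemma monomial_map_0 [simp]: "monomial_map h 0 = 1"
  by (simp add: monomial_map_def)

lemma monomial_map_add:
  fixes m m' :: "'i \<Rightarrow>\<^sub>0 'e::monoid_add"
  assumes "\<And>i. h i 0 = 1"
    and "\<And>i. h i (Poly_Mapping.lookup m i + Poly_Mapping.lookup m' i)
              = h i (Poly_Mapping.lookup m i) * h i (Poly_Mapping.lookup m' i)"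
  shows "monomial_map h (m + m') = monomial_map h m * monomial_map h m'"
proof -
  let ?A = "Poly_Mapping.keys m \<union> Poly_Mapping.keys m'"
  have "monomial_map h (m + m') = (\<Prod>i\<in>?A. h i (Poly_Mapping.lookup (m + m') i))"
    "monomial_map h m = (\<Prod>i\<in>?A. h i (Poly_Mapping.lookup m i))"
    "monomial_map h m' = (\<Prod>i\<in>?A. h i (Poly_Mapping.lookup m' i))"
    using Poly_Mapping.keys_add[of m m'] by (auto intro!: monomial_map_superset simp: assms(1))
  then show ?thesis
    by (simp add: lookup_add assms(2) prod.distrib)
qed

lemma monomial_map_single:
  "(\<And>i. h i 0 = 1) \<Longrightarrow> monomial_map h (Poly_Mapping.single i k) = h i k"
  by (cases "k = 0") (simp_all add: monomial_map_def)

section \<open>Algebraic independence of the variables of a seed\<close>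

definition eval_poly :: "(nat \<Rightarrow> real) \<Rightarrow> ((nat \<Rightarrow>\<^sub>0 nat) \<Rightarrow>\<^sub>0 int) \<Rightarrow> real" where
  "eval_poly v = lin_ext (monomial_map (\<lambda>i k. v i ^ k))"

lemma eval_poly_add: "eval_poly v (p + q) = eval_poly v p + eval_poly v q"
  by (simp add: eval_poly_def lin_ext_add)

lemma eval_poly_mult: "eval_poly v (p * q) = eval_poly v p * eval_poly v q"
  unfolding eval_poly_def
  by (intro lin_ext_mult monomial_map_add) (simp_all add: power_add)

lemma eval_poly_0 [simp]: "eval_poly v 0 = 0"
  by (simp add: eval_poly_def)

lemma eval_poly_1 [simp]: "eval_poly v 1 = 1"
  by (simp add: eval_poly_def lin_ext_1)

lemma eval_poly_of_int: "eval_poly v (of_int c) = of_int c"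
  by (simp add: eval_poly_def lin_ext_of_int)

lemma eval_poly_var: "eval_poly v (Poly_Mapping.single (Poly_Mapping.single i 1) 1) = v i"
  by (simp add: eval_poly_def monomial_map_single)

text \<open>A relation and not a function: a fraction has a value at a point only through a
  representative whose denominator does not vanish there. \<open>evaluates_unique\<close> makes it
  single-valued.\<close>

definition evaluates :: "(nat \<Rightarrow> real) \<Rightarrow> ratfun \<Rightarrow> real \<Rightarrow> bool" where
  "evaluates v f r \<longleftrightarrow>
     (\<exists>p q. f = Fract p q \<and> eval_poly v q \<noteq> 0 \<and> r = eval_poly v p / eval_poly v q)"

lemma evaluates_unique:
  assumes "evaluates v f r" "evaluates v f s"
  shows "r = s"
proof -
  obtain p q where 1: "f = Fract p q" "eval_poly v q \<noteq> 0" "r = eval_poly v p / eval_poly v q"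
    using assms(1) unfolding evaluates_def by blast
  obtain p' q' where 2: "f = Fract p' q'" "eval_poly v q' \<noteq> 0" "s = eval_poly v p' / eval_poly v q'"
    using assms(2) unfolding evaluates_def by blast
  have "q \<noteq> 0" "q' \<noteq> 0"
    using 1(2) 2(2) by auto
  then have "p * q' = p' * q"
    using 1(1) 2(1) by (simp add: eq_fract)
  then have "eval_poly v p * eval_poly v q' = eval_poly v p' * eval_poly v q"
    by (metis eval_poly_mult)
  with 1 2 show ?thesis
    by (simp add: frac_eq_eq)
qed

lemma evaluates_add:
  assumes "evaluates v f r" "evaluates v g s"
  shows "evaluates v (f + g) (r + s)"
proof -
  obtain p q where 1: "f = Fract p q" "eval_poly v q \<noteq> 0" "r = eval_poly v p / eval_poly v q"
    using assms(1) unfolding evaluates_def by blast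
  obtain p' q' where 2: "g = Fract p' q'" "eval_poly v q' \<noteq> 0" "s = eval_poly v p' / eval_poly v q'"
    using assms(2) unfolding evaluates_def by blast
  have "q \<noteq> 0" "q' \<noteq> 0"
    using 1(2) 2(2) by auto
  then have "f + g = Fract (p * q' + p' * q) (q * q')"
    using 1 2 by simp
  moreover have "r + s = eval_poly v (p * q' + p' * q) / eval_poly v (q * q')"
    using 1 2 by (simp add: eval_poly_add eval_poly_mult add_frac_eq)
  moreover have "eval_poly v (q * q') \<noteq> 0"
    using 1 2 by (simp add: eval_poly_mult)
  ultimately show ?thesis
    unfolding evaluates_def by blast
qed

lemma evaluates_mult:
  assumes "evaluates v f r" "evaluates v g s"
  shows "evaluates v (f * g) (r * s)"
proof -
  obtain p q where 1: "f = Fract p q" "eval_poly v q \<noteq> 0" "r = eval_poly v p / eval_poly v q"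
    using assms(1) unfolding evaluates_def by blast
  obtain p' q' where 2: "g = Fract p' q'" "eval_poly v q' \<noteq> 0" "s = eval_poly v p' / eval_poly v q'"
    using assms(2) unfolding evaluates_def by blast
  have "f * g = Fract (p * p') (q * q')"
    using 1 2 by simp
  moreover have "r * s = eval_poly v (p * p') / eval_poly v (q * q')" "eval_poly v (q * q') \<noteq> 0"
    using 1 2 by (simp_all add: eval_poly_mult)
  ultimately show ?thesis
    unfolding evaluates_def by blast
qed

lemma evaluates_inverse:
  assumes "evaluates v f r" "r \<noteq> 0"
  shows "evaluates v (inverse f) (inverse r)"
proof -
  obtain p q where 1: "f = Fract p q" "eval_poly v q \<noteq> 0" "r = eval_poly v p / eval_poly v q"
    using assms(1) unfolding evaluates_def by blast
  have "inverse f = Fract q p"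
    using 1 by simp
  moreover have "inverse r = eval_poly v q / eval_poly v p" "eval_poly v p \<noteq> 0"
    using 1 assms(2) by simp_all
  ultimately show ?thesis
    unfolding evaluates_def by blast
qed

lemma evaluates_divide:
  "evaluates v f r \<Longrightarrow> evaluates v g s \<Longrightarrow> s \<noteq> 0 \<Longrightarrow> evaluates v (f / g) (r / s)"
  by (simp add: divide_inverse evaluates_mult evaluates_inverse)

lemma evaluates_of_int: "evaluates v (of_int c) (of_int c)"
proof -
  have 0: "evaluates v 0 0"
    unfolding evaluates_def by (rule exI[of _ 0], rule exI[of _ 1]) (simp add: Zero_fract_def)
  have 1: "evaluates v 1 1"
    unfolding evaluates_def by (rule exI[of _ 1], rule exI[of _ 1]) (simp add: One_fract_def)
  have m1: "evaluates v (- 1) (- 1)"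
    unfolding evaluates_def using eval_poly_of_int[of v "- 1"]
    by (intro exI[of _ "- 1"] exI[of _ 1]) (simp add: One_fract_def)
  have nat: "evaluates v (of_nat k) (of_nat k)" for k
    by (induction k) (simp_all add: 0 1 evaluates_add)
  show ?thesis
    using nat evaluates_mult[OF m1 nat] by (cases c rule: int_cases2) auto
qed

lemma evaluates_0: "evaluates v 0 0"
  using evaluates_of_int[of v 0] by simp

lemma evaluates_1: "evaluates v 1 1"
  using evaluates_of_int[of v 1] by simp

lemma evaluates_var: "evaluates v (var i) (v i)"
  unfolding evaluates_def var_def
  by (rule exI[of _ "Poly_Mapping.single (Poly_Mapping.single i 1) 1"], rule exI[of _ 1])
    (simp add: eval_poly_var del: One_nat_def)

lemma evaluates_nonzero: "evaluates v f r \<Longrightarrow> r \<noteq> 0 \<Longrightarrow> f \<noteq> 0"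
  using evaluates_unique evaluates_0 by blast

lemma evaluates_power: "evaluates v f r \<Longrightarrow> evaluates v (f ^ k) (r ^ k)"
  by (induction k) (auto intro: evaluates_1 evaluates_mult)

lemma evaluates_powi: "evaluates v f r \<Longrightarrow> r \<noteq> 0 \<Longrightarrow> evaluates v (f powi k) (r powi k)"
  unfolding power_int_def by (auto intro: evaluates_power evaluates_inverse)

lemma evaluates_sum:
  "(\<And>x. x \<in> A \<Longrightarrow> evaluates v (f x) (r x)) \<Longrightarrow> evaluates v (sum f A) (sum r A)"
  by (induction A rule: infinite_finite_induct) (auto intro: evaluates_0 evaluates_add)

lemma evaluates_prod:
  "(\<And>x. x \<in> A \<Longrightarrow> evaluates v (f x) (r x)) \<Longrightarrow> evaluates v (prod f A) (prod r A)"
  by (induction A rule: infinite_finite_induct) (auto intro: evaluates_1 evaluates_mult)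

text \<open>Without a loop at \<open>j\<close> the exchange polynomial does not involve the variable
  being replaced, so the exchange acts on values as an involution.\<close>

lemma seeds_loopless:
  assumes "s \<in> seeds n Q" "\<And>i. i < n \<Longrightarrow> Q i i = 0" "i < n"
  shows "fst s i i = 0"
  using assms
proof (induction rule: seeds.induct)
  case (mutate s j)
  then show ?case
    by (cases s) (auto simp: mutate_seed_def mutate_quiver_def)
qed simp

text \<open>Mutation is reversible at the level of values, so the variables of every seed can be given
  arbitrary positive values; hence they are algebraically independent.\<close>
lemma seeds_evaluates:
  assumes "s \<in> seeds n Q" "\<And>i. i < n \<Longrightarrow> Q i i = 0" "\<And>i. 0 < u i"
  shows "\<exists>v. \<forall>i<n. evaluates v (snd s i) (u i)"
  using assms
proof (induction arbitrary: u rule: seeds.induct)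
  case initial
  show ?case
    by (rule exI[of _ u]) (simp add: evaluates_var)
next
  case (mutate s j)
  obtain R y where s: "s = (R, y)"
    by (cases s)
  have loop: "R j j = 0"
    using seeds_loopless[OF mutate.hyps(1) mutate.prems(1) mutate.hyps(2)] s by simp
  define P where "P = (\<Prod>i<n. u i ^ R i j) + (\<Prod>i<n. u i ^ R j i)"
  \<comment> \<open>The exchange relation solved for the old variable: an old value
    \<open>P / u j\<close> is mutated into \<open>u j\<close>.\<close>
  define u' where "u' = u(j := P / u j)"
  have P: "P > 0"
    unfolding P_def by (intro add_pos_pos prod_pos) (auto simp: mutate.prems(2))
  have u': "u' i > 0" for i
    using P mutate.prems(2) by (simp add: u'_def)
  obtain v where v: "\<forall>i<n. evaluates v (y i) (u' i)"
    using mutate.IH[where u = u', OF mutate.prems(1) u'] s by auto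
  have "(\<Prod>i<n. u' i ^ R i j) = (\<Prod>i<n. u i ^ R i j)" "(\<Prod>i<n. u' i ^ R j i) = (\<Prod>i<n. u i ^ R j i)"
    using loop by (auto intro!: prod.cong simp: u'_def)
  moreover have "evaluates v (\<Prod>i<n. y i ^ R i j) (\<Prod>i<n. u' i ^ R i j)"
    "evaluates v (\<Prod>i<n. y i ^ R j i) (\<Prod>i<n. u' i ^ R j i)"
    using v by (auto intro!: evaluates_prod evaluates_power)
  ultimately have "evaluates v (((\<Prod>i<n. y i ^ R i j) + (\<Prod>i<n. y i ^ R j i)) / y j) (P / u' j)"
    unfolding P_def using v u'[of j] mutate.hyps(2)
    by (intro evaluates_divide evaluates_add) auto
  moreover have "P / u' j = u j"
    using P by (simp add: u'_def)
  ultimately have "\<forall>i<n. evaluates v (snd (mutate_seed n j s) i) (u i)"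
    using v by (auto simp: s mutate_seed_def u'_def)
  then show ?case
    by blast
qed

text \<open>A Kronecker substitution: two exponent vectors get the same weight only if the base is a
  root of the nonzero polynomial whose coefficients are their differences, so all but finitely many
  bases separate a finite set of vectors.\<close>

lemma distinct_weights:
  fixes K :: "(nat \<Rightarrow>\<^sub>0 int) set"
  assumes "finite K" "\<And>m. m \<in> K \<Longrightarrow> Poly_Mapping.keys m \<subseteq> {..<n}"
  shows "\<exists>B::nat. inj_on (\<lambda>m. \<Sum>i<n. Poly_Mapping.lookup m i * int B ^ i) K"
proof -
  define p where "p m m' = (\<Sum>i<n. monom (Poly_Mapping.lookup m i - Poly_Mapping.lookup m' i) i)"
    for m m' :: "nat \<Rightarrow>\<^sub>0 int"
  have nz: "p m m' \<noteq> 0" if "m \<in> K" "m' \<in> K" "m \<noteq> m'" for m m'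
  proof
    assume "p m m' = 0"
    have "Poly_Mapping.lookup m i = Poly_Mapping.lookup m' i" for i
    proof (cases "i < n")
      case True
      have "coeff (p m m') i = Poly_Mapping.lookup m i - Poly_Mapping.lookup m' i"
        using True unfolding p_def coeff_sum by simp
      then show ?thesis
        using \<open>p m m' = 0\<close> by simp
    next
      case False
      then have "i \<notin> Poly_Mapping.keys m" "i \<notin> Poly_Mapping.keys m'"
        using assms(2)[OF that(1)] assms(2)[OF that(2)] by auto
      then show ?thesis
        by (simp add: in_keys_iff)
    qed
    then have "m = m'"
      by (rule poly_mapping_eqI)
    then show False
      using that(3) by contradiction
  qed
  define D where "D = {(m, m'). m \<in> K \<and> m' \<in> K \<and> m \<noteq> m'}"
  define F where "F = (\<Union>d\<in>D. {x. poly (p (fst d) (snd d)) x = 0})"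
  have "finite D"
    by (rule finite_subset[of _ "K \<times> K"]) (auto simp: D_def assms(1))
  then have "finite F"
    unfolding F_def
  proof (rule finite_UN_I)
    fix d assume "d \<in> D"
    then have "p (fst d) (snd d) \<noteq> 0"
      using nz by (auto simp: D_def)
    then show "finite {x. poly (p (fst d) (snd d)) x = 0}"
      by (rule poly_roots_finite)
  qed
  moreover have "infinite (range int)"
    by (rule range_inj_infinite) simp
  ultimately have "\<not> range int \<subseteq> F"
    using finite_subset by blast
  then obtain B :: nat where B: "int B \<notin> F"
    by blast
  show ?thesis
  proof (intro exI[of _ B] inj_onI)
    fix m m' assume m: "m \<in> K" "m' \<in> K"
      "(\<Sum>i<n. Poly_Mapping.lookup m i * int B ^ i) = (\<Sum>i<n. Poly_Mapping.lookup m' i * int B ^ i)"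
    show "m = m'"
    proof (rule ccontr)
      assume "m \<noteq> m'"
      then have "(m, m') \<in> D"
        using m by (simp add: D_def)
      then have "poly (p m m') (int B) \<noteq> 0"
        using B by (auto simp: F_def)
      moreover have "poly (p m m') (int B) = 0"
        using m(3) by (simp add: p_def poly_sum poly_monom left_diff_distrib sum_subtractf)
      ultimately show False
        by simp
    qed
  qed
qed

text \<open>Restricted to the curve on which variable \<open>i\<close> equals
  \<open>X ^ (B ^ i)\<close>, distinct monomials become distinct powers of \<open>X\<close>, so no
  coefficients merge. The shift by \<open>M\<close> makes all exponents natural numbers, and a real
  polynomial vanishing at every positive \<open>X\<close> is 0.\<close>

lemma laurent_vanishes:
  fixes L :: laurent
  assumes "in_vars n L"
    and zero: "\<And>u. (\<And>i. 0 < u i) \<Longrightarrow> lin_ext (monomial_map (\<lambda>i k. u i powi k)) L = (0::real)"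
  shows "L = 0"
proof (rule ccontr)
  assume "L \<noteq> 0"
  define K where "K = Poly_Mapping.keys L"
  have K: "finite K" "\<And>m. m \<in> K \<Longrightarrow> Poly_Mapping.keys m \<subseteq> {..<n}"
    using assms(1) by (auto simp: K_def in_vars_def)
  obtain B :: nat where B: "inj_on (\<lambda>m. \<Sum>i<n. Poly_Mapping.lookup m i * int B ^ i) K"
    using distinct_weights[OF K] by blast
  define w where "w m = (\<Sum>i<n. Poly_Mapping.lookup m i * int B ^ i)" for m :: "nat \<Rightarrow>\<^sub>0 int"
  define M where "M = (\<Sum>m\<in>K. \<bar>w m\<bar>)"
  have M: "0 \<le> w m + M" if "m \<in> K" for m
    using member_le_sum[of m K "\<lambda>m. \<bar>w m\<bar>"] that K(1) by (auto simp: M_def)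
  define P where "P = (\<Sum>m\<in>K. monom (real_of_int (Poly_Mapping.lookup L m)) (nat (w m + M)))"
  have root: "poly P X = 0" if X: "X > 0" for X :: real
  proof -
    define u where "u i = X ^ (B ^ i)" for i
    have mono: "monomial_map (\<lambda>i k. u i powi k) m = X powi w m" if "m \<in> K" for m
    proof -
      have "monomial_map (\<lambda>i k. u i powi k) m = (\<Prod>i<n. u i powi Poly_Mapping.lookup m i)"
        by (rule monomial_map_superset) (use K(2)[OF that] in auto)
      also have "\<dots> = (\<Prod>i<n. X powi (Poly_Mapping.lookup m i * int B ^ i))"
      proof (intro prod.cong refl)
        fix i
        have "u i = X powi int (B ^ i)"
          unfolding u_def by (rule power_int_of_nat[symmetric])
        then show "u i powi Poly_Mapping.lookup m i = X powi (Poly_Mapping.lookup m i * int B ^ i)"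
          by (simp only: power_int_mult mult.commute[of "Poly_Mapping.lookup m i"] of_nat_power)
      qed
      also have "\<dots> = X powi w m"
        unfolding w_def using X by (induction n) (auto simp: power_int_add)
      finally show ?thesis .
    qed
    have "poly P X = (\<Sum>m\<in>K. of_int (Poly_Mapping.lookup L m) * X ^ nat (w m + M))"
      by (simp add: P_def poly_sum poly_monom)
    also have "\<dots> = (\<Sum>m\<in>K. X powi M * (of_int (Poly_Mapping.lookup L m) * X powi w m))"
    proof (intro sum.cong refl)
      fix m assume "m \<in> K"
      then have "X ^ nat (w m + M) = X powi (w m + M)"
        using M by (simp add: power_int_def)
      also have "\<dots> = X powi M * X powi w m"
        using X by (simp add: power_int_add)
      finally show "of_int (Poly_Mapping.lookup L m) * X ^ nat (w m + M)
          = X powi M * (of_int (Poly_Mapping.lookup L m) * X powi w m)"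
        by simp
    qed
    also have "\<dots> = X powi M * lin_ext (monomial_map (\<lambda>i k. u i powi k)) L"
      unfolding lin_ext_def by (simp add: K_def[symmetric] mono sum_distrib_left)
    also have "\<dots> = 0"
      using zero[of u] X by (simp add: u_def)
    finally show ?thesis .
  qed
  obtain m0 where m0: "m0 \<in> K"
    using \<open>L \<noteq> 0\<close> unfolding K_def by (metis all_not_in_conv keys_eq_empty)
  have "coeff P (nat (w m0 + M)) = (\<Sum>m\<in>K. if m = m0 then real_of_int (Poly_Mapping.lookup L m) else 0)"
    unfolding P_def coeff_sum
  proof (intro sum.cong refl)
    fix m assume m: "m \<in> K"
    then have "nat (w m + M) = nat (w m0 + M) \<longleftrightarrow> m = m0"
      using M[OF m] M[OF m0] inj_onD[OF B, folded w_def, of m m0] m0 by auto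
    then show "coeff (monom (real_of_int (Poly_Mapping.lookup L m)) (nat (w m + M))) (nat (w m0 + M))
        = (if m = m0 then real_of_int (Poly_Mapping.lookup L m) else 0)"
      by simp
  qed
  also have "\<dots> = Poly_Mapping.lookup L m0"
    using K(1) m0 by simp
  finally have "P \<noteq> 0"
    using m0 by (auto simp: K_def in_keys_iff)
  then have "finite {X. poly P X = 0}"
    by (rule poly_roots_finite)
  then have "finite {0::real<..}"
    by (rule rev_finite_subset) (use root in auto)
  then show False
    by (simp add: infinite_Ioi)
qed

section \<open>Laurent expansions and specialisations\<close>

text \<open>If \<open>A\<close> is a submonoid of the exponents, this selects a subring. The
  instances are exponents in the first \<open>n\<close> variables, exponents vanishing at one index,
  and nonnegative exponents.\<close>

definition supported :: "'m set \<Rightarrow> ('m \<Rightarrow>\<^sub>0 int) \<Rightarrow> bool" where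
  "supported A f \<longleftrightarrow> Poly_Mapping.keys f \<subseteq> A"

lemma supported_0 [simp]: "supported A 0"
  by (simp add: supported_def)

lemma supported_add: "supported A f \<Longrightarrow> supported A g \<Longrightarrow> supported A (f + g)"
  using Poly_Mapping.keys_add[of f g] by (auto simp: supported_def)

lemma supported_diff: "supported A f \<Longrightarrow> supported A g \<Longrightarrow> supported A (f - g)"
  using keys_diff[of f g] by (auto simp: supported_def)

lemma supported_sum: "(\<And>x. x \<in> X \<Longrightarrow> supported A (f x)) \<Longrightarrow> supported A (sum f X)"
  by (induction X rule: infinite_finite_induct) (auto intro: supported_add)

lemma supported_single: "m \<in> A \<Longrightarrow> supported A (Poly_Mapping.single m c)"
  by (simp add: supported_def)

lemma supported_of_int: "0 \<in> A \<Longrightarrow> supported A (of_int c)"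
  by (metis single_of_int supported_single)

lemma supported_1:
  fixes A :: "'m::monoid_add set"
  shows "0 \<in> A \<Longrightarrow> supported A 1"
  using supported_of_int[of A 1] by simp

lemma supported_mult:
  assumes "\<And>a b. a \<in> A \<Longrightarrow> b \<in> A \<Longrightarrow> a + b \<in> A" "supported A f" "supported A g"
  shows "supported A (f * g)"
  using assms keys_mult[of f g] by (fastforce simp: supported_def)

lemma supported_prod:
  fixes A :: "'m::comm_monoid_add set"
  assumes "\<And>a b. a \<in> A \<Longrightarrow> b \<in> A \<Longrightarrow> a + b \<in> A" "0 \<in> A" "\<And>x. x \<in> X \<Longrightarrow> supported A (f x)"
  shows "supported A (prod f X)"
  using assms(3)
  by (induction X rule: infinite_finite_induct)
    (auto intro: supported_1 supported_mult assms(1,2))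

lemma laurent_eval_lin_ext: "laurent_eval y = lin_ext (monomial_map (\<lambda>i k. y i powi k))"
  by (simp add: fun_eq_iff laurent_eval_def lin_ext_def monomial_map_def)

lemma in_vars_supported: "in_vars n = supported {m. Poly_Mapping.keys m \<subseteq> {..<n}}"
  by (auto simp: fun_eq_iff in_vars_def supported_def)

lemma in_vars_mult:
  assumes "in_vars n L" "in_vars n L'"
  shows "in_vars n (L * L')"
proof -
  have "Poly_Mapping.keys (a + b) \<subseteq> {..<n}"
    if "Poly_Mapping.keys a \<subseteq> {..<n}" "Poly_Mapping.keys b \<subseteq> {..<n}" for a b :: "nat \<Rightarrow>\<^sub>0 int"
    using that Poly_Mapping.keys_add[of a b] by auto
  then show ?thesis
    using assms unfolding in_vars_supported by (intro supported_mult) auto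
qed

lemma in_vars_diff: "in_vars n L \<Longrightarrow> in_vars n L' \<Longrightarrow> in_vars n (L - L')"
  unfolding in_vars_supported by (rule supported_diff)

lemma in_vars_1: "in_vars n 1"
  unfolding in_vars_supported by (rule supported_1) simp

lemma in_vars_single: "i < n \<Longrightarrow> in_vars n (Poly_Mapping.single (Poly_Mapping.single i k) c)"
  unfolding in_vars_supported by (rule supported_single) simp

section \<open>Specialisation at signs as a ring homomorphism\<close>

definition special_power :: "(nat \<rightharpoonup> int) \<Rightarrow> nat \<Rightarrow> int \<Rightarrow> laurent" where
  "special_power \<sigma> i k = (case \<sigma> i of
      Some s \<Rightarrow> of_int (s ^ nat \<bar>k\<bar>)
    | None \<Rightarrow> Poly_Mapping.single (Poly_Mapping.single i k) 1)"

lemma specialise_lin_ext: "specialise \<sigma> = lin_ext (monomial_map (special_power \<sigma>))"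
  by (simp add: fun_eq_iff specialise_def lin_ext_def monomial_map_def special_power_def)

lemma special_power_0: "special_power \<sigma> i 0 = 1"
  by (simp add: special_power_def split: option.split)

text \<open>The integers \<open>a + b\<close> and \<open>\<bar>a\<bar> + \<bar>b\<bar>\<close> have
  the same parity, so the absolute value in \<open>specialise\<close> does not spoil
  multiplicativity.\<close>

lemma sign_power_abs_add:
  assumes "s \<in> {1, -1 :: int}"
  shows "s ^ nat \<bar>a + b\<bar> = s ^ nat \<bar>a\<bar> * s ^ nat \<bar>b\<bar>"
proof -
  have "even (nat \<bar>a + b\<bar>) \<longleftrightarrow> even (nat \<bar>a\<bar> + nat \<bar>b\<bar>)"
    by (auto simp: even_nat_iff)
  then show ?thesis
    using assms by (auto simp: minus_one_power_iff simp flip: power_add)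
qed

lemma special_power_add:
  assumes "specialisation n \<sigma>"
  shows "special_power \<sigma> i (a + b) = special_power \<sigma> i a * special_power \<sigma> i b"
proof (cases "\<sigma> i")
  case None
  then show ?thesis
    by (simp add: special_power_def mult_single single_add)
next
  case (Some s)
  then have "s \<in> {1, -1}"
    using assms by (auto simp: specialisation_def ran_def)
  then show ?thesis
    using Some by (simp add: special_power_def sign_power_abs_add)
qed

lemma specialise_diff: "specialise \<sigma> (L - L') = specialise \<sigma> L - specialise \<sigma> L'"
  by (simp add: specialise_lin_ext lin_ext_diff)

lemma specialise_1: "specialise \<sigma> 1 = 1"
  by (simp add: specialise_lin_ext lin_ext_1)

lemma specialise_mult:
  assumes "specialisation n \<sigma>"
  shows "specialise \<sigma> (L * L') = specialise \<sigma> L * specialise \<sigma> L'"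
  unfolding specialise_lin_ext
  by (intro lin_ext_mult monomial_map_add special_power_0 special_power_add[OF assms])

lemma specialise_var:
  "specialise \<sigma> (Poly_Mapping.single (Poly_Mapping.single i 1) 1) = special_power \<sigma> i 1"
  by (simp add: specialise_lin_ext monomial_map_single special_power_0)

text \<open>Polyamory constrains only the exponents of unspecialised variables below
  \<open>n\<close>. All other exponents being zero, it amounts to \<open>nonneg_exponents\<close>,
  which is stable under ring operations.\<close>

lemma specialise_exponents:
  assumes "in_vars n L" "m \<in> Poly_Mapping.keys (specialise \<sigma> L)" "i \<notin> {..<n} - dom \<sigma>"
  shows "Poly_Mapping.lookup m i = 0"
proof -
  let ?A = "{m :: nat \<Rightarrow>\<^sub>0 int. Poly_Mapping.lookup m i = 0}"
  have add: "\<And>a b. a \<in> ?A \<Longrightarrow> b \<in> ?A \<Longrightarrow> a + b \<in> ?A"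
    by (simp add: lookup_add)
  have "supported ?A (specialise \<sigma> L)"
    unfolding specialise_lin_ext lin_ext_def monomial_map_def
  proof (intro supported_sum supported_mult supported_prod add supported_of_int)
    fix m j assume m: "m \<in> Poly_Mapping.keys L" and j: "j \<in> Poly_Mapping.keys m"
    then have "j < n"
      using assms(1) by (auto simp: in_vars_def)
    then have "j \<noteq> i \<or> j \<in> dom \<sigma>"
      using assms(3) by auto
    then show "supported ?A (special_power \<sigma> j (Poly_Mapping.lookup m j))"
      by (auto simp: special_power_def lookup_single when_def simp del: of_int_power
          intro!: supported_of_int supported_single split: option.split)
  qed simp_all
  then show ?thesis
    using assms(2) by (auto simp: supported_def)
qed

section \<open>Evaluation of polynomials at integers\<close>

lemma poly_eval_lin_ext: "poly_eval t = lin_ext (monomial_map (\<lambda>i k. t i ^ nat k))"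
  by (simp add: fun_eq_iff poly_eval_def lin_ext_def monomial_map_def)

definition nonneg_exponents :: "laurent \<Rightarrow> bool" where
  "nonneg_exponents = supported {m. \<forall>i. 0 \<le> Poly_Mapping.lookup m i}"

lemma poly_eval_mult:
  assumes "nonneg_exponents f" "nonneg_exponents g"
  shows "poly_eval t (f * g) = poly_eval t f * poly_eval t g"
  unfolding poly_eval_lin_ext using assms
  by (intro lin_ext_mult monomial_map_add)
    (auto simp: nonneg_exponents_def supported_def nat_add_distrib power_add subset_iff)

lemma poly_eval_add: "poly_eval t (f + g) = poly_eval t f + poly_eval t g"
  by (simp add: poly_eval_lin_ext lin_ext_add)

lemma poly_eval_of_int: "poly_eval t (of_int c) = c"
  by (simp add: poly_eval_lin_ext lin_ext_of_int)

lemma poly_eval_1: "poly_eval t 1 = 1"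
  using poly_eval_of_int[of t 1] by simp

lemma poly_eval_var: "poly_eval t (Poly_Mapping.single (Poly_Mapping.single i 1) 1) = t i"
  by (simp add: poly_eval_lin_ext monomial_map_single)

lemma nonneg_exponents_of_int: "nonneg_exponents (of_int c)"
  unfolding nonneg_exponents_def by (rule supported_of_int) simp

lemma nonneg_exponents_1: "nonneg_exponents 1"
  unfolding nonneg_exponents_def by (rule supported_1) simp

lemma nonneg_exponents_0: "nonneg_exponents 0"
  by (simp add: nonneg_exponents_def)

lemma nonneg_exponents_add: "nonneg_exponents f \<Longrightarrow> nonneg_exponents g \<Longrightarrow> nonneg_exponents (f + g)"
  unfolding nonneg_exponents_def by (rule supported_add)

lemma nonneg_exponents_diff: "nonneg_exponents f \<Longrightarrow> nonneg_exponents g \<Longrightarrow> nonneg_exponents (f - g)"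
  unfolding nonneg_exponents_def by (rule supported_diff)

lemma nonneg_exponents_mult: "nonneg_exponents f \<Longrightarrow> nonneg_exponents g \<Longrightarrow> nonneg_exponents (f * g)"
  unfolding nonneg_exponents_def by (rule supported_mult) (auto simp: lookup_add)

lemma nonneg_exponents_var: "nonneg_exponents (Poly_Mapping.single (Poly_Mapping.single i 1) 1)"
  unfolding nonneg_exponents_def
  by (rule supported_single) (simp add: lookup_single when_def)

section \<open>The Laurent ring of a seed\<close>

locale seed_in =
  fixes n :: nat and Q R :: quiver and y :: "nat \<Rightarrow> ratfun"
  assumes seed: "(R, y) \<in> seeds n Q"
    and loopless: "\<And>i. i < n \<Longrightarrow> Q i i = 0"
begin

lemma generic_values:
  assumes "\<And>i. 0 < u i"
  obtains v where "\<And>i. i < n \<Longrightarrow> evaluates v (y i) (u i)"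
  using seeds_evaluates[where u = u, OF seed loopless assms] by auto

lemma y_nonzero: "i < n \<Longrightarrow> y i \<noteq> 0"
  using generic_values[of "\<lambda>_. 1", OF zero_less_one] evaluates_nonzero zero_neq_one by metis

lemma inj_y: "inj_on y {..<n}"
proof (rule inj_onI)
  fix i j assume ij: "i \<in> {..<n}" "j \<in> {..<n}" "y i = y j"
  define u where "u = (\<lambda>k. if k = i then 2 else 1 :: real)"
  have "0 < u k" for k
    by (simp add: u_def)
  then obtain v where v: "\<And>k. k < n \<Longrightarrow> evaluates v (y k) (u k)"
    using generic_values by blast
  have "u i = u j"
    using v[of i] v[of j] ij evaluates_unique by auto
  then show "i = j"
    by (auto simp: u_def split: if_splits)
qed

lemma laurent_eval_mult:
  assumes "in_vars n L" "in_vars n L'"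
  shows "laurent_eval y (L * L') = laurent_eval y L * laurent_eval y L'"
  unfolding laurent_eval_lin_ext
proof (intro lin_ext_mult monomial_map_add)
  fix m m' i
  assume "m \<in> Poly_Mapping.keys L" "m' \<in> Poly_Mapping.keys L'"
  then have "Poly_Mapping.keys m \<subseteq> {..<n}" "Poly_Mapping.keys m' \<subseteq> {..<n}"
    using assms by (auto simp: in_vars_def)
  then have "i < n \<or> Poly_Mapping.lookup m i = 0 \<and> Poly_Mapping.lookup m' i = 0"
    by (auto simp: in_keys_iff subset_iff)
  then show "y i powi (Poly_Mapping.lookup m i + Poly_Mapping.lookup m' i)
      = y i powi Poly_Mapping.lookup m i * y i powi Poly_Mapping.lookup m' i"
    using y_nonzero by (auto simp: power_int_add)
qed simp

lemma laurent_eval_diff: "laurent_eval y (L - L') = laurent_eval y L - laurent_eval y L'"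
  by (simp add: laurent_eval_lin_ext lin_ext_diff)

lemma laurent_eval_1: "laurent_eval y 1 = 1"
  by (simp add: laurent_eval_lin_ext lin_ext_1)

lemma laurent_eval_var: "laurent_eval y (Poly_Mapping.single (Poly_Mapping.single i k) 1) = y i powi k"
  by (simp add: laurent_eval_lin_ext monomial_map_single)

text \<open>A Laurent relation among the variables of a seed would hold at every positive real
  point, because \<open>generic_values\<close> realises each such point;
  \<open>laurent_vanishes\<close> then makes it trivial.\<close>

lemma laurent_eval_inj:
  assumes "in_vars n L" "in_vars n L'" "laurent_eval y L = laurent_eval y L'"
  shows "L = L'"
proof -
  have vars: "in_vars n (L - L')"
    using assms in_vars_diff by blast
  have "L - L' = 0"
  proof (rule laurent_vanishes[OF vars])
    fix u :: "nat \<Rightarrow> real" assume u: "\<And>i. 0 < u i"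
    obtain v where v: "\<And>i. i < n \<Longrightarrow> evaluates v (y i) (u i)"
      using generic_values u by blast
    have "evaluates v (lin_ext (monomial_map (\<lambda>i k. y i powi k)) (L - L'))
        (lin_ext (monomial_map (\<lambda>i k. u i powi k)) (L - L'))"
      unfolding lin_ext_def monomial_map_def
    proof (intro evaluates_sum evaluates_mult evaluates_of_int evaluates_prod evaluates_powi v)
      fix m i assume "m \<in> Poly_Mapping.keys (L - L')" "i \<in> Poly_Mapping.keys m"
      then show "i < n"
        using vars by (auto simp: in_vars_def)
    next
      fix i show "u i \<noteq> 0"
        using u[of i] by simp
    qed
    moreover have "lin_ext (monomial_map (\<lambda>i k. y i powi k)) (L - L') = 0"
      using assms(3) laurent_eval_diff[of L L'] by (simp add: laurent_eval_lin_ext)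
    ultimately show "lin_ext (monomial_map (\<lambda>i k. u i powi k)) (L - L') = (0 :: real)"
      using evaluates_unique[OF _ evaluates_0] by simp
  qed
  then show ?thesis
    by simp
qed

text \<open>On this subring \<open>laurent_expansion\<close> inverts \<open>laurent_eval y\<close>
  and is therefore a ring homomorphism. Outside it the definite description is unspecified, so
  membership has to be tracked.\<close>

definition laurent_ring :: "ratfun set" where
  "laurent_ring = laurent_eval y ` {L. in_vars n L}"

lemma laurent_expansion_eval: "in_vars n L \<Longrightarrow> laurent_expansion n y (laurent_eval y L) = L"
  unfolding laurent_expansion_def by (rule the_equality) (auto intro: laurent_eval_inj)

lemma laurent_ringE:
  assumes "a \<in> laurent_ring"
  obtains "in_vars n (laurent_expansion n y a)" "laurent_eval y (laurent_expansion n y a) = a"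
proof (rule that)
  obtain L where L: "in_vars n L" "a = laurent_eval y L"
    using assms unfolding laurent_ring_def by blast
  then show "in_vars n (laurent_expansion n y a)" "laurent_eval y (laurent_expansion n y a) = a"
    by (simp_all add: laurent_expansion_eval)
qed

lemma laurent_ringI: "in_vars n L \<Longrightarrow> laurent_eval y L = a \<Longrightarrow> a \<in> laurent_ring"
  by (auto simp: laurent_ring_def)

lemma laurent_expansionI: "in_vars n L \<Longrightarrow> laurent_eval y L = a \<Longrightarrow> laurent_expansion n y a = L"
  using laurent_expansion_eval by blast

lemma
  shows laurent_ring_1: "1 \<in> laurent_ring"
    and laurent_expansion_1: "laurent_expansion n y 1 = 1"
  by (rule laurent_ringI[OF in_vars_1 laurent_eval_1])
    (rule laurent_expansionI[OF in_vars_1 laurent_eval_1])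

lemma
  assumes "a \<in> laurent_ring" "b \<in> laurent_ring"
  shows laurent_ring_diff: "a - b \<in> laurent_ring"
    and laurent_expansion_diff:
      "laurent_expansion n y (a - b) = laurent_expansion n y a - laurent_expansion n y b"
    and laurent_ring_mult: "a * b \<in> laurent_ring"
    and laurent_expansion_mult:
      "laurent_expansion n y (a * b) = laurent_expansion n y a * laurent_expansion n y b"
proof -
  let ?L = "laurent_expansion n y a" and ?M = "laurent_expansion n y b"
  have L: "in_vars n ?L" "laurent_eval y ?L = a" and M: "in_vars n ?M" "laurent_eval y ?M = b"
    using laurent_ringE assms by blast+
  have 1: "in_vars n (?L - ?M)" "laurent_eval y (?L - ?M) = a - b"
    using L M by (auto simp: in_vars_diff laurent_eval_diff)
  have 2: "in_vars n (?L * ?M)" "laurent_eval y (?L * ?M) = a * b"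
    using L M by (auto simp: in_vars_mult laurent_eval_mult)
  show "a - b \<in> laurent_ring" "laurent_expansion n y (a - b) = ?L - ?M"
    "a * b \<in> laurent_ring" "laurent_expansion n y (a * b) = ?L * ?M"
    by (fact laurent_ringI[OF 1] laurent_expansionI[OF 1] laurent_ringI[OF 2] laurent_expansionI[OF 2])+
qed

lemma laurent_expansion_var:
  assumes "i < n"
  shows "laurent_expansion n y (y i) = Poly_Mapping.single (Poly_Mapping.single i 1) 1"
  by (rule laurent_expansionI) (simp_all add: in_vars_single assms laurent_eval_var)

lemma laurent_ring_powi: "i < n \<Longrightarrow> y i powi k \<in> laurent_ring"
  by (rule laurent_ringI[OF in_vars_single laurent_eval_var])

lemma laurent_ring_var: "i < n \<Longrightarrow> y i \<in> laurent_ring"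
  using laurent_ring_powi[of i 1] by simp

lemma laurent_ring_divide: "a \<in> laurent_ring \<Longrightarrow> i < n \<Longrightarrow> a / y i \<in> laurent_ring"
  using laurent_ring_mult[OF _ laurent_ring_powi[of i "- 1"]] by (simp add: divide_inverse)

lemma laurent_ring_0: "0 \<in> laurent_ring"
  using laurent_ring_diff[OF laurent_ring_1 laurent_ring_1] by simp

lemma laurent_ring_add: "a \<in> laurent_ring \<Longrightarrow> b \<in> laurent_ring \<Longrightarrow> a + b \<in> laurent_ring"
  using laurent_ring_diff[of a "0 - b"] laurent_ring_diff[of 0 b] by (simp add: laurent_ring_0)

lemma laurent_expansion_0: "laurent_expansion n y 0 = 0"
  using laurent_expansion_diff[OF laurent_ring_1 laurent_ring_1] by simp

lemma laurent_expansion_add: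
  assumes "a \<in> laurent_ring" "b \<in> laurent_ring"
  shows "laurent_expansion n y (a + b) = laurent_expansion n y a + laurent_expansion n y b"
  using laurent_expansion_diff[OF laurent_ring_add[OF assms] assms(2)] by (simp add: algebra_simps)

end

section \<open>Triangulations and flips\<close>

definition pairs :: "nat \<Rightarrow> (int \<times> int) set" where
  "pairs n = {(a, b). 0 \<le> a \<and> a < b \<and> b < int n + 3}"

definition sides :: "nat \<Rightarrow> (int \<times> int) set" where
  "sides n = {(a, b). 0 \<le> a \<and> a < b \<and> b < int n + 3 \<and> (b = a + 1 \<or> (a, b) = (0, int n + 2))}"

lemma pairs_eq: "pairs n = sides n \<union> diagonals n" "sides n \<inter> diagonals n = {}"
  by (auto simp: pairs_def sides_def diagonals_def)

lemma finite_pairs: "finite (pairs n)"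
  by (rule finite_subset[of _ "{0..int n + 3} \<times> {0..int n + 3}"]) (auto simp: pairs_def)

lemma finite_diagonals: "finite (diagonals n)"
  using finite_pairs[of n] by (simp add: pairs_eq)

lemma crossing_pair:
  "crossing (a, b) (c, d) \<longleftrightarrow> a < c \<and> c < b \<and> b < d \<or> c < a \<and> a < d \<and> d < b"
  by (simp add: crossing_def)

lemma crossing_commute: "crossing d e \<longleftrightarrow> crossing e d"
  by (cases d; cases e) (auto simp: crossing_pair)

lemma crossing_irrefl: "\<not> crossing d d"
  by (cases d) (auto simp: crossing_pair)

lemma side_not_crossing: "d \<in> sides n \<Longrightarrow> e \<in> pairs n \<Longrightarrow> \<not> crossing d e"
  by (auto simp: sides_def pairs_def crossing_pair)

text \<open>Keeping the polygon sides in the edge set gives every triangle all its edges in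
  \<open>E\<close>, so triangles and quadrilaterals at the boundary need no special treatment. Sides
  cross nothing, hence maximality is not affected.\<close>

definition triangulates :: "nat \<Rightarrow> (int \<times> int) set \<Rightarrow> bool" where
  "triangulates n E \<longleftrightarrow> sides n \<subseteq> E \<and> E \<subseteq> pairs n \<and>
     (\<forall>d\<in>E. \<forall>e\<in>E. \<not> crossing d e) \<and> (\<forall>d\<in>pairs n - E. \<exists>e\<in>E. crossing d e)"

lemma triangulation_iff:
  "triangulation n T \<longleftrightarrow> T \<subseteq> diagonals n \<and> triangulates n (sides n \<union> T)"
proof (cases "T \<subseteq> diagonals n")
  case True
  have sides: "\<not> crossing d e" "\<not> crossing e d" if "d \<in> sides n" "e \<in> sides n \<union> diagonals n" for d e
    using side_not_crossing[OF that(1), of e] that(2) crossing_commute[of d e] by (auto simp: pairs_eq)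
  have "pairs n - (sides n \<union> T) = diagonals n - T"
    using True pairs_eq[of n] by blast
  moreover have "(\<forall>d\<in>sides n \<union> T. \<forall>e\<in>sides n \<union> T. \<not> crossing d e) \<longleftrightarrow> (\<forall>d\<in>T. \<forall>e\<in>T. \<not> crossing d e)"
    using sides True by blast
  moreover have "(\<exists>e\<in>sides n \<union> T. crossing d e) \<longleftrightarrow> (\<exists>e\<in>T. crossing d e)" if "d \<in> diagonals n - T" for d
    using sides(2)[of _ d] that by blast
  ultimately show ?thesis
    unfolding triangulation_def triangulates_def using True pairs_eq(1)[of n] by auto
qed (simp add: triangulation_def)

lemma triangulates_triangulation:
  assumes "triangulates n E"
  shows "triangulation n (E - sides n)" "sides n \<union> (E - sides n) = E"
proof -
  show "sides n \<union> (E - sides n) = E"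
    using assms by (auto simp: triangulates_def)
  then show "triangulation n (E - sides n)"
    using assms pairs_eq[of n] by (auto simp: triangulation_iff triangulates_def)
qed

lemma triangulation_extends:
  assumes "D \<subseteq> diagonals n" "\<And>d e. d \<in> D \<Longrightarrow> e \<in> D \<Longrightarrow> \<not> crossing d e"
  shows "\<exists>T. triangulation n T \<and> D \<subseteq> T"
proof -
  define F where "F = {T. T \<subseteq> diagonals n \<and> D \<subseteq> T \<and> (\<forall>d\<in>T. \<forall>e\<in>T. \<not> crossing d e)}"
  have "finite F"
    by (rule finite_subset[of _ "Pow (diagonals n)"]) (auto simp: F_def finite_diagonals)
  moreover have "D \<in> F"
    using assms by (auto simp: F_def)
  ultimately obtain T where T: "T \<in> F" "\<And>T'. T' \<in> F \<Longrightarrow> T \<subseteq> T' \<Longrightarrow> T' = T"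
    using finite_has_maximal[of F] by blast
  have "\<exists>e\<in>T. crossing d e" if d: "d \<in> diagonals n - T" for d
  proof (rule ccontr)
    assume "\<not> (\<exists>e\<in>T. crossing d e)"
    then have "insert d T \<in> F"
      using T(1) d crossing_commute crossing_irrefl by (auto simp: F_def)
    then show False
      using T(2)[of "insert d T"] d by blast
  qed
  then show ?thesis
    using T(1) unfolding triangulation_def F_def by blast
qed

section \<open>The triangles on both sides of an edge\<close>

locale triangulated =
  fixes n :: nat and E :: "(int \<times> int) set"
  assumes triangulates: "triangulates n E"
begin

lemma in_pairs: "(a, b) \<in> E \<Longrightarrow> 0 \<le> a \<and> a < b \<and> b < int n + 3"
  using triangulates by (auto simp: triangulates_def pairs_def)

lemma side: "(a, b) \<in> sides n \<Longrightarrow> (a, b) \<in> E"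
  using triangulates by (auto simp: triangulates_def)

lemma noncrossing: "(a, b) \<in> E \<Longrightarrow> (c, d) \<in> E \<Longrightarrow> \<not> (a < c \<and> c < b \<and> b < d)"
  using triangulates unfolding triangulates_def by (metis crossing_pair)

lemma maximal:
  assumes "0 \<le> a" "a < b" "b < int n + 3" "(a, b) \<notin> E"
  obtains c d where "(c, d) \<in> E" "a < c \<and> c < b \<and> b < d \<or> c < a \<and> a < d \<and> d < b"
proof -
  have "(a, b) \<in> pairs n - E"
    using assms by (simp add: pairs_def)
  then obtain e where "e \<in> E" "crossing (a, b) e"
    using triangulates unfolding triangulates_def by blast
  then show ?thesis
    using that by (cases e) (auto simp: crossing_pair)
qed

text \<open>The apex is the last neighbour \<open>s\<close> of \<open>p\<close> before
  \<open>q\<close>. An element of \<open>E\<close> crossing \<open>(s, q)\<close> would cross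
  \<open>(p, q)\<close> or \<open>(p, s)\<close> unless it starts at \<open>p\<close>, and then it
  ends at a later neighbour.\<close>

lemma inner_apex:
  assumes pq: "(p, q) \<in> E" and "p + 1 < q"
  obtains s where "p < s" "s < q" "(p, s) \<in> E" "(s, q) \<in> E"
proof -
  define S where "S = {s. p < s \<and> s < q \<and> (p, s) \<in> E}"
  define s where "s = Max S"
  have bounds: "0 \<le> p" "q < int n + 3"
    using in_pairs[OF pq] by auto
  have "finite S"
    by (rule finite_subset[of _ "{p..q}"]) (auto simp: S_def)
  moreover have "p + 1 \<in> S"
    using side[of p "p + 1"] bounds assms(2) by (simp add: S_def sides_def)
  ultimately have s: "s \<in> S" and s_max: "\<And>x. x \<in> S \<Longrightarrow> x \<le> s"
    unfolding s_def using Max_in Max_ge by blast+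
  have "(s, q) \<in> E"
  proof (rule ccontr)
    assume "(s, q) \<notin> E"
    then obtain c d where cd: "(c, d) \<in> E" "s < c \<and> c < q \<and> q < d \<or> c < s \<and> s < d \<and> d < q"
      using maximal[of s q] s bounds by (auto simp: S_def)
    have ps: "(p, s) \<in> E" "p < s" "s < q"
      using s by (auto simp: S_def)
    have "\<not> (c = p \<and> s < d \<and> d < q)"
      using s_max[of d] cd(1) ps by (auto simp: S_def)
    then show False
      using noncrossing[OF pq cd(1)] noncrossing[OF cd(1) pq] noncrossing[OF ps(1) cd(1)] cd(2) ps
      by linarith
  qed
  then show ?thesis
    using s that by (auto simp: S_def)
qed

text \<open>Among the edges properly enclosing \<open>(p, q)\<close>, which include
  \<open>(0, n + 2)\<close>, a shortest one has an inner triangle. Its apex cannot separate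
  \<open>p\<close> from \<open>q\<close>, and by minimality \<open>(p, q)\<close> must be one of the
  two inner edges of that triangle.\<close>

lemma outer_apex:
  assumes pq: "(p, q) \<in> E" and "(p, q) \<noteq> (0, int n + 2)"
  obtains r where "q < r" "(q, r) \<in> E" "(p, r) \<in> E" | r where "r < p" "(r, p) \<in> E" "(r, q) \<in> E"
proof -
  define C where "C = (\<lambda>(u, v). (u, v) \<in> E \<and> u \<le> p \<and> q \<le> v \<and> (u, v) \<noteq> (p, q))"
  have bounds: "0 \<le> p" "p < q" "q < int n + 3"
    using in_pairs[OF pq] by auto
  have "C (0, int n + 2)"
    using side[of 0 "int n + 2"] bounds assms(2) by (auto simp: C_def sides_def)
  then obtain e where e: "C e" "\<And>e'. C e' \<Longrightarrow> nat (snd e - fst e) \<le> nat (snd e' - fst e')"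
    using ex_has_least_nat[of C _ "\<lambda>e. nat (snd e - fst e)"] by blast
  obtain u v where e_eq: "e = (u, v)"
    by (cases e)
  have uv: "(u, v) \<in> E" "u \<le> p" "q \<le> v" "(u, v) \<noteq> (p, q)"
    using e(1) by (auto simp: C_def e_eq)
  then obtain s where s: "u < s" "s < v" "(u, s) \<in> E" "(s, v) \<in> E"
    using inner_apex[of u v] bounds by force
  have not_C: "\<not> C (u, s)" "\<not> C (s, v)"
    using e(2)[of "(u, s)"] e(2)[of "(s, v)"] s by (auto simp: e_eq)
  have 1: "(u, s) = (p, q)" if "q \<le> s"
    using not_C(1) that s uv by (auto simp: C_def)
  have 2: "(s, v) = (p, q)" if "s \<le> p"
    using not_C(2) that s uv by (auto simp: C_def)
  have "s \<le> p \<or> q \<le> s"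
    using noncrossing[OF s(3) pq] noncrossing[OF pq s(4)] uv s bounds by force
  then show ?thesis
    using 1 2 s uv that bounds by auto
qed

text \<open>With corners named in increasing order, the common edge of the two triangles is
  \<open>(a, c)\<close> if the outer apex lies beyond \<open>q\<close> and \<open>(b, d)\<close> if
  it lies before \<open>p\<close>. This is the source of the two versions of all statements about
  flips.\<close>

lemma quad_around:
  assumes pq: "(p, q) \<in> E" and "(p, q) \<notin> sides n"
  obtains (ac) a b c d where "a < b" "b < c" "c < d" "(a, b) \<in> E" "(b, c) \<in> E" "(c, d) \<in> E" "(a, d) \<in> E"
      "(p, q) = (a, c)"
  | (bd) a b c d where "a < b" "b < c" "c < d" "(a, b) \<in> E" "(b, c) \<in> E" "(c, d) \<in> E" "(a, d) \<in> E"
      "(p, q) = (b, d)"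
proof -
  have "p + 1 < q" "(p, q) \<noteq> (0, int n + 2)"
    using assms(2) in_pairs[OF pq] by (auto simp: sides_def)
  then obtain s where "p < s" "s < q" "(p, s) \<in> E" "(s, q) \<in> E"
    using inner_apex[OF pq] by blast
  then show ?thesis
    using outer_apex[OF pq \<open>(p, q) \<noteq> _\<close>] that by metis
qed

end

lemma triangulatesI:
  assumes "sides n \<subseteq> E" "E \<subseteq> pairs n"
    and "\<And>a b c d. (a, b) \<in> E \<Longrightarrow> (c, d) \<in> E \<Longrightarrow> \<not> (a < c \<and> c < b \<and> b < d)"
    and "\<And>a b. 0 \<le> a \<Longrightarrow> a < b \<Longrightarrow> b < int n + 3 \<Longrightarrow> (a, b) \<notin> E \<Longrightarrow>
      \<exists>c d. (c, d) \<in> E \<and> (a < c \<and> c < b \<and> b < d \<or> c < a \<and> a < d \<and> d < b)"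
  shows "triangulates n E"
  unfolding triangulates_def
proof (intro conjI ballI assms(1,2))
  fix d e assume "d \<in> E" "e \<in> E"
  then show "\<not> crossing d e"
    using assms(3)[of "fst d" "snd d" "fst e" "snd e"] assms(3)[of "fst e" "snd e" "fst d" "snd d"]
    by (cases d; cases e) (auto simp: crossing_pair)
next
  fix d assume "d \<in> pairs n - E"
  then obtain p q where "(p, q) \<in> E" "crossing d (p, q)"
    using assms(4)[of "fst d" "snd d"] by (cases d) (auto simp: pairs_def crossing_pair)
  then show "\<exists>e\<in>E. crossing d e"
    by blast
qed

section \<open>Flips in a quadrilateral\<close>

locale quad = triangulated +
  fixes a b c d :: int
  assumes order: "a < b" "b < c" "c < d"
    and ab: "(a, b) \<in> E" and bc: "(b, c) \<in> E" and cd: "(c, d) \<in> E" and ad: "(a, d) \<in> E"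
begin

lemma diagonals_not_sides: "(a, c) \<in> diagonals n" "(b, d) \<in> diagonals n"
  using order in_pairs[OF ad] by (auto simp: diagonals_def)

lemma ac_or_bd: "\<not> ((a, c) \<in> E \<and> (b, d) \<in> E)"
  using noncrossing[of a c b d] order by auto

text \<open>For maximality only pairs that crossed \<open>(a, c)\<close> need a new obstacle. Such a
  pair, unless it is \<open>(b, d)\<close>, leaves the quadrilateral through a side, and all sides
  stay in the edge set.\<close>

lemma flip_ac:
  assumes "(a, c) \<in> E"
  shows "triangulates n (E - {(a, c)} \<union> {(b, d)})"
proof (rule triangulatesI)
  show "sides n \<subseteq> E - {(a, c)} \<union> {(b, d)}" "E - {(a, c)} \<union> {(b, d)} \<subseteq> pairs n"
    using diagonals_not_sides triangulates pairs_eq[of n] by (auto simp: triangulates_def)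
  have bd: "\<not> (b < p \<and> p < d \<and> d < q)" "\<not> (p < b \<and> b < q \<and> q < d)"
    if pq: "(p, q) \<in> E" "(p, q) \<noteq> (a, c)" for p q
    using noncrossing[OF pq(1) ad] noncrossing[OF ad pq(1)] noncrossing[OF ab pq(1)]
      noncrossing[OF pq(1) bc] noncrossing[OF pq(1) cd] order pq(2) by auto
  fix p q u v assume "(p, q) \<in> E - {(a, c)} \<union> {(b, d)}" "(u, v) \<in> E - {(a, c)} \<union> {(b, d)}"
  then show "\<not> (p < u \<and> u < q \<and> q < v)"
    using bd[of p q] bd[of u v] noncrossing[of p q u v] by auto
next
  fix u v assume uv: "0 \<le> u" "u < v" "v < int n + 3" "(u, v) \<notin> E - {(a, c)} \<union> {(b, d)}"
  show "\<exists>p q. (p, q) \<in> E - {(a, c)} \<union> {(b, d)} \<and> (u < p \<and> p < v \<and> v < q \<or> p < u \<and> u < q \<and> q < v)"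
  proof (cases "(u, v) \<in> E")
    case True
    then have "(u, v) = (a, c)"
      using uv by auto
    then show ?thesis
      using order by auto
  next
    case False
    then obtain p q where pq: "(p, q) \<in> E" "u < p \<and> p < v \<and> v < q \<or> p < u \<and> u < q \<and> q < v"
      using maximal uv by metis
    show ?thesis
    proof (cases "(p, q) = (a, c)")
      case True
      define F where "F = E - {(a, c)} \<union> {(b, d)}"
      have F: "(a, b) \<in> F" "(b, c) \<in> F" "(c, d) \<in> F" "(a, d) \<in> F"
        using ab bc cd ad order by (auto simp: F_def)
      have "u < a \<and> a < v \<and> v < c \<or> a < u \<and> u < c \<and> c < v" "\<not> (u = b \<and> v = d)"
        using True pq(2) uv(4) by auto
      then consider "u < a \<and> a < v \<and> v < d \<or> a < u \<and> u < d \<and> d < v"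
        | "a < u \<and> u < b \<and> b < v" | "u < c \<and> c < v \<and> v < d" | "b < u \<and> u < c \<and> c < v"
        using order by (smt (verit))
      then show ?thesis
        unfolding F_def[symmetric] using F by cases blast+
    qed (use pq in auto)
  qed
qed

lemma flip_bd:
  assumes "(b, d) \<in> E"
  shows "triangulates n (E - {(b, d)} \<union> {(a, c)})"
proof (rule triangulatesI)
  show "sides n \<subseteq> E - {(b, d)} \<union> {(a, c)}" "E - {(b, d)} \<union> {(a, c)} \<subseteq> pairs n"
    using diagonals_not_sides triangulates pairs_eq[of n] by (auto simp: triangulates_def)
  have ac: "\<not> (a < p \<and> p < c \<and> c < q)" "\<not> (p < a \<and> a < q \<and> q < c)"
    if pq: "(p, q) \<in> E" "(p, q) \<noteq> (b, d)" for p q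
    using noncrossing[OF pq(1) ad] noncrossing[OF ad pq(1)] noncrossing[OF ab pq(1)]
      noncrossing[OF bc pq(1)] noncrossing[OF pq(1) cd] order pq(2) by auto
  fix p q u v assume "(p, q) \<in> E - {(b, d)} \<union> {(a, c)}" "(u, v) \<in> E - {(b, d)} \<union> {(a, c)}"
  then show "\<not> (p < u \<and> u < q \<and> q < v)"
    using ac[of p q] ac[of u v] noncrossing[of p q u v] by auto
next
  fix u v assume uv: "0 \<le> u" "u < v" "v < int n + 3" "(u, v) \<notin> E - {(b, d)} \<union> {(a, c)}"
  show "\<exists>p q. (p, q) \<in> E - {(b, d)} \<union> {(a, c)} \<and> (u < p \<and> p < v \<and> v < q \<or> p < u \<and> u < q \<and> q < v)"
  proof (cases "(u, v) \<in> E")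
    case True
    then have "(u, v) = (b, d)"
      using uv by auto
    then show ?thesis
      using order by auto
  next
    case False
    then obtain p q where pq: "(p, q) \<in> E" "u < p \<and> p < v \<and> v < q \<or> p < u \<and> u < q \<and> q < v"
      using maximal uv by metis
    show ?thesis
    proof (cases "(p, q) = (b, d)")
      case True
      define F where "F = E - {(b, d)} \<union> {(a, c)}"
      have F: "(a, b) \<in> F" "(b, c) \<in> F" "(c, d) \<in> F" "(a, d) \<in> F"
        using ab bc cd ad order by (auto simp: F_def)
      have "u < b \<and> b < v \<and> v < d \<or> b < u \<and> u < d \<and> d < v" "\<not> (u = a \<and> v = c)"
        using True pq(2) uv(4) by auto
      then consider "u < a \<and> a < v \<and> v < d \<or> a < u \<and> u < d \<and> d < v"
        | "u < b \<and> b < v \<and> v < c" | "u < c \<and> c < v \<and> v < d" | "a < u \<and> u < b \<and> b < v"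
        using order by (smt (verit))
      then show ?thesis
        unfolding F_def[symmetric] using F by cases blast+
    qed (use pq in auto)
  qed
qed

end

text \<open>Every triangulation can be flipped into the fan at vertex 0: flipping the longest
  diagonal not incident to 0 produces a new diagonal at 0.\<close>
lemma triangulates_flip_induct:
  assumes E0: "triangulates n E0" "P E0"
    and ac: "\<And>E a b c d. quad n E a b c d \<Longrightarrow> (a, c) \<in> E \<Longrightarrow> P E \<Longrightarrow> P (E - {(a, c)} \<union> {(b, d)})"
    and bd: "\<And>E a b c d. quad n E a b c d \<Longrightarrow> (b, d) \<in> E \<Longrightarrow> P E \<Longrightarrow> P (E - {(b, d)} \<union> {(a, c)})"
    and E: "triangulates n E"
  shows "P E"
proof -
  \<comment> \<open>Undoing a flip of \<open>(b, d)\<close> is a flip of \<open>(a, c)\<close>, so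
    \<open>P\<close> is invariant in both directions. The path to the fan uses only flips of this
    kind; it is followed forwards from \<open>E0\<close> and backwards to \<open>E\<close>.\<close>
  have flip_back: "P (E - {(b, d)} \<union> {(a, c)}) \<longleftrightarrow> P E"
    if "quad n E a b c d" "(b, d) \<in> E" for E a b c d
  proof
    interpret quad n E a b c d
      by (fact that(1))
    assume P': "P (E - {(b, d)} \<union> {(a, c)})"
    have "quad n (E - {(b, d)} \<union> {(a, c)}) a b c d"
      by unfold_locales (use flip_bd[OF that(2)] order ab bc cd ad in auto)
    from ac[OF this _ P'] have "P ((E - {(b, d)} \<union> {(a, c)}) - {(a, c)} \<union> {(b, d)})"
      by simp
    also have "(E - {(b, d)} \<union> {(a, c)}) - {(a, c)} \<union> {(b, d)} = E"
      using ac_or_bd that(2) order by auto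
    finally show "P E" .
  next
    assume "P E"
    with that show "P (E - {(b, d)} \<union> {(a, c)})"
      by (rule bd)
  qed
  define fan where "fan = sides n \<union> {(0, q) | q. 0 < q \<and> q < int n + 3}"
  define off where "off E = {(p, q). (p, q) \<in> E \<and> 1 \<le> p \<and> p + 1 < q}" for E :: "(int \<times> int) set"
  have "P E \<longleftrightarrow> P fan" if "triangulates n E" for E
    using that
  proof (induction "card (off E)" arbitrary: E rule: less_induct)
    case less
    interpret triangulated n E
      by unfold_locales (fact less.prems)
    have fin: "finite (off E)"
      by (rule finite_subset[OF _ finite_pairs[of n]]) (use in_pairs in \<open>auto simp: off_def pairs_def\<close>)
    show ?case
    proof (cases "off E = {}")
      case True
      have "E \<subseteq> fan"
      proof
        fix e assume e: "e \<in> E"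
        obtain p q where pq: "e = (p, q)"
          by (cases e)
        then have "\<not> (1 \<le> p \<and> p + 1 < q)"
          using True e by (auto simp: off_def)
        then show "e \<in> fan"
          using in_pairs[of p q] e pq by (auto simp: fan_def sides_def)
      qed
      moreover have "fan \<subseteq> E"
      proof
        fix e assume e: "e \<in> fan"
        obtain p q where pq: "e = (p, q)"
          by (cases e)
        show "e \<in> E"
        proof (rule ccontr)
          assume "e \<notin> E"
          then have "p = 0" "0 < q" "q < int n + 3" "(p, q) \<notin> E"
            using e side by (auto simp: fan_def pq)
          show False
          proof (rule maximal)
            show "0 \<le> p" "p < q" "q < int n + 3" "(p, q) \<notin> E"
              by (simp_all add: \<open>p = 0\<close> \<open>0 < q\<close> \<open>q < int n + 3\<close> \<open>(p, q) \<notin> E\<close>[unfolded \<open>p = 0\<close>])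
          next
            fix c d assume "(c, d) \<in> E" "p < c \<and> c < q \<and> q < d \<or> c < p \<and> p < d \<and> d < q"
            then have "(c, d) \<in> off E"
              using in_pairs[of c d] \<open>p = 0\<close> by (auto simp: off_def)
            then show False
              using True by simp
          qed
        qed
      qed
      ultimately show ?thesis
        by simp
    next
      case False
      then obtain e where e: "e \<in> off E" "\<And>e'. e' \<in> off E \<Longrightarrow> snd e' - fst e' \<le> snd e - fst e"
        using fin Max_in[of "(\<lambda>e. snd e - fst e) ` off E"] Max_ge[of "(\<lambda>e. snd e - fst e) ` off E"]
        by fastforce
      obtain p q where e_eq: "e = (p, q)"
        by (cases e)
      have pq: "(p, q) \<in> E" "1 \<le> p" "p + 1 < q"
        using e(1) by (auto simp: e_eq off_def)
      have longest: "v - u \<le> q - p" if "(u, v) \<in> E" "1 \<le> u" "u + 1 < v" for u v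
        using e(2)[of "(u, v)"] that by (simp add: off_def e_eq)
      \<comment> \<open>The outer triangle of the longest such diagonal has its apex at 0, since
        otherwise it would contain a longer diagonal avoiding 0.\<close>
      have zero: "(0, p) \<in> E \<and> (0, q) \<in> E"
      proof (rule outer_apex[OF pq(1)])
        show "(p, q) \<noteq> (0, int n + 2)"
          using pq by auto
      next
        fix r assume "q < r" "(p, r) \<in> E"
        then show ?thesis
          using longest[of p r] pq by auto
      next
        fix r assume r: "r < p" "(r, p) \<in> E" "(r, q) \<in> E"
        then have "r = 0"
          using longest[of r q] pq in_pairs[OF r(2)] by force
        then show ?thesis
          using r by auto
      qed
      obtain s where s: "p < s" "s < q" "(p, s) \<in> E" "(s, q) \<in> E"
        by (rule inner_apex[OF pq(1,3)])
      interpret q: quad n E 0 p s q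
        by unfold_locales (use pq s zero in auto)
      let ?E = "E - {(p, q)} \<union> {(0, s)}"
      have "off ?E = off E - {(p, q)}"
        by (auto simp: off_def)
      then have "card (off ?E) < card (off E)"
        using card_Diff1_less[OF fin e(1)] by (simp only: e_eq)
      then have "P ?E \<longleftrightarrow> P fan"
        using less.hyps q.flip_bd[OF pq(1)] by blast
      then show ?thesis
        using flip_back[OF q.quad_axioms pq(1)] by blast
    qed
  qed
  then show ?thesis
    using E0 E by blast
qed

section \<open>The quiver of a triangulation\<close>

definition tri_arrow :: "int \<Rightarrow> int \<Rightarrow> int \<Rightarrow> int \<times> int \<Rightarrow> int \<times> int \<Rightarrow> bool" where
  "tri_arrow a b c f g \<longleftrightarrow>
     f = (a, b) \<and> g = (b, c) \<or> f = (b, c) \<and> g = (a, c) \<or> f = (a, c) \<and> g = (a, b)"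

text \<open>The sides of each triangle are joined by an oriented 3-cycle.\<close>
definition arrow :: "(int \<times> int) set \<Rightarrow> int \<times> int \<Rightarrow> int \<times> int \<Rightarrow> bool" where
  "arrow E f g \<longleftrightarrow>
     (\<exists>a b c. a < b \<and> b < c \<and> (a, b) \<in> E \<and> (b, c) \<in> E \<and> (a, c) \<in> E \<and> tri_arrow a b c f g)"

lemma arrow_asym: "arrow E f g \<Longrightarrow> \<not> arrow E g f"
  by (cases f; cases g) (auto simp: arrow_def tri_arrow_def)

lemma arrow_in: "arrow E f g \<Longrightarrow> f \<in> E \<and> g \<in> E"
  by (auto simp: arrow_def tri_arrow_def)

lemma ex_triple_disj:
  assumes "a < b" "b < c" "a' < b'" "b' < c'"
  shows "(\<exists>x y z :: 'a::order. x < y \<and> y < z \<and>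
      (A x y \<and> A y z \<and> A x z \<or> (x = a \<and> y = b \<and> z = c) \<or> (x = a' \<and> y = b' \<and> z = c')) \<and> t x y z)
    \<longleftrightarrow> (\<exists>x y z. x < y \<and> y < z \<and> A x y \<and> A y z \<and> A x z \<and> t x y z) \<or> t a b c \<or> t a' b' c'"
  using assms by blast

context quad
begin

text \<open>With any other apex over \<open>(a, c)\<close>, an edge of the triangle would cross a
  side of the quadrilateral.\<close>

lemma triangle_ac:
  assumes ac: "(a, c) \<in> E" and xyz: "x < y" "y < z"
  shows "(x, y) \<in> E \<and> (y, z) \<in> E \<and> (x, z) \<in> E \<longleftrightarrow>
    (x, y) \<in> E - {(a, c)} \<and> (y, z) \<in> E - {(a, c)} \<and> (x, z) \<in> E - {(a, c)} \<or>
    (x = a \<and> y = b \<and> z = c) \<or> (x = a \<and> y = c \<and> z = d)"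
proof
  assume E: "(x, y) \<in> E \<and> (y, z) \<in> E \<and> (x, z) \<in> E"
  have "z = d" if "x = a" "y = c"
    using E that noncrossing[of a z c d] noncrossing[of a d c z] cd ad xyz order by force
  moreover have False if "y = a" "z = c"
    using E that noncrossing[of x c a d] ad xyz order by force
  moreover have "y = b" if "x = a" "z = c"
    using E that noncrossing[of a b y c] noncrossing[of a y b c] ab bc xyz order by force
  ultimately show "(x, y) \<in> E - {(a, c)} \<and> (y, z) \<in> E - {(a, c)} \<and> (x, z) \<in> E - {(a, c)} \<or>
    (x = a \<and> y = b \<and> z = c) \<or> (x = a \<and> y = c \<and> z = d)"
    using E by auto
qed (use ac ab bc cd ad in auto)

lemma triangle_bd:
  assumes bd: "(b, d) \<in> E" and xyz: "x < y" "y < z"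
  shows "(x, y) \<in> E \<and> (y, z) \<in> E \<and> (x, z) \<in> E \<longleftrightarrow>
    (x, y) \<in> E - {(b, d)} \<and> (y, z) \<in> E - {(b, d)} \<and> (x, z) \<in> E - {(b, d)} \<or>
    (x = a \<and> y = b \<and> z = d) \<or> (x = b \<and> y = c \<and> z = d)"
proof
  assume E: "(x, y) \<in> E \<and> (y, z) \<in> E \<and> (x, z) \<in> E"
  have False if "x = b" "y = d"
    using E that noncrossing[of a d b z] ad xyz order by force
  moreover have "x = a" if "y = b" "z = d"
    using E that noncrossing[of x b a d] noncrossing[of a b x d] ab ad xyz order by force
  moreover have "y = c" if "x = b" "z = d"
    using E that noncrossing[of b c y d] noncrossing[of b y c d] bc cd xyz order by force
  ultimately show "(x, y) \<in> E - {(b, d)} \<and> (y, z) \<in> E - {(b, d)} \<and> (x, z) \<in> E - {(b, d)} \<or>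
    (x = a \<and> y = b \<and> z = d) \<or> (x = b \<and> y = c \<and> z = d)"
    using E by auto
qed (use bd ab bc cd ad in auto)

lemma arrow_ac:
  assumes "(a, c) \<in> E"
  shows "arrow E f g \<longleftrightarrow> arrow (E - {(a, c)}) f g \<or> tri_arrow a b c f g \<or> tri_arrow a c d f g"
proof -
  have "arrow E f g \<longleftrightarrow> (\<exists>x y z. x < y \<and> y < z \<and>
      ((x, y) \<in> E \<and> (y, z) \<in> E \<and> (x, z) \<in> E) \<and> tri_arrow x y z f g)"
    by (simp add: arrow_def)
  also have "\<dots> \<longleftrightarrow> (\<exists>x y z. x < y \<and> y < z \<and>
      ((x, y) \<in> E - {(a, c)} \<and> (y, z) \<in> E - {(a, c)} \<and> (x, z) \<in> E - {(a, c)} \<or>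
       (x = a \<and> y = b \<and> z = c) \<or> (x = a \<and> y = c \<and> z = d)) \<and> tri_arrow x y z f g)"
    by (simp only: triangle_ac[OF assms] cong: conj_cong)
  also have "\<dots> \<longleftrightarrow> arrow (E - {(a, c)}) f g \<or> tri_arrow a b c f g \<or> tri_arrow a c d f g"
    unfolding arrow_def using order by (intro ex_triple_disj) auto
  finally show ?thesis .
qed

lemma arrow_bd:
  assumes "(b, d) \<in> E"
  shows "arrow E f g \<longleftrightarrow> arrow (E - {(b, d)}) f g \<or> tri_arrow a b d f g \<or> tri_arrow b c d f g"
proof -
  have "arrow E f g \<longleftrightarrow> (\<exists>x y z. x < y \<and> y < z \<and>
      ((x, y) \<in> E \<and> (y, z) \<in> E \<and> (x, z) \<in> E) \<and> tri_arrow x y z f g)"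
    by (simp add: arrow_def)
  also have "\<dots> \<longleftrightarrow> (\<exists>x y z. x < y \<and> y < z \<and>
      ((x, y) \<in> E - {(b, d)} \<and> (y, z) \<in> E - {(b, d)} \<and> (x, z) \<in> E - {(b, d)} \<or>
       (x = a \<and> y = b \<and> z = d) \<or> (x = b \<and> y = c \<and> z = d)) \<and> tri_arrow x y z f g)"
    by (simp only: triangle_bd[OF assms] cong: conj_cong)
  also have "\<dots> \<longleftrightarrow> arrow (E - {(b, d)}) f g \<or> tri_arrow a b d f g \<or> tri_arrow b c d f g"
    unfolding arrow_def using order by (intro ex_triple_disj) auto
  finally show ?thesis .
qed

text \<open>A triangle containing two sides of the quadrilateral has one of its diagonals as third
  edge, and \<open>F\<close> contains neither.\<close>

lemma no_arrow_between_sides: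
  assumes "(a, c) \<notin> F" "(b, d) \<notin> F"
    and "f \<in> {(a, b), (b, c), (c, d), (a, d)}" "g \<in> {(a, b), (b, c), (c, d), (a, d)}"
  shows "\<not> arrow F f g"
proof
  assume "arrow F f g"
  then show False
    using assms order by (auto simp: arrow_def tri_arrow_def)
qed

end

text \<open>A flip of the diagonal \<open>j\<close> into \<open>j'\<close> within a quadrilateral with sides \<open>w, x, y, z\<close>, recorded
  by its effect on the quiver. Up to rotating \<open>w, x, y, z\<close>, the data of the inverse flip are the same.\<close>
locale flip =
  fixes n :: nat and E E' F :: "(int \<times> int) set" and j j' w x y z :: "int \<times> int"
  assumes triangulates_E: "triangulates n E" and triangulates_E': "triangulates n E'"
    and j: "j \<in> E" "j \<in> diagonals n" and j': "j' \<in> diagonals n" "j' \<notin> F"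
    and F: "F = E - {j}" and E': "E' = insert j' F"
    and distinct: "distinct [w, x, y, z]" "{w, x, y, z} \<subseteq> F"
    and no_arrow: "\<And>f g. f \<in> {w, x, y, z} \<Longrightarrow> g \<in> {w, x, y, z} \<Longrightarrow> \<not> arrow F f g"
    and arrow_E: "\<And>f g. arrow E f g \<longleftrightarrow> arrow F f g \<or> f = w \<and> g = x \<or> f = y \<and> g = z
        \<or> f \<in> {x, z} \<and> g = j \<or> f = j \<and> g \<in> {w, y}"
    and arrow_E': "\<And>f g. arrow E' f g \<longleftrightarrow> arrow F f g \<or> f = z \<and> g = w \<or> f = x \<and> g = y
        \<or> f \<in> {w, y} \<and> g = j' \<or> f = j' \<and> g \<in> {x, z}"
begin

text \<open>Paths of length two through \<open>j\<close> join only sides of the quadrilateral,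
  between which \<open>F\<close> has no arrows. There \<open>x -> j -> w\<close> cancels
  \<open>w -> x\<close>, \<open>z -> j -> y\<close> cancels \<open>y -> z\<close>, and
  \<open>x -> y\<close>, \<open>z -> w\<close> are created, as in the flipped triangles. Elsewhere
  nothing changes, and \<open>arrow_asym\<close> makes the truncated subtraction harmless.\<close>

lemma arrow_flip:
  assumes "f \<in> F" "g \<in> F"
  shows "(of_bool (arrow E' f g) :: nat) =
    (of_bool (arrow E f g) + of_bool (arrow E f j) * of_bool (arrow E j g)) -
    (of_bool (arrow E g f) + of_bool (arrow E g j) * of_bool (arrow E j f))"
proof -
  have jF: "\<not> arrow F h j" "\<not> arrow F j h" for h
    using arrow_in[of F h j] arrow_in[of F j h] F by blast+
  have nj: "f \<noteq> j" "g \<noteq> j" "f \<noteq> j'" "g \<noteq> j'" "w \<noteq> j" "x \<noteq> j" "y \<noteq> j" "z \<noteq> j"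
    using assms F j' distinct(2) by auto
  note arr = arrow_E arrow_E' jF nj
  show ?thesis
  proof (cases "f \<in> {w, x, y, z} \<and> g \<in> {w, x, y, z}")
    case True
    then have "f = w \<or> f = x \<or> f = y \<or> f = z" "g = w \<or> g = x \<or> g = y \<or> g = z"
      by auto
    moreover have "w \<noteq> x" "w \<noteq> y" "w \<noteq> z" "x \<noteq> y" "x \<noteq> z" "y \<noteq> z"
      using distinct(1) by auto
    note ne = this this[symmetric]
    moreover have "w \<noteq> j'" "x \<noteq> j'" "y \<noteq> j'" "z \<noteq> j'"
      using distinct(2) j' by auto
    ultimately show ?thesis
      by (elim disjE) (simp_all only: ne arr nj[symmetric] no_arrow insert_iff empty_iff simp_thms of_bool_eq
          mult_0 mult_0_right add_0 add_0_right diff_0_eq_0 add_0_right mult_1 diff_self_eq_0 minus_nat.diff_0)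
  next
    case False
    have "arrow E' f g \<longleftrightarrow> arrow F f g" "arrow E f g \<longleftrightarrow> arrow F f g" "arrow E g f \<longleftrightarrow> arrow F g f"
      "\<not> (arrow E f j \<and> arrow E j g)" "\<not> (arrow E g j \<and> arrow E j f)"
      using False by (auto simp: arr)
    then show ?thesis
      using arrow_asym[of F f g] by auto
  qed
qed

lemma arrow_flip_j:
  assumes "f \<in> F"
  shows "arrow E' f j' \<longleftrightarrow> arrow E j f" "arrow E' j' f \<longleftrightarrow> arrow E f j"
proof -
  have "\<not> arrow F h j" "\<not> arrow F j h" "\<not> arrow F h j'" "\<not> arrow F j' h" for h
    using arrow_in[of F h j] arrow_in[of F j h] arrow_in[of F h j'] arrow_in[of F j' h] F j' by blast+
  moreover have "f \<noteq> j" "f \<noteq> j'" "w \<noteq> j" "x \<noteq> j" "y \<noteq> j" "z \<noteq> j" "w \<noteq> j'" "x \<noteq> j'" "y \<noteq> j'" "z \<noteq> j'"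
    using assms F j' distinct(2) by auto
  ultimately show "arrow E' f j' \<longleftrightarrow> arrow E j f" "arrow E' j' f \<longleftrightarrow> arrow E f j"
    by (auto simp: arrow_E arrow_E')
qed

lemma arrow_to_j: "arrow E f j \<longleftrightarrow> f = x \<or> f = z"
  and arrow_from_j: "arrow E j f \<longleftrightarrow> f = w \<or> f = y"
proof -
  have "\<not> arrow F h j" "\<not> arrow F j h" for h
    using arrow_in[of F h j] arrow_in[of F j h] F by blast+
  moreover have "w \<noteq> j" "x \<noteq> j" "y \<noteq> j" "z \<noteq> j"
    using F distinct(2) by auto
  ultimately show "arrow E f j \<longleftrightarrow> f = x \<or> f = z" "arrow E j f \<longleftrightarrow> f = w \<or> f = y"
    by (auto simp: arrow_E)
qed

end

context quad
begin

lemma flip_from_ac: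
  assumes ac: "(a, c) \<in> E"
  shows "flip n E (insert (b, d) (E - {(a, c)})) (E - {(a, c)}) (a, c) (b, d) (a, b) (b, c) (c, d) (a, d)"
proof
  let ?F = "E - {(a, c)}" and ?E' = "insert (b, d) (E - {(a, c)})"
  show E': "triangulates n ?E'"
    using flip_ac[OF ac] by simp
  have bd: "(b, d) \<notin> E"
    using ac_or_bd ac by blast
  show "(b, d) \<notin> ?F"
    using bd by blast
  have sides: "{(a, b), (b, c), (c, d), (a, d)} \<subseteq> ?F"
    using ab bc cd ad order by auto
  interpret q: quad n ?E' a b c d
    by unfold_locales (use E' sides order in auto)
  have F: "?E' - {(b, d)} = ?F"
    using bd by blast
  fix f g
  show "arrow E f g \<longleftrightarrow> arrow ?F f g \<or> f = (a, b) \<and> g = (b, c) \<or> f = (c, d) \<and> g = (a, d)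
        \<or> f \<in> {(b, c), (a, d)} \<and> g = (a, c) \<or> f = (a, c) \<and> g \<in> {(a, b), (c, d)}"
    unfolding arrow_ac[OF ac] tri_arrow_def by blast
  show "arrow ?E' f g \<longleftrightarrow> arrow ?F f g \<or> f = (a, d) \<and> g = (a, b) \<or> f = (b, c) \<and> g = (c, d)
        \<or> f \<in> {(a, b), (c, d)} \<and> g = (b, d) \<or> f = (b, d) \<and> g \<in> {(b, c), (a, d)}"
    using q.arrow_bd[of f g] unfolding F tri_arrow_def by blast
  show "\<not> arrow ?F f g" if "f \<in> {(a, b), (b, c), (c, d), (a, d)}" "g \<in> {(a, b), (b, c), (c, d), (a, d)}"
    using no_arrow_between_sides[of ?F] bd that by blast
qed (use triangulates ac diagonals_not_sides order ab bc cd ad in auto)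

text \<open>The sides are listed one step further around than in \<open>flip_from_ac\<close>, so
  that \<open>w -> x\<close> and \<open>y -> z\<close> again lie in the two triangles at the flipped
  diagonal.\<close>

lemma flip_from_bd:
  assumes bd: "(b, d) \<in> E"
  shows "flip n E (insert (a, c) (E - {(b, d)})) (E - {(b, d)}) (b, d) (a, c) (b, c) (c, d) (a, d) (a, b)"
proof
  let ?F = "E - {(b, d)}" and ?E' = "insert (a, c) (E - {(b, d)})"
  show E': "triangulates n ?E'"
    using flip_bd[OF bd] by simp
  have ac: "(a, c) \<notin> E"
    using ac_or_bd bd by blast
  show "(a, c) \<notin> ?F"
    using ac by blast
  have sides: "{(a, b), (b, c), (c, d), (a, d)} \<subseteq> ?F"
    using ab bc cd ad order by auto
  interpret q: quad n ?E' a b c d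
    by unfold_locales (use E' sides order in auto)
  have F: "?E' - {(a, c)} = ?F"
    using ac by blast
  fix f g
  show "arrow E f g \<longleftrightarrow> arrow ?F f g \<or> f = (b, c) \<and> g = (c, d) \<or> f = (a, d) \<and> g = (a, b)
        \<or> f \<in> {(c, d), (a, b)} \<and> g = (b, d) \<or> f = (b, d) \<and> g \<in> {(b, c), (a, d)}"
    unfolding arrow_bd[OF bd] tri_arrow_def by blast
  show "arrow ?E' f g \<longleftrightarrow> arrow ?F f g \<or> f = (a, b) \<and> g = (b, c) \<or> f = (c, d) \<and> g = (a, d)
        \<or> f \<in> {(b, c), (a, d)} \<and> g = (a, c) \<or> f = (a, c) \<and> g \<in> {(c, d), (a, b)}"
    using q.arrow_ac[of f g] unfolding F tri_arrow_def by blast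
  show "\<not> arrow ?F f g" if "f \<in> {(b, c), (c, d), (a, d), (a, b)}" "g \<in> {(b, c), (c, d), (a, d), (a, b)}"
    using no_arrow_between_sides[of ?F] ac that by blast
qed (use triangulates bd diagonals_not_sides order ab bc cd ad in auto)

end

section \<open>Seeds labelled by triangulations\<close>

definition labelled ::
  "nat \<Rightarrow> (int \<times> int \<Rightarrow> ratfun) \<Rightarrow> seed \<Rightarrow> (int \<times> int) set \<Rightarrow> (nat \<Rightarrow> int \<times> int) \<Rightarrow> bool" where
  "labelled n X s E d \<longleftrightarrow> triangulates n E \<and> bij_betw d {..<n} (E - sides n) \<and>
     (\<forall>i<n. snd s i = X (d i)) \<and> (\<forall>i<n. \<forall>k<n. fst s i k = of_bool (arrow E (d i) (d k)))"

text \<open>Exchange products run over diagonals only. A polygon side contributes the factor 1, so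
  quadrilaterals at the boundary obey the same exchange relation as interior ones.\<close>

lemma prod_two_labels:
  fixes X :: "'e \<Rightarrow> 'a::comm_monoid_mult" and n :: nat
  assumes d: "bij_betw d {..<n} T" and "\<And>e. e \<in> S \<Longrightarrow> X e = 1"
    and "e1 \<in> S \<union> T" "e2 \<in> S \<union> T" "e1 \<noteq> e2"
  shows "(\<Prod>i<n. X (d i) ^ of_bool (d i = e1 \<or> d i = e2)) = X e1 * X e2"
proof -
  have fin: "finite T"
    using bij_betw_finite[OF d] by simp
  have "(\<Prod>i<n. X (d i) ^ of_bool (d i = e1 \<or> d i = e2)) = (\<Prod>e\<in>T. X e ^ of_bool (e = e1 \<or> e = e2))"
    by (rule prod.reindex_bij_betw[OF d])
  also have "\<dots> = (\<Prod>e\<in>T \<union> {e1, e2}. X e ^ of_bool (e = e1 \<or> e = e2))"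
    by (rule prod.mono_neutral_left) (use fin assms in auto)
  also have "\<dots> = (\<Prod>e\<in>{e1, e2}. X e ^ of_bool (e = e1 \<or> e = e2))"
    by (rule prod.mono_neutral_right) (use fin in auto)
  also have "\<dots> = X e1 * X e2"
    using assms(5) by simp
  finally show ?thesis .
qed

lemma (in flip) labelled_mutate:
  assumes lab: "labelled n X (R, v) E d" and k: "k < n" "d k = j"
    and sides: "\<And>e. e \<in> sides n \<Longrightarrow> X e = 1"
    and exchange: "X j * X j' = X w * X y + X x * X z" and nonzero: "X j \<noteq> 0"
  shows "labelled n X (mutate_seed n k (R, v)) E' (d(k := j'))"
proof -
  have d: "bij_betw d {..<n} (E - sides n)" and v: "\<And>i. i < n \<Longrightarrow> v i = X (d i)"
    and R: "\<And>i m. i < n \<Longrightarrow> m < n \<Longrightarrow> R i m = of_bool (arrow E (d i) (d m))"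
    using lab by (auto simp: labelled_def)
  have inj: "inj_on d {..<n}" and img: "d ` {..<n} = E - sides n"
    using d by (auto simp: bij_betw_def)
  have dF: "d i \<in> F" if "i < n" "i \<noteq> k" for i
    using that k inj img F unfolding inj_on_def by blast
  have j_side: "j \<notin> sides n" "j' \<notin> sides n"
    using j j' pairs_eq[of n] by auto
  have "bij_betw (d(k := j')) {..<n} (E' - sides n)"
  proof -
    have "bij_betw d ({..<n} - {k}) (E - sides n - {j})"
      using d k by (intro bij_betw_DiffI) (auto simp: bij_betw_def)
    then have "bij_betw (d(k := j')) ({..<n} - {k}) (E - sides n - {j})"
      by (rule bij_betw_cong[THEN iffD1, rotated]) auto
    then have "bij_betw (d(k := j')) (({..<n} - {k}) \<union> {k}) ((E - sides n - {j}) \<union> {j'})"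
      using j' F by (intro bij_betw_combine) (auto simp: bij_betw_def)
    moreover have "({..<n} - {k}) \<union> {k} = {..<n}"
      using k by auto
    moreover have "(E - sides n - {j}) \<union> {j'} = E' - sides n"
      using j_side E' F by auto
    ultimately show ?thesis
      by simp
  qed
  moreover have "snd (mutate_seed n k (R, v)) i = X ((d(k := j')) i)" if "i < n" for i
  proof (cases "i = k")
    case True
    have "F \<subseteq> sides n \<union> (E - sides n)"
      using F by auto
    then have in_E: "w \<in> sides n \<union> (E - sides n)" "x \<in> sides n \<union> (E - sides n)"
      "y \<in> sides n \<union> (E - sides n)" "z \<in> sides n \<union> (E - sides n)"
      using distinct(2) by auto
    have "(\<Prod>i<n. v i ^ R i k) = (\<Prod>i<n. X (d i) ^ of_bool (d i = x \<or> d i = z))"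
      using k by (intro prod.cong refl) (simp add: v R arrow_to_j)
    also have "\<dots> = X x * X z"
      by (rule prod_two_labels[OF d sides]) (use in_E distinct in auto)
    finally have 1: "(\<Prod>i<n. v i ^ R i k) = X x * X z" .
    have "(\<Prod>i<n. v i ^ R k i) = (\<Prod>i<n. X (d i) ^ of_bool (d i = w \<or> d i = y))"
      using k by (intro prod.cong refl) (simp add: v R arrow_from_j)
    also have "\<dots> = X w * X y"
      by (rule prod_two_labels[OF d sides]) (use in_E distinct in auto)
    finally have 2: "(\<Prod>i<n. v i ^ R k i) = X w * X y" .
    have "(X x * X z + X w * X y) / X j = X j'"
      using exchange nonzero by (simp add: field_simps)
    then show ?thesis
      using True v[OF k(1)] k(2) by (simp add: mutate_seed_def 1 2)
  qed (use that v in \<open>simp add: mutate_seed_def\<close>)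
  moreover have "fst (mutate_seed n k (R, v)) i m = of_bool (arrow E' ((d(k := j')) i) ((d(k := j')) m))"
    if im: "i < n" "m < n" for i m
  proof -
    have irrefl: "\<not> arrow E f f" "\<not> arrow E' f f" for f
      using arrow_asym by blast+
    consider "i \<noteq> k" "m \<noteq> k" | "i = k" "m \<noteq> k" | "i \<noteq> k" "m = k" | "i = k" "m = k"
      by blast
    then show ?thesis
    proof cases
      case 1
      then show ?thesis
        using arrow_flip[OF dF dF, of i m] im k by (simp add: mutate_seed_def mutate_quiver_def R)
    next
      case 2
      then show ?thesis
        using arrow_flip_j[OF dF, of m] im k by (simp add: mutate_seed_def mutate_quiver_def R)
    next
      case 3
      then show ?thesis
        using arrow_flip_j[OF dF, of i] im k by (simp add: mutate_seed_def mutate_quiver_def R)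
    next
      case 4
      then show ?thesis
        using irrefl im k by (simp add: mutate_seed_def mutate_quiver_def R)
    qed
  qed
  ultimately show ?thesis
    using triangulates_E' by (simp add: labelled_def)
qed

section \<open>The initial triangulation\<close>

text \<open>Quiver vertex \<open>k\<close> will label interval \<open>Suc k\<close>, so step
  \<open>l\<close> is dictated by the arrow between vertices \<open>l - 1\<close> and
  \<open>l\<close>. At \<open>0\<close> the predicate is false and the first diagonal is
  \<open>(1, n + 2)\<close>; step \<open>n\<close> leads to a polygon side for either
  outcome.\<close>

definition step_down :: "quiver \<Rightarrow> nat \<Rightarrow> bool" where
  "step_down Q l \<longleftrightarrow> (\<exists>k. l = Suc k \<and> Q k l = 1)"

text \<open>Nested intervals, each obtained by dropping one end of the previous one. The orientation of
  the arrow between two consecutive diagonals tells which end is dropped.\<close>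
fun zigzag :: "nat \<Rightarrow> quiver \<Rightarrow> nat \<Rightarrow> int \<times> int" where
  "zigzag n Q 0 = (0, int n + 2)"
| "zigzag n Q (Suc l) = (if step_down Q l then (fst (zigzag n Q l), snd (zigzag n Q l) - 1)
     else (fst (zigzag n Q l) + 1, snd (zigzag n Q l)))"

declare zigzag.simps(2) [simp del]

context
  fixes n :: nat and Q :: quiver
begin

abbreviation (input) lo :: "nat \<Rightarrow> int" where "lo l \<equiv> fst (zigzag n Q l)"
abbreviation (input) hi :: "nat \<Rightarrow> int" where "hi l \<equiv> snd (zigzag n Q l)"

definition zigzag_edges :: "(int \<times> int) set" where
  "zigzag_edges = sides n \<union> zigzag n Q ` {..n}"

lemma zigzag_length: "hi l - lo l = int n + 2 - int l"
  by (induction l) (auto simp: zigzag.simps(2))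

lemma zigzag_mono: "l \<le> l' \<Longrightarrow> lo l \<le> lo l' \<and> hi l' \<le> hi l"
  by (induction l' rule: dec_induct) (auto simp: zigzag.simps(2))

lemma zigzag_bounds: "0 \<le> lo l" "hi l \<le> int n + 2"
  using zigzag_mono[of 0 l] by auto

lemma zigzag_inj: "zigzag n Q l = zigzag n Q l' \<longleftrightarrow> l = l'"
proof
  assume "zigzag n Q l = zigzag n Q l'"
  then have "int n + 2 - int l = int n + 2 - int l'"
    unfolding zigzag_length[symmetric] by simp
  then show "l = l'"
    by simp
qed simp

lemma zigzag_last: "zigzag n Q (Suc n) \<in> sides n"
proof -
  have "hi (Suc n) = lo (Suc n) + 1"
    using zigzag_length[of "Suc n"] by linarith
  then show ?thesis
    using zigzag_bounds[of "Suc n"] by (simp add: sides_def case_prod_beta)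
qed

lemma zigzag_in_edges: "l \<le> Suc n \<Longrightarrow> zigzag n Q l \<in> zigzag_edges"
  using zigzag_last by (cases "l = Suc n") (auto simp: zigzag_edges_def)

lemma zigzag_diagonal: "l < n \<Longrightarrow> zigzag n Q (Suc l) \<in> diagonals n"
proof -
  assume "l < n"
  then have "lo (Suc l) + 2 \<le> hi (Suc l)" "hi (Suc l) - lo (Suc l) < int n + 2"
    unfolding zigzag_length using zigzag_length[of "Suc l"] by linarith+
  then show ?thesis
    using zigzag_bounds[of "Suc l"]
    by (auto simp: diagonals_def case_prod_beta prod_eq_iff)
qed

lemma zigzag_edges_cases:
  assumes "(p, q) \<in> zigzag_edges"
  obtains "0 \<le> p" "q = p + 1" "q < int n + 3" | l where "l \<le> n" "p = lo l" "q = hi l"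
proof (cases "(p, q) \<in> zigzag n Q ` {..n}")
  case True
  then show ?thesis
    using that(2) by (metis atMost_iff fst_conv imageE snd_conv)
next
  case False
  then have "(p, q) \<in> sides n" "(p, q) \<noteq> zigzag n Q 0"
    using assms unfolding zigzag_edges_def by force+
  then show ?thesis
    using that(1) by (auto simp: sides_def)
qed

lemma triangulates_zigzag: "triangulates n zigzag_edges"
proof (rule triangulatesI)
  show "sides n \<subseteq> zigzag_edges"
    by (simp add: zigzag_edges_def)
  show "zigzag_edges \<subseteq> pairs n"
  proof
    fix e assume "e \<in> zigzag_edges"
    then obtain p q where pq: "e = (p, q)" "(p, q) \<in> zigzag_edges"
      by (cases e) auto
    from pq(2) show "e \<in> pairs n"
    proof (cases rule: zigzag_edges_cases)
      case (2 l)
      then show ?thesis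
        using zigzag_length[of l] zigzag_bounds[of l] by (simp add: pq pairs_def case_prod_beta)
    qed (simp add: pq pairs_def)
  qed
next
  fix p q u v assume pq: "(p, q) \<in> zigzag_edges" and uv: "(u, v) \<in> zigzag_edges"
  show "\<not> (p < u \<and> u < q \<and> q < v)"
    using pq
  proof (cases rule: zigzag_edges_cases)
    case l: (2 l)
    from uv show ?thesis
    proof (cases rule: zigzag_edges_cases)
      case (2 l')
      then show ?thesis
        using l zigzag_mono[of l l'] zigzag_mono[of l' l] by (cases "l \<le> l'") auto
    qed auto
  qed auto
next
  fix x y assume xy: "0 \<le> x" "x < y" "y < int n + 3" "(x, y) \<notin> zigzag_edges"
  show "\<exists>c d. (c, d) \<in> zigzag_edges \<and> (x < c \<and> c < y \<and> y < d \<or> c < x \<and> x < d \<and> d < y)"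
  proof (rule ccontr)
    assume not_crossed: "\<not> ?thesis"
    have "(x, y) \<notin> sides n"
      using xy(4) by (simp add: zigzag_edges_def)
    then have not_side: "x + 1 < y"
      using xy by (auto simp: sides_def)
    \<comment> \<open>An uncrossed pair outside the set is squeezed into every interval: if it
      touched the end dropped next, it would cross the next interval. The last interval has length
      1, too short for it.\<close>
    have "lo l \<le> x \<and> y \<le> hi l" if "l \<le> Suc n" for l
      using that
    proof (induction l)
      case 0
      then show ?case
        using xy by simp
    next
      case (Suc l)
      then have IH: "lo l \<le> x" "y \<le> hi l" "l \<le> n"
        by auto
      have ne: "\<not> (x = lo l \<and> y = hi l)"
        using xy(4) zigzag_in_edges[of l] Suc.prems by auto
      have "(fst (zigzag n Q (Suc l)), snd (zigzag n Q (Suc l))) \<in> zigzag_edges"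
        using zigzag_in_edges Suc.prems by simp
      then have nc: "\<not> (x < lo (Suc l) \<and> lo (Suc l) < y \<and> y < hi (Suc l))"
        "\<not> (lo (Suc l) < x \<and> x < hi (Suc l) \<and> hi (Suc l) < y)"
        using not_crossed by blast+
      show ?case
      proof (cases "step_down Q l")
        case True
        then have "lo (Suc l) = lo l" "hi (Suc l) = hi l - 1"
          by (simp_all add: zigzag.simps(2))
        then show ?thesis
          using nc ne IH not_side by linarith
      next
        case False
        then have "lo (Suc l) = lo l + 1" "hi (Suc l) = hi l"
          by (simp_all add: zigzag.simps(2))
        then show ?thesis
          using nc ne IH not_side by linarith
      qed
    qed
    from this[of "Suc n"] show False
      using zigzag_length[of "Suc n"] not_side by linarith
  qed
qed

interpretation triangulated n zigzag_edges
  by unfold_locales (rule triangulates_zigzag)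

text \<open>The triangle between intervals \<open>l\<close> and \<open>l + 1\<close> has these two
  as edges; its third edge is a polygon side.\<close>

definition zigzag_apex :: "nat \<Rightarrow> int" where
  "zigzag_apex l = (if step_down Q l then hi l - 1 else lo l + 1)"

lemma zigzag_triangle:
  assumes "l \<le> n"
  shows "lo l < zigzag_apex l" "zigzag_apex l < hi l"
    "(lo l, zigzag_apex l) \<in> zigzag_edges" "(zigzag_apex l, hi l) \<in> zigzag_edges"
proof -
  show less: "lo l < zigzag_apex l" "zigzag_apex l < hi l"
    using zigzag_length[of l] assms by (auto simp: zigzag_apex_def)
  have "(fst (zigzag n Q (Suc l)), snd (zigzag n Q (Suc l))) \<in> zigzag_edges"
    using zigzag_in_edges[of "Suc l"] assms by simp
  moreover have "(lo l, lo l + 1) \<in> zigzag_edges" "(hi l - 1, hi l) \<in> zigzag_edges"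
    using zigzag_bounds[of l] less by (auto intro!: side simp: sides_def)
  ultimately show "(lo l, zigzag_apex l) \<in> zigzag_edges" "(zigzag_apex l, hi l) \<in> zigzag_edges"
    by (auto simp: zigzag_apex_def zigzag.simps(2) split: if_splits)
qed

lemma arrow_zigzag:
  "arrow zigzag_edges f g \<longleftrightarrow> (\<exists>l\<le>n. tri_arrow (lo l) (zigzag_apex l) (hi l) f g)"
proof
  assume "arrow zigzag_edges f g"
  then obtain x y z where xyz: "x < y" "y < z" "(x, y) \<in> zigzag_edges" "(y, z) \<in> zigzag_edges"
    "(x, z) \<in> zigzag_edges" and t: "tri_arrow x y z f g"
    by (auto simp: arrow_def)
  from xyz(5) obtain l where l: "l \<le> n" "x = lo l" "z = hi l"
    by (cases rule: zigzag_edges_cases) (use xyz in auto)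
  note tr = zigzag_triangle[OF l(1)]
  have "y = zigzag_apex l"
    using noncrossing[OF xyz(3) tr(4)] noncrossing[OF tr(3) xyz(4)] l tr xyz(1,2) by linarith
  then show "\<exists>l\<le>n. tri_arrow (lo l) (zigzag_apex l) (hi l) f g"
    using l t by auto
next
  assume "\<exists>l\<le>n. tri_arrow (lo l) (zigzag_apex l) (hi l) f g"
  then obtain l where l: "l \<le> n" and t: "tri_arrow (lo l) (zigzag_apex l) (hi l) f g"
    by blast
  have "(lo l, hi l) \<in> zigzag_edges"
    using zigzag_in_edges[of l] l by simp
  then show "arrow zigzag_edges f g"
    unfolding arrow_def using zigzag_triangle[OF l] t by blast
qed

text \<open>Since one edge of triangle \<open>l\<close> is a polygon side, it yields at most one
  arrow between labels. Dropping the right end directs it from interval \<open>l\<close> to interval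
  \<open>l + 1\<close>, dropping the left end the other way.\<close>

lemma arrow_zigzag_labels:
  assumes "i < n" "k < n"
  shows "arrow zigzag_edges (zigzag n Q (Suc i)) (zigzag n Q (Suc k)) \<longleftrightarrow>
    k = Suc i \<and> step_down Q (Suc i) \<or> i = Suc k \<and> \<not> step_down Q (Suc k)"
proof -
  have len: "hi (Suc m) \<noteq> lo (Suc m) + 1" if "m < n" for m
    using zigzag_length[of "Suc m"] that by linarith
  have down: "tri_arrow (lo l) (zigzag_apex l) (hi l) f g \<longleftrightarrow> f = zigzag n Q l \<and> g = zigzag n Q (Suc l)"
    if "step_down Q l" "f = zigzag n Q (Suc i)" "g = zigzag n Q (Suc k)" for l f g
  proof -
    have "f \<noteq> (hi l - 1, hi l)" "g \<noteq> (hi l - 1, hi l)"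
      using len[OF assms(1)] len[OF assms(2)] that(2,3) by (metis diff_add_cancel fst_conv snd_conv)+
    moreover have "zigzag n Q (Suc l) = (lo l, hi l - 1)"
      using that(1) by (simp add: zigzag.simps(2))
    ultimately show ?thesis
      using that(1) by (auto simp: tri_arrow_def zigzag_apex_def prod_eq_iff)
  qed
  have up: "tri_arrow (lo l) (zigzag_apex l) (hi l) f g \<longleftrightarrow> f = zigzag n Q (Suc l) \<and> g = zigzag n Q l"
    if "\<not> step_down Q l" "f = zigzag n Q (Suc i)" "g = zigzag n Q (Suc k)" for l f g
  proof -
    have "f \<noteq> (lo l, lo l + 1)" "g \<noteq> (lo l, lo l + 1)"
      using len[OF assms(1)] len[OF assms(2)] that(2,3) by (metis fst_conv snd_conv)+
    moreover have "zigzag n Q (Suc l) = (lo l + 1, hi l)"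
      using that(1) by (simp add: zigzag.simps(2))
    ultimately show ?thesis
      using that(1) by (auto simp: tri_arrow_def zigzag_apex_def prod_eq_iff)
  qed
  have "tri_arrow (lo l) (zigzag_apex l) (hi l) (zigzag n Q (Suc i)) (zigzag n Q (Suc k)) \<longleftrightarrow>
      step_down Q l \<and> Suc i = l \<and> k = l \<or> \<not> step_down Q l \<and> i = l \<and> Suc k = l" for l
    using down[of l, OF _ refl refl] up[of l, OF _ refl refl]
    by (cases "step_down Q l") (auto simp: zigzag_inj)
  then show ?thesis
    unfolding arrow_zigzag using assms by (auto intro: exI[of _ "Suc i"] exI[of _ "Suc k"])
qed

lemma labelled_zigzag:
  assumes path: "path_quiver n Q" and X: "\<And>i. i < n \<Longrightarrow> X (zigzag n Q (Suc i)) = var i"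
  shows "labelled n X (Q, var) zigzag_edges (\<lambda>i. zigzag n Q (Suc i))"
proof -
  have "bij_betw (\<lambda>i. zigzag n Q (Suc i)) {..<n} (zigzag_edges - sides n)"
    unfolding bij_betw_def
  proof
    show "inj_on (\<lambda>i. zigzag n Q (Suc i)) {..<n}"
      by (auto intro!: inj_onI simp: zigzag_inj)
    have root: "zigzag n Q 0 \<in> sides n"
      by (simp add: sides_def)
    have "zigzag_edges = sides n \<union> (\<lambda>i. zigzag n Q (Suc i)) ` {..<n}"
    proof -
      have "{..n} = insert 0 (Suc ` {..<n})"
        by (simp add: lessThan_Suc_atMost[symmetric] lessThan_Suc_eq_insert_0)
      then show ?thesis
        using root by (auto simp: zigzag_edges_def)
    qed
    moreover have "(\<lambda>i. zigzag n Q (Suc i)) ` {..<n} \<inter> sides n = {}"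
      using zigzag_diagonal pairs_eq(2)[of n] by (auto)
    ultimately show "(\<lambda>i. zigzag n Q (Suc i)) ` {..<n} = zigzag_edges - sides n"
      by blast
  qed
  moreover have "Q i k = of_bool (arrow zigzag_edges (zigzag n Q (Suc i)) (zigzag n Q (Suc k)))"
    if "i < n" "k < n" for i k
  proof -
    have step: "step_down Q (Suc m) \<longleftrightarrow> Q m (Suc m) = 1" for m
      by (auto simp: step_down_def)
    have "if k = Suc i then Q i k + Q k i = 1 else i \<noteq> Suc k \<longrightarrow> Q i k = 0"
      "if i = Suc k then Q k i + Q i k = 1 else k \<noteq> Suc i \<longrightarrow> Q k i = 0"
      using path that unfolding path_quiver_def by blast+
    then show ?thesis
      unfolding arrow_zigzag_labels[OF that] step by (auto split: if_splits)
  qed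
  ultimately show ?thesis
    using X triangulates_zigzag by (simp add: labelled_def)
qed

text \<open>Representing vertices by vectors in the plane, with determinants as values of the
  diagonals, turns the Ptolemy relations into the Pluecker relation.\<close>
lemma zigzag_vectors:
  fixes g :: "nat \<Rightarrow> 'a::field"
  assumes g: "\<And>k. k \<le> Suc n \<Longrightarrow> g k \<noteq> 0" "g (Suc n) = 1"
  shows "\<exists>u v. (\<forall>k\<le>Suc n. u (lo k) * v (hi k) - v (lo k) * u (hi k) = g k) \<and>
    (\<forall>i. 0 \<le> i \<and> i < int n + 2 \<longrightarrow> u i * v (i + 1) - v i * u (i + 1) = 1)"
proof -
  have "\<exists>u v. (\<forall>k. l \<le> k \<and> k \<le> Suc n \<longrightarrow> u (lo k) * v (hi k) - v (lo k) * u (hi k) = g k) \<and>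
    (\<forall>i. lo l \<le> i \<and> i < hi l \<longrightarrow> u i * v (i + 1) - v i * u (i + 1) = 1)" if "l \<le> Suc n" for l
    using that
  proof (induction rule: inc_induct)
    case base
    have len: "hi (Suc n) = lo (Suc n) + 1"
      using zigzag_length[of "Suc n"] by linarith
    show ?case
      by (rule exI[of _ "\<lambda>i. if i = lo (Suc n) then 1 else 0"],
          rule exI[of _ "\<lambda>i. if i = lo (Suc n) then 0 else 1"])
        (auto simp: g(2) len dest!: le_antisym)
  next
    case (step l)
    then obtain u v where
      uv: "\<And>k. Suc l \<le> k \<Longrightarrow> k \<le> Suc n \<Longrightarrow> u (lo k) * v (hi k) - v (lo k) * u (hi k) = g k"
      "\<And>i. lo (Suc l) \<le> i \<Longrightarrow> i < hi (Suc l) \<Longrightarrow> u i * v (i + 1) - v i * u (i + 1) = 1"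
      by blast
    define a b h where "a = lo (Suc l)" and "b = hi (Suc l)" and "h = g (Suc l)"
    have h: "h \<noteq> 0" "u a * v b - v a * u b = h"
      using g(1)[of "Suc l"] uv(1)[of "Suc l"] step.hyps by (auto simp: a_def b_def h_def)
    have inside: "a \<le> lo k \<and> hi k \<le> b \<and> lo k < hi k" if "Suc l \<le> k" "k \<le> Suc n" for k
      using zigzag_mono[OF that(1)] zigzag_length[of k] that(2) by (simp add: a_def b_def)
    have ab: "a < b"
      using inside[of "Suc l"] step.hyps by (simp add: a_def b_def)
    show ?case
    proof (cases "step_down Q l")
      case True
      then have l: "lo l = a" "hi l = b + 1"
        by (simp_all add: a_def b_def zigzag.simps(2))
      \<comment> \<open>The new vector solves two linear conditions: determinant \<open>g l\<close>
        with the vector at \<open>a\<close> and determinant 1 from the vector at \<open>b\<close>.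
        As \<open>h\<close> is nonzero, the vectors at \<open>a\<close> and \<open>b\<close> form a
        basis.\<close>
      define u' where "u' = u(b + 1 := (g l * u b - u a) / h)"
      define v' where "v' = v(b + 1 := (g l * v b - v a) / h)"
      have old: "u' i = u i" "v' i = v i" if "i \<le> b" for i
        using that by (auto simp: u'_def v'_def)
      have "u' (lo k) * v' (hi k) - v' (lo k) * u' (hi k) = g k" if "l \<le> k" "k \<le> Suc n" for k
      proof (cases "k = l")
        case True
        have "u a * v' (b + 1) - v a * u' (b + 1) = g l * (u a * v b - v a * u b) / h"
          by (simp add: u'_def v'_def diff_divide_distrib algebra_simps)
        then show ?thesis
          using True h old[of a] ab by (simp add: l)
      next
        case False
        then show ?thesis
          using that inside[of k] uv(1)[of k] old by (simp)
      qed
      moreover have "u' i * v' (i + 1) - v' i * u' (i + 1) = 1" if "a \<le> i" "i < b + 1" for i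
      proof (cases "i = b")
        case True
        have "u b * v' (b + 1) - v b * u' (b + 1) = (u a * v b - v a * u b) / h"
          by (simp add: u'_def v'_def diff_divide_distrib algebra_simps)
        then show ?thesis
          using True h old[of b] by simp
      next
        case False
        then show ?thesis
          using that uv(2)[of i] old by (simp add: a_def b_def)
      qed
      ultimately show ?thesis
        unfolding l by blast
    next
      case False
      then have l: "lo l = a - 1" "hi l = b"
        by (simp_all add: a_def b_def zigzag.simps(2))
      define u' where "u' = u(a - 1 := (g l * u a - u b) / h)"
      define v' where "v' = v(a - 1 := (g l * v a - v b) / h)"
      have old: "u' i = u i" "v' i = v i" if "a \<le> i" for i
        using that by (auto simp: u'_def v'_def)
      have "u' (lo k) * v' (hi k) - v' (lo k) * u' (hi k) = g k" if "l \<le> k" "k \<le> Suc n" for k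
      proof (cases "k = l")
        case True
        have "u' (a - 1) * v b - v' (a - 1) * u b = g l * (u a * v b - v a * u b) / h"
          by (simp add: u'_def v'_def diff_divide_distrib algebra_simps)
        then show ?thesis
          using True h old[of b] ab by (simp add: l)
      next
        case False
        then show ?thesis
          using that inside[of k] uv(1)[of k] old by (simp)
      qed
      moreover have "u' i * v' (i + 1) - v' i * u' (i + 1) = 1" if "a - 1 \<le> i" "i < b" for i
      proof (cases "i = a - 1")
        case True
        have "u' (a - 1) * v a - v' (a - 1) * u a = (u a * v b - v a * u b) / h"
          by (simp add: u'_def v'_def diff_divide_distrib algebra_simps)
        then show ?thesis
          using True h old[of a] by simp
      next
        case False
        then show ?thesis
          using that uv(2)[of i] old by (simp add: a_def b_def)
      qed
      ultimately show ?thesis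
        unfolding l by blast
    qed
  qed
  from this[of 0] show ?thesis
    by simp
qed

end

section \<open>The polygon model\<close>

definition ptolemaic :: "nat \<Rightarrow> (int \<Rightarrow> int \<Rightarrow> 'a::comm_ring_1) \<Rightarrow> bool" where
  "ptolemaic n X \<longleftrightarrow> (\<forall>a b c d. 0 \<le> a \<and> a < b \<and> b < c \<and> c < d \<and> d < int n + 3 \<longrightarrow>
     X a c * X b d = X a b * X c d + X a d * X b c)"

lemma ptolemaicD:
  "ptolemaic n X \<Longrightarrow> 0 \<le> a \<Longrightarrow> a < b \<Longrightarrow> b < c \<Longrightarrow> c < d \<Longrightarrow> d < int n + 3 \<Longrightarrow>
    X a c * X b d = X a b * X c d + X a d * X b c"
  by (simp add: ptolemaic_def)

lemma path_quiver_loopless: "path_quiver n Q \<Longrightarrow> i < n \<Longrightarrow> Q i i = 0"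
  unfolding path_quiver_def by (metis n_not_Suc_n)

text \<open>Ptolemy relations, unit sides and the initial variables on the zigzag already force
  everything that \<open>polygon_model\<close> says about clusters, because every mutation follows a
  flip.\<close>

locale zigzag_values =
  fixes n :: nat and Q :: quiver and X :: "int \<Rightarrow> int \<Rightarrow> ratfun"
  assumes path: "path_quiver n Q"
    and ptolemy: "ptolemaic n X"
    and sides: "\<And>e. e \<in> sides n \<Longrightarrow> case_prod X e = 1"
    and initial: "\<And>i. i < n \<Longrightarrow> case_prod X (zigzag n Q (Suc i)) = var i"
begin

abbreviation lab :: "seed \<Rightarrow> (int \<times> int) set \<Rightarrow> (nat \<Rightarrow> int \<times> int) \<Rightarrow> bool" where
  "lab \<equiv> labelled n (case_prod X)"

lemma seed_in: "(R, y) \<in> seeds n Q \<Longrightarrow> seed_in n Q R y"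
  by unfold_locales (simp_all add: path_quiver_loopless[OF path])

lemma lab_mutate:
  assumes s: "s \<in> seeds n Q" "lab s E e" and k: "k < n"
    and flip: "flip n E E' F (e k) j' w x y z"
    and exchange: "case_prod X (e k) * case_prod X j' =
      case_prod X w * case_prod X y + case_prod X x * case_prod X z"
  shows "lab (mutate_seed n k s) E' (e(k := j'))"
proof -
  obtain R v where Rv: "s = (R, v)"
    by (cases s)
  have "v k \<noteq> 0"
    using seed_in.y_nonzero[OF seed_in] s(1) k by (simp add: Rv)
  then have "case_prod X (e k) \<noteq> 0"
    using s(2) k by (simp add: Rv labelled_def)
  then show ?thesis
    using flip.labelled_mutate[OF flip s(2)[unfolded Rv] k refl sides exchange] by (simp add: Rv)
qed

lemma lab_edge:
  assumes "lab s E e" "k < n"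
  shows "e k \<in> E" "e k \<notin> sides n"
proof -
  have "e k \<in> e ` {..<n}"
    using assms(2) by simp
  also have "e ` {..<n} = E - sides n"
    using assms(1) by (simp add: labelled_def bij_betw_def)
  finally show "e k \<in> E" "e k \<notin> sides n"
    by auto
qed

lemma lab_flip_ac:
  assumes s: "s \<in> seeds n Q" "lab s E e" and k: "k < n" "e k = (a, c)"
    and q: "quad n E a b c d"
  shows "lab (mutate_seed n k s) (insert (b, d) (E - {(a, c)})) (e(k := (b, d)))"
proof -
  interpret quad n E a b c d
    by (fact q)
  have ac: "(a, c) \<in> E"
    using lab_edge(1)[OF s(2) k(1)] k(2) by simp
  have "X a c * X b d = X a b * X c d + X b c * X a d"
    using ptolemaicD[OF ptolemy _ order] in_pairs[OF ad] by (simp add: mult.commute)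
  then show ?thesis
    by (intro lab_mutate[OF s k(1)]) (use flip_from_ac[OF ac] k(2) in auto)
qed

lemma lab_flip_bd:
  assumes s: "s \<in> seeds n Q" "lab s E e" and k: "k < n" "e k = (b, d)"
    and q: "quad n E a b c d"
  shows "lab (mutate_seed n k s) (insert (a, c) (E - {(b, d)})) (e(k := (a, c)))"
proof -
  interpret quad n E a b c d
    by (fact q)
  have bd: "(b, d) \<in> E"
    using lab_edge(1)[OF s(2) k(1)] k(2) by simp
  have "X b d * X a c = X b c * X a d + X c d * X a b"
    using ptolemaicD[OF ptolemy _ order] in_pairs[OF ad] by (simp add: algebra_simps)
  then show ?thesis
    by (intro lab_mutate[OF s k(1)]) (use flip_from_bd[OF bd] k(2) in auto)
qed

section \<open>Clusters and triangulations\<close>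

lemma initial_lab: "lab (Q, var) (zigzag_edges n Q) (\<lambda>i. zigzag n Q (Suc i))"
  by (rule labelled_zigzag[OF path]) (rule initial)

lemma seed_lab: "s \<in> seeds n Q \<Longrightarrow> \<exists>E e. lab s E e"
proof (induction rule: seeds.induct)
  case initial
  show ?case
    using initial_lab by blast
next
  case (mutate s k)
  then obtain E e where lab: "lab s E e"
    by blast
  then interpret triangulated n E
    by unfold_locales (simp add: labelled_def)
  obtain p q where pq: "e k = (p, q)"
    by (cases "e k")
  have in_E: "(p, q) \<in> E" "(p, q) \<notin> sides n"
    using lab_edge[OF lab mutate.hyps(2)] pq by simp_all
  from in_E show ?case
  proof (cases rule: quad_around)
    case (ac a b c d)
    then have "quad n E a b c d"
      by unfold_locales
    then show ?thesis
      using lab_flip_ac[OF mutate.hyps(1) lab mutate.hyps(2)] pq ac by blast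
  next
    case (bd a b c d)
    then have "quad n E a b c d"
      by unfold_locales
    then show ?thesis
      using lab_flip_bd[OF mutate.hyps(1) lab mutate.hyps(2)] pq bd by blast
  qed
qed

lemma lab_index:
  assumes "lab s E e" "f \<in> E" "f \<in> diagonals n"
  obtains k where "k < n" "e k = f"
proof -
  have "f \<in> e ` {..<n}"
    using assms pairs_eq(2)[of n] by (auto simp: labelled_def bij_betw_def)
  then show ?thesis
    using that by auto
qed

text \<open>Mutations reach the triangulations connected with the zigzag by flips; by
  \<open>triangulates_flip_induct\<close> these are all triangulations.\<close>

lemma lab_seed:
  assumes "triangulates n E"
  shows "\<exists>s\<in>seeds n Q. \<exists>e. lab s E e"
proof (rule triangulates_flip_induct[OF triangulates_zigzag _ _ _ assms])
  show "\<exists>s\<in>seeds n Q. \<exists>e. lab s (zigzag_edges n Q) e"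
    using initial_lab seeds.initial by blast
next
  fix E a b c d
  assume q: "quad n E a b c d" and ac: "(a, c) \<in> E" and "\<exists>s\<in>seeds n Q. \<exists>e. lab s E e"
  then obtain s e where s: "s \<in> seeds n Q" "lab s E e"
    by blast
  obtain k where k: "k < n" "e k = (a, c)"
    by (rule lab_index[OF s(2) ac quad.diagonals_not_sides(1)[OF q]])
  show "\<exists>s\<in>seeds n Q. \<exists>e. lab s (E - {(a, c)} \<union> {(b, d)}) e"
    using lab_flip_ac[OF s k q] seeds.mutate[OF s(1) k(1)] by auto
next
  fix E a b c d
  assume q: "quad n E a b c d" and bd: "(b, d) \<in> E" and "\<exists>s\<in>seeds n Q. \<exists>e. lab s E e"
  then obtain s e where s: "s \<in> seeds n Q" "lab s E e"
    by blast
  obtain k where k: "k < n" "e k = (b, d)"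
    by (rule lab_index[OF s(2) bd quad.diagonals_not_sides(2)[OF q]])
  show "\<exists>s\<in>seeds n Q. \<exists>e. lab s (E - {(b, d)} \<union> {(a, c)}) e"
    using lab_flip_bd[OF s k q] seeds.mutate[OF s(1) k(1)] by auto
qed

lemma lab_cluster: "lab (R, y) E e \<Longrightarrow> y ` {..<n} = case_prod X ` (E - sides n)"
  unfolding labelled_def bij_betw_def by (metis (no_types, lifting) image_cong image_image lessThan_iff snd_conv)

lemma triangulation_lab:
  assumes "triangulation n T"
  obtains R y e where "(R, y) \<in> seeds n Q" "lab (R, y) (sides n \<union> T) e" "y ` {..<n} = case_prod X ` T"
proof -
  have T: "triangulates n (sides n \<union> T)" "sides n \<union> T - sides n = T"
    using assms pairs_eq(2)[of n] by (auto simp: triangulation_iff)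
  then obtain s e where "s \<in> seeds n Q" "lab s (sides n \<union> T) e"
    using lab_seed by blast
  then show ?thesis
    using that lab_cluster T(2) by (metis surj_pair)
qed

lemma clusters_triangulations: "clusters n Q = {case_prod X ` T | T. triangulation n T}"
proof (intro equalityI subsetI)
  fix C assume "C \<in> clusters n Q"
  then obtain R y where Ry: "(R, y) \<in> seeds n Q" "C = y ` {..<n}"
    by (auto simp: clusters_def)
  then obtain E e where lab: "lab (R, y) E e"
    using seed_lab by blast
  then have "triangulation n (E - sides n)"
    by (intro triangulates_triangulation(1)) (simp add: labelled_def)
  then show "C \<in> {case_prod X ` T | T. triangulation n T}"
    using lab_cluster[OF lab] Ry(2) by blast
next
  fix C assume "C \<in> {case_prod X ` T | T. triangulation n T}"
  then obtain T where T: "triangulation n T" "C = case_prod X ` T"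
    by blast
  obtain R y e where "(R, y) \<in> seeds n Q" "lab (R, y) (sides n \<union> T) e" "y ` {..<n} = case_prod X ` T"
    by (rule triangulation_lab[OF T(1)])
  then show "C \<in> clusters n Q"
    unfolding clusters_def T(2) by (intro rev_image_eqI[of "(R, y)"]) simp_all
qed

text \<open>Diagonals that do not cross extend to a common triangulation, so they belong to
  different indices of one seed, whose variables are distinct.\<close>

lemma distinct_noncrossing:
  assumes "e \<in> diagonals n" "f \<in> diagonals n" "e \<noteq> f" "\<not> crossing e f"
  shows "case_prod X e \<noteq> case_prod X f"
proof
  assume eq: "case_prod X e = case_prod X f"
  have "\<exists>T. triangulation n T \<and> {e, f} \<subseteq> T"
    by (rule triangulation_extends) (use assms crossing_irrefl crossing_commute[of f e] in auto)
  then obtain T where T: "triangulation n T" "{e, f} \<subseteq> T"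
    by blast
  obtain R y l where s: "(R, y) \<in> seeds n Q" "lab (R, y) (sides n \<union> T) l"
    by (rule triangulation_lab[OF T(1)])
  interpret seed_in n Q R y
    by (rule seed_in[OF s(1)])
  obtain i where i: "i < n" "l i = e"
    using lab_index[OF s(2), of e] T(2) assms(1) by auto
  obtain k where k: "k < n" "l k = f"
    using lab_index[OF s(2), of f] T(2) assms(2) by auto
  have "y i = y k"
    using s(2) i k eq by (simp add: labelled_def)
  then have "i = k"
    using inj_y i k by (auto dest: inj_onD)
  then show False
    using i k assms(3) by simp
qed

text \<open>Crossing diagonals share no triangulation and are separated by values: where
  \<open>(a, c)\<close> and the sides of the quadrilateral all have value 1, the Ptolemy relation
  would force \<open>(b, d)\<close> to have value 2.\<close>

lemma distinct_crossing:
  assumes "0 \<le> a" "a < b" "b < c" "c < d" "d < int n + 3"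
  shows "X a c \<noteq> X b d"
proof
  assume eq: "X a c = X b d"
  define D where "D = {(a, c), (a, b), (b, c), (c, d), (a, d)} \<inter> diagonals n"
  have ac: "(a, c) \<in> D"
    using assms by (auto simp: D_def diagonals_def)
  have "\<exists>T. triangulation n T \<and> D \<subseteq> T"
    by (rule triangulation_extends) (use assms in \<open>auto simp: D_def crossing_pair\<close>)
  then obtain T where T: "triangulation n T" "D \<subseteq> T"
    by blast
  obtain R y l where s: "(R, y) \<in> seeds n Q" "lab (R, y) (sides n \<union> T) l"
    by (rule triangulation_lab[OF T(1)])
  interpret seed_in n Q R y
    by (rule seed_in[OF s(1)])
  obtain v where v: "\<And>i. i < n \<Longrightarrow> evaluates v (y i) 1"
    using generic_values[of "\<lambda>_. 1"] by auto
  have one: "evaluates v (X p q) 1" if pq: "(p, q) \<in> {(a, c), (a, b), (b, c), (c, d), (a, d)}" for p q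
  proof (cases "(p, q) \<in> diagonals n")
    case True
    then have "(p, q) \<in> T"
      using pq T(2) by (auto simp: D_def)
    then obtain i where "i < n" "l i = (p, q)"
      using lab_index[OF s(2), of "(p, q)"] True by auto
    then show ?thesis
      using v[of i] s(2) by (simp add: labelled_def)
  next
    case False
    then have "(p, q) \<in> sides n"
      using pq assms by (auto simp: sides_def diagonals_def)
    then show ?thesis
      using sides[of "(p, q)"] evaluates_1 by simp
  qed
  have "evaluates v (X a b * X c d + X a d * X b c) (1 * 1 + 1 * 1)"
    by (intro evaluates_add evaluates_mult one) auto
  also have "X a b * X c d + X a d * X b c = X a c * X b d"
    using ptolemaicD[OF ptolemy] assms by simp
  finally have "evaluates v (X a c * X a c) (1 * 1 + 1 * 1)"
    by (simp add: eq)
  moreover have "evaluates v (X a c * X a c) (1 * 1)"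
    by (intro evaluates_mult one) auto
  ultimately show False
    using evaluates_unique by fastforce
qed

lemma cluster_variables: "bij_betw (case_prod X) (diagonals n) (\<Union> (clusters n Q))"
  unfolding bij_betw_def
proof
  show "inj_on (case_prod X) (diagonals n)"
  proof (rule inj_onI, rule ccontr)
    fix e f assume ef: "e \<in> diagonals n" "f \<in> diagonals n" "case_prod X e = case_prod X f" "e \<noteq> f"
    obtain a b c d where abcd: "e = (a, b)" "f = (c, d)"
      by (cases e; cases f)
    have "crossing e f"
      using distinct_noncrossing ef by blast
    then show False
      using distinct_crossing[of a c b d] distinct_crossing[of c a d b] ef abcd
      by (auto simp: crossing_pair diagonals_def)
  qed
  have "\<Union> {T. triangulation n T} = diagonals n"
  proof
    show "\<Union> {T. triangulation n T} \<subseteq> diagonals n"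
      by (auto simp: triangulation_def)
    show "diagonals n \<subseteq> \<Union> {T. triangulation n T}"
    proof
      fix e assume "e \<in> diagonals n"
      then have "\<exists>T. triangulation n T \<and> {e} \<subseteq> T"
        by (intro triangulation_extends) (use crossing_irrefl in auto)
      then show "e \<in> \<Union> {T. triangulation n T}"
        by blast
    qed
  qed
  then show "case_prod X ` diagonals n = \<Union> (clusters n Q)"
    unfolding clusters_triangulations by blast
qed

end

section \<open>Existence of a polygon model\<close>

lemma polygon_model_exists:
  assumes path: "path_quiver n Q"
  shows "\<exists>X. polygon_model n Q X"
proof -
  \<comment> \<open>Intervals \<open>0\<close> and \<open>n + 1\<close> are polygon sides; interval
    \<open>k\<close> in between carries the initial variable \<open>k - 1\<close>.\<close>
  define g where "g k = (if k = 0 \<or> k = Suc n then 1 else var (k - 1))" for k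
  have "evaluates (\<lambda>_. 1) (var i) 1" for i
    using evaluates_var[of "\<lambda>_. 1"] .
  then have "var i \<noteq> 0" for i
    using evaluates_nonzero zero_neq_one by metis
  then have g: "g k \<noteq> 0" "g (Suc n) = 1" for k
    by (simp_all add: g_def)
  obtain u v where
    uv: "\<And>k. k \<le> Suc n \<Longrightarrow> u (fst (zigzag n Q k)) * v (snd (zigzag n Q k)) -
      v (fst (zigzag n Q k)) * u (snd (zigzag n Q k)) = g k"
    "\<And>i. 0 \<le> i \<Longrightarrow> i < int n + 2 \<Longrightarrow> u i * v (i + 1) - v i * u (i + 1) = 1"
    using zigzag_vectors[of n g Q, OF g] by blast
  \<comment> \<open>Determinants change sign when their arguments are exchanged while cluster
    variables do not; the case distinction symmetrises.\<close>
  define X where "X a b = (if a \<le> b then u a * v b - v a * u b else u b * v a - v b * u a)" for a b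
  have "u 0 * v (int n + 2) - v 0 * u (int n + 2) = 1"
    using uv(1)[of 0] by (simp add: g_def)
  then have sides: "case_prod X e = 1" if "e \<in> sides n" for e
    using that uv(2) by (auto simp: sides_def X_def)
  have less: "fst (zigzag n Q (Suc i)) \<le> snd (zigzag n Q (Suc i))" if "i < n" for i
    using zigzag_length[of n Q "Suc i"] that by linarith
  interpret zigzag_values n Q X
  proof
    show "ptolemaic n X"
      by (auto simp: ptolemaic_def X_def algebra_simps)
    show "case_prod X (zigzag n Q (Suc i)) = var i" if "i < n" for i
      using uv(1)[of "Suc i"] less[OF that] that by (simp add: X_def case_prod_beta g_def)
  qed (use path sides in auto)
  have "X a ((a + 1) mod (int n + 3)) = 1" if "0 \<le> a" "a < int n + 3" for a
  proof (cases "a = int n + 2")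
    case True
    have "(0, int n + 2) \<in> sides n"
      by (simp add: sides_def)
    then have "X 0 (int n + 2) = 1"
      using sides[of "(0, int n + 2)"] by simp
    moreover have "(a + 1) mod (int n + 3) = 0"
    proof -
      have "a + 1 = int n + 3"
        using True by simp
      then show ?thesis
        by (simp only: mod_self)
    qed
    ultimately show ?thesis
      using True by (simp add: X_def)
  next
    case False
    then have "(a, a + 1) \<in> sides n" "(a + 1) mod (int n + 3) = a + 1"
      using that by (auto simp: sides_def)
    then show ?thesis
      using sides[of "(a, a + 1)"] by simp
  qed
  then have "polygon_model n Q X"
    using ptolemy cluster_variables clusters_triangulations
    unfolding polygon_model_def ptolemaic_def by (auto simp: X_def)
  then show ?thesis
    by blast
qed

section \<open>The Laurent phenomenon\<close>

text \<open>A chord through a side of a convex quadrilateral crosses at least one of its diagonals.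
  When one of these lies in a noncrossing set, every member of the set that crosses a side misses it
  and hence crosses the other: resolving a crossing creates no new ones.\<close>

lemma crossing_quad:
  assumes "p < q" "q < r" "r < s" "x < y"
    and "f \<in> {(p, q), (q, r), (r, s), (p, s)}" "crossing f (x, y)"
  shows "\<not> crossing (q, s) (x, y) \<Longrightarrow> crossing (p, r) (x, y)"
    and "\<not> crossing (p, r) (x, y) \<Longrightarrow> crossing (q, s) (x, y)"
  using assms by (elim insertE emptyE; simp only: crossing_pair prod.inject; smt (verit))+

text \<open>A diagonal crossing some element of a noncrossing set \<open>S\<close> is resolved by a Ptolemy relation
  into diagonals that cross fewer elements of \<open>S\<close>.\<close>
lemma crossing_induct [consumes 3, case_names noncrossing first second]:
  assumes S: "S \<subseteq> pairs n" "\<And>d e. d \<in> S \<Longrightarrow> e \<in> S \<Longrightarrow> \<not> crossing d e" and ab: "(a, b) \<in> pairs n"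
    and base: "\<And>a b. (a, b) \<in> pairs n \<Longrightarrow> (\<And>e. e \<in> S \<Longrightarrow> \<not> crossing (a, b) e) \<Longrightarrow> P a b"
    and first: "\<And>p q r s. 0 \<le> p \<Longrightarrow> p < q \<Longrightarrow> q < r \<Longrightarrow> r < s \<Longrightarrow> s < int n + 3 \<Longrightarrow> (q, s) \<in> S \<Longrightarrow>
      P p q \<Longrightarrow> P q r \<Longrightarrow> P r s \<Longrightarrow> P p s \<Longrightarrow> P p r"
    and second: "\<And>p q r s. 0 \<le> p \<Longrightarrow> p < q \<Longrightarrow> q < r \<Longrightarrow> r < s \<Longrightarrow> s < int n + 3 \<Longrightarrow> (p, r) \<in> S \<Longrightarrow>
      P p q \<Longrightarrow> P q r \<Longrightarrow> P r s \<Longrightarrow> P p s \<Longrightarrow> P q s"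
  shows "P a b"
proof -
  define X where "X d = {e \<in> S. crossing d e}" for d
  have fin: "finite (X d)" for d
    using finite_subset[OF S(1) finite_pairs] by (simp add: X_def)
  show ?thesis
    using ab
  proof (induction "card (X (a, b))" arbitrary: a b rule: less_induct)
    case less
    have a: "0 \<le> a" "a < b" "b < int n + 3"
      using less.prems by (auto simp: pairs_def)
    have less_crossings: "P u v" if "(u, v) \<in> pairs n" "(c, d) \<in> S" "crossing (a, b) (c, d)"
      "\<not> crossing (u, v) (c, d)" "\<And>e. e \<in> S \<Longrightarrow> crossing (u, v) e \<Longrightarrow> crossing (a, b) e" for u v c d
    proof (rule less.hyps)
      have "X (u, v) \<subset> X (a, b)"
        using that by (auto simp: X_def)
      then show "card (X (u, v)) < card (X (a, b))"
        by (rule psubset_card_mono[OF fin])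
    qed (fact that(1))
    show ?case
    proof (cases "\<exists>e\<in>S. crossing (a, b) e")
      case False
      then show ?thesis
        using base[OF less.prems] by blast
    next
      case True
      then obtain c d where cd: "(c, d) \<in> S" "crossing (a, b) (c, d)"
        by auto
      have bounds: "0 \<le> c" "c < d" "d < int n + 3"
        using S(1) cd(1) by (auto simp: pairs_def)
      have x_less_y: "x < y" if "(x, y) \<in> S" for x y
        using S(1) that by (auto simp: pairs_def)
      consider "a < c" "c < b" "b < d" | "c < a" "a < d" "d < b"
        using cd(2) by (auto simp: crossing_pair)
      then show ?thesis
      proof cases
        case 1
        have "P u v" if f: "(u, v) \<in> {(a, c), (c, b), (b, d), (a, d)}" for u v
        proof (rule less_crossings[OF _ cd])
          show "(u, v) \<in> pairs n" "\<not> crossing (u, v) (c, d)"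
            using f a bounds 1 by (auto simp: pairs_def crossing_pair)
          fix e assume e: "e \<in> S" "crossing (u, v) e"
          obtain x y where xy: "e = (x, y)"
            by (cases e)
          show "crossing (a, b) e"
            using crossing_quad(1)[OF 1 x_less_y f] S(2)[OF cd(1)] e unfolding xy by blast
        qed
        then show ?thesis
          using first[of a c b d] 1 a bounds cd(1) by simp
      next
        case 2
        have "P u v" if f: "(u, v) \<in> {(c, a), (a, d), (d, b), (c, b)}" for u v
        proof (rule less_crossings[OF _ cd])
          show "(u, v) \<in> pairs n" "\<not> crossing (u, v) (c, d)"
            using f a bounds 2 by (auto simp: pairs_def crossing_pair)
          fix e assume e: "e \<in> S" "crossing (u, v) e"
          obtain x y where xy: "e = (x, y)"
            by (cases e)
          show "crossing (a, b) e"
            using crossing_quad(2)[OF 2 x_less_y f] S(2)[OF cd(1)] e unfolding xy by blast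
        qed
        then show ?thesis
          using second[of c a d b] 2 a bounds cd(1) by simp
      qed
    qed
  qed
qed

text \<open>The theorem speaks of every polygon model, so from here on \<open>X\<close> is arbitrary
  and no longer known to consist of determinants.\<close>

locale polygon_seed = seed_in n Q R y for n Q R y +
  fixes X :: "int \<Rightarrow> int \<Rightarrow> ratfun" and T :: "(int \<times> int) set"
  assumes model: "polygon_model n Q X" and triangulation: "triangulation n T"
    and cluster: "y ` {..<n} = case_prod X ` T"
begin

lemma X_commute: "0 \<le> a \<Longrightarrow> a < int n + 3 \<Longrightarrow> 0 \<le> b \<Longrightarrow> b < int n + 3 \<Longrightarrow> X a b = X b a"
  using model by (simp add: polygon_model_def)

lemma X_refl: "0 \<le> a \<Longrightarrow> a < int n + 3 \<Longrightarrow> X a a = 0"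
  using model by (simp add: polygon_model_def)

lemma X_next: "0 \<le> a \<Longrightarrow> a < int n + 3 \<Longrightarrow> X a ((a + 1) mod (int n + 3)) = 1"
  using model by (simp add: polygon_model_def)

lemma X_ptolemaic: "ptolemaic n X"
  using model by (simp add: polygon_model_def ptolemaic_def)

lemma X_side:
  assumes "(a, b) \<in> sides n"
  shows "X a b = 1"
proof (cases "b = a + 1")
  case True
  then show ?thesis
    using X_next[of a] assms by (simp add: sides_def)
next
  case False
  have "int n + 2 + 1 = int n + 3"
    by simp
  then have "X (int n + 2) 0 = 1"
    using X_next[of "int n + 2"] by (simp only: mod_self)
  then show ?thesis
    using False assms X_commute[of "int n + 2" 0] by (simp add: sides_def)
qed

lemma T_index:
  assumes "(a, b) \<in> T"
  obtains i where "i < n" "y i = X a b"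
proof -
  have "X a b \<in> y ` {..<n}"
    unfolding cluster using assms by force
  then show ?thesis
    using that by auto
qed

lemma T_pairs: "T \<subseteq> pairs n"
  using triangulation by (auto simp: triangulation_def pairs_eq)

lemma not_crossing_T:
  assumes "(a, b) \<in> pairs n" "\<And>e. e \<in> T \<Longrightarrow> \<not> crossing (a, b) e"
  shows "(a, b) \<in> sides n \<union> T"
  using assms triangulation pairs_eq[of n] unfolding triangulation_def by blast

text \<open>Resolving crossings with \<open>T\<close> divides only by values of elements of
  \<open>T\<close>, which are the variables of the seed.\<close>

lemma laurent_ring_X: "(a, b) \<in> pairs n \<Longrightarrow> X a b \<in> laurent_ring"
proof (rule crossing_induct[of T n a b])
  show "\<not> crossing d e" if "d \<in> T" "e \<in> T" for d e
    using that triangulation by (auto simp: triangulation_def)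
next
  fix a b assume "(a, b) \<in> pairs n" "\<And>e. e \<in> T \<Longrightarrow> \<not> crossing (a, b) e"
  then consider "(a, b) \<in> sides n" | "(a, b) \<in> T"
    using not_crossing_T by blast
  then show "X a b \<in> laurent_ring"
  proof cases
    case 1
    then show ?thesis
      using X_side laurent_ring_1 by simp
  next
    case 2
    then show ?thesis
      using laurent_ring_var by (metis T_index)
  qed
next
  fix p q r s assume pqrs: "0 \<le> p" "p < q" "q < r" "r < s" "s < int n + 3" "(q, s) \<in> T"
    and ring: "X p q \<in> laurent_ring" "X q r \<in> laurent_ring" "X r s \<in> laurent_ring" "X p s \<in> laurent_ring"
  obtain i where i: "i < n" "y i = X q s"
    using T_index[OF pqrs(6)] .
  have "X p r = (X p q * X r s + X p s * X q r) / y i"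
    using ptolemaicD[OF X_ptolemaic pqrs(1-5)] y_nonzero[OF i(1)] by (simp add: i(2) field_simps)
  then show "X p r \<in> laurent_ring"
    using ring i(1) by (simp add: laurent_ring_divide laurent_ring_add laurent_ring_mult)
next
  fix p q r s assume pqrs: "0 \<le> p" "p < q" "q < r" "r < s" "s < int n + 3" "(p, r) \<in> T"
    and ring: "X p q \<in> laurent_ring" "X q r \<in> laurent_ring" "X r s \<in> laurent_ring" "X p s \<in> laurent_ring"
  obtain i where i: "i < n" "y i = X p r"
    using T_index[OF pqrs(6)] .
  have "X q s = (X p q * X r s + X p s * X q r) / y i"
    using ptolemaicD[OF X_ptolemaic pqrs(1-5)] y_nonzero[OF i(1)] by (simp add: i(2) field_simps)
  then show "X q s \<in> laurent_ring"
    using ring i(1) by (simp add: laurent_ring_divide laurent_ring_add laurent_ring_mult)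
qed (use T_pairs in auto)

lemma cluster_variables: "\<Union> (clusters n Q) = case_prod X ` diagonals n"
  using model by (simp add: polygon_model_def bij_betw_def)

lemma cluster_algebra_laurent: "a \<in> cluster_algebra n Q \<Longrightarrow> a \<in> laurent_ring"
  unfolding cluster_algebra_def
proof (induction rule: int_algebra_generated.induct)
  case (gen a)
  then obtain p q where "(p, q) \<in> diagonals n" "a = X p q"
    unfolding cluster_variables by auto
  then show ?case
    using laurent_ring_X pairs_eq(1)[of n] by simp
qed (simp_all add: laurent_ring_1 laurent_ring_diff laurent_ring_mult)

lemma cluster_algebra_1: "1 \<in> cluster_algebra n Q"
  unfolding cluster_algebra_def by (rule int_algebra_generated.one)

lemma cluster_algebra_diff:
  "a \<in> cluster_algebra n Q \<Longrightarrow> b \<in> cluster_algebra n Q \<Longrightarrow> a - b \<in> cluster_algebra n Q"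
  unfolding cluster_algebra_def by (rule int_algebra_generated.diff)

lemma cluster_algebra_0: "0 \<in> cluster_algebra n Q"
  using cluster_algebra_diff[OF cluster_algebra_1 cluster_algebra_1] by simp

lemma cluster_algebra_X:
  assumes "0 \<le> a" "a < int n + 3" "0 \<le> b" "b < int n + 3"
  shows "X a b \<in> cluster_algebra n Q"
proof -
  have ordered: "X a b \<in> cluster_algebra n Q" if "(a, b) \<in> pairs n" for a b
  proof (cases "(a, b) \<in> sides n")
    case True
    then show ?thesis
      using X_side cluster_algebra_1 by simp
  next
    case False
    then have "X a b \<in> \<Union> (clusters n Q)"
      unfolding cluster_variables using that pairs_eq(1)[of n] by force
    then show ?thesis
      unfolding cluster_algebra_def by (rule int_algebra_generated.gen)
  qed
  consider "a = b" | "(a, b) \<in> pairs n" | "(b, a) \<in> pairs n"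
    using assms by (force simp: pairs_def)
  then show ?thesis
    using ordered[of a b] ordered[of b a] X_refl[of a] X_commute[of a b] assms cluster_algebra_0
    by cases simp_all
qed

end

section \<open>The specialised cluster algebra\<close>

locale specialised_seed = polygon_seed +
  fixes \<sigma> :: "nat \<rightharpoonup> int"
  assumes specialisation: "specialisation n \<sigma>"
begin

definition special :: "ratfun \<Rightarrow> laurent" where
  "special a = specialise \<sigma> (laurent_expansion n y a)"

lemma special_1: "special 1 = 1"
  by (simp add: special_def laurent_expansion_1 specialise_1)

lemma special_diff:
  "a \<in> laurent_ring \<Longrightarrow> b \<in> laurent_ring \<Longrightarrow> special (a - b) = special a - special b"
  by (simp add: special_def laurent_expansion_diff specialise_diff)

lemma special_mult:
  "a \<in> laurent_ring \<Longrightarrow> b \<in> laurent_ring \<Longrightarrow> special (a * b) = special a * special b"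
  by (simp add: special_def laurent_expansion_mult specialise_mult[OF specialisation])

lemma special_0: "special 0 = 0"
  by (simp add: special_def laurent_expansion_0 specialise_lin_ext)

lemma special_add:
  "a \<in> laurent_ring \<Longrightarrow> b \<in> laurent_ring \<Longrightarrow> special (a + b) = special a + special b"
  by (simp add: special_def laurent_expansion_add specialise_lin_ext lin_ext_add)

lemma special_var: "i < n \<Longrightarrow> special (y i) = special_power \<sigma> i 1"
  by (simp add: special_def laurent_expansion_var specialise_var)

lemma special_ptolemy:
  assumes "0 \<le> p" "p < q" "q < r" "r < s" "s < int n + 3"
  shows "special (X p r) * special (X q s) = special (X p q) * special (X r s) + special (X p s) * special (X q r)"
proof -
  have ring: "X p q \<in> laurent_ring" "X q r \<in> laurent_ring" "X r s \<in> laurent_ring" "X p s \<in> laurent_ring"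
    "X p r \<in> laurent_ring" "X q s \<in> laurent_ring"
    using assms by (auto intro!: laurent_ring_X simp: pairs_def)
  have "special (X p r * X q s) = special (X p q * X r s + X p s * X q r)"
    using ptolemaicD[OF X_ptolemaic assms] by simp
  then show ?thesis
    using ring by (simp add: special_add special_mult laurent_ring_mult)
qed

lemma specialised_algebra_eq: "specialised_algebra n Q y \<sigma> = special ` cluster_algebra n Q"
  by (simp add: specialised_algebra_def special_def)

lemma polyamorous_iff:
  "polyamorous n Q y \<sigma> \<longleftrightarrow> (\<forall>a\<in>cluster_algebra n Q. nonneg_exponents (special a))"
proof -
  have "(\<forall>m\<in>Poly_Mapping.keys (special a). \<forall>i\<in>{..<n} - dom \<sigma>. 0 \<le> Poly_Mapping.lookup m i) \<longleftrightarrow>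
      nonneg_exponents (special a)" if "a \<in> cluster_algebra n Q" for a
  proof
    assume nonneg: "\<forall>m\<in>Poly_Mapping.keys (special a). \<forall>i\<in>{..<n} - dom \<sigma>. 0 \<le> Poly_Mapping.lookup m i"
    have "in_vars n (laurent_expansion n y a)"
      by (rule laurent_ringE[OF cluster_algebra_laurent[OF that]])
    then have "Poly_Mapping.lookup m i = 0"
      if "m \<in> Poly_Mapping.keys (special a)" "i \<notin> {..<n} - dom \<sigma>" for m i
      using specialise_exponents that unfolding special_def by blast
    then have "0 \<le> Poly_Mapping.lookup m i" if "m \<in> Poly_Mapping.keys (special a)" for m i
      using nonneg that by (cases "i \<in> {..<n} - dom \<sigma>") simp_all
    then show "nonneg_exponents (special a)"
      by (auto simp: nonneg_exponents_def supported_def)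
  qed (auto simp: nonneg_exponents_def supported_def)
  then show ?thesis
    unfolding polyamorous_def specialised_algebra_eq by (simp only: ball_simps(9) cong: ball_cong)
qed

text \<open>Polynomials without negative exponents form a subring and specialisation is a ring
  homomorphism, so testing the generators is enough.\<close>

lemma polyamorousI:
  assumes "\<And>a b. (a, b) \<in> diagonals n \<Longrightarrow> nonneg_exponents (special (X a b))"
  shows "polyamorous n Q y \<sigma>"
  unfolding polyamorous_iff
proof
  fix a assume "a \<in> cluster_algebra n Q"
  then show "nonneg_exponents (special a)"
    unfolding cluster_algebra_def
  proof (induction rule: int_algebra_generated.induct)
    case (gen a)
    then show ?case
      unfolding cluster_variables using assms by auto
  qed (simp_all add: special_1 nonneg_exponents_1 special_diff nonneg_exponents_diff special_mult
      nonneg_exponents_mult cluster_algebra_laurent[unfolded cluster_algebra_def])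
qed

lemma cluster_value_special: "cluster_value n y \<sigma> t a = poly_eval t (special a)"
  by (simp add: cluster_value_def special_def)

end

section \<open>Tame friezes and Ptolemy relations\<close>

lemma det_recurrence:
  fixes x1 :: "'a::comm_ring_1"
  shows "det (vector [vector [x1, x2, k * x2 - x1], vector [y1, y2, k * y2 - y1],
    vector [z1, z2, k * z2 - z1]] :: 'a^3^3) = 0"
  by (simp add: det_3 algebra_simps)

text \<open>The determinant equals the defect of the recurrence in the first row times the minor of
  the other two rows. With minor 1, its vanishing passes the recurrence from two rows to the row
  above them.\<close>

lemma det_recurrence_iff:
  fixes x1 :: "'a::comm_ring_1"
  assumes "y1 * z2 - z1 * y2 = 1"
  shows "det (vector [vector [x1, x2, x3], vector [y1, y2, k * y2 - y1],
    vector [z1, z2, k * z2 - z1]] :: 'a^3^3) = 0 \<longleftrightarrow> x3 = k * x2 - x1"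
proof -
  have "det (vector [vector [x1, x2, x3], vector [y1, y2, k * y2 - y1],
      vector [z1, z2, k * z2 - z1]] :: 'a^3^3) = (x1 - k * x2 + x3) * (y1 * z2 - z1 * y2)"
    by (simp add: det_3 algebra_simps)
  also have "\<dots> = x3 - (k * x2 - x1)"
    using assms by simp
  finally show ?thesis
    by simp
qed

section \<open>From Ptolemy relations to tame friezes\<close>

locale polygon_values =
  fixes n :: nat and V :: "int \<Rightarrow> int \<Rightarrow> int"
  assumes V_ptolemaic: "ptolemaic n V"
    and V_commute: "\<And>a b. 0 \<le> a \<Longrightarrow> a < int n + 3 \<Longrightarrow> 0 \<le> b \<Longrightarrow> b < int n + 3 \<Longrightarrow> V a b = V b a"
    and V_refl: "\<And>a. 0 \<le> a \<Longrightarrow> a < int n + 3 \<Longrightarrow> V a a = 0"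
    and V_next: "\<And>a. 0 \<le> a \<Longrightarrow> a < int n + 3 \<Longrightarrow> V a ((a + 1) mod (int n + 3)) = 1"
begin

definition periodic :: "int \<Rightarrow> int \<Rightarrow> int" where
  "periodic i j = V (i mod (int n + 3)) (j mod (int n + 3))"

lemma periodic_commute: "periodic i j = periodic j i"
  unfolding periodic_def by (rule V_commute) simp_all

lemma periodic_shift: "periodic (i - k * (int n + 3)) (j - k * (int n + 3)) = periodic i j"
  unfolding periodic_def by (simp add: mod_diff_eq[symmetric])

lemma periodic_refl: "i mod (int n + 3) = j mod (int n + 3) \<Longrightarrow> periodic i j = 0"
  unfolding periodic_def by (simp add: V_refl)

lemma periodic_next: "periodic i (i + 1) = 1"
  using V_next[of "i mod (int n + 3)"] by (simp add: periodic_def mod_add_left_eq)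

text \<open>After a shift of \<open>a\<close> into the base period, reduction modulo
  \<open>n + 3\<close> rotates the quadruple according to how many of its points have left that
  period, and the relation is invariant under rotation since \<open>V\<close> is symmetric. If two
  neighbouring points coincide, it holds because the values on the diagonal vanish.\<close>

lemma periodic_ptolemy:
  assumes "a \<le> b" "b \<le> c" "c \<le> d" "d \<le> a + int n + 3"
  shows "periodic a c * periodic b d = periodic a b * periodic c d + periodic a d * periodic b c"
proof -
  let ?N = "int n + 3"
  have strict: "periodic a c * periodic b d = periodic a b * periodic c d + periodic a d * periodic b c"
    if abcd: "0 \<le> a" "a < ?N" "a < b" "b < c" "c < d" "d < a + ?N" for a b c d
  proof -
    have low: "i mod ?N = i" if "0 \<le> i" "i < ?N" for i
      using that by simp
    have high: "i mod ?N = i - ?N" if "?N \<le> i" "i < 2 * ?N" for i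
      using that mod_pos_pos_trivial[of "i - ?N" ?N] by (simp add: minus_mod_self2[of i ?N, symmetric] del: minus_mod_self2)
    consider "d < ?N" | "c < ?N" "?N \<le> d" | "b < ?N" "?N \<le> c" | "?N \<le> b"
      by linarith
    then show ?thesis
    proof cases
      case 1
      have mods: "a mod ?N = a" "b mod ?N = b" "c mod ?N = c" "d mod ?N = d"
        using abcd 1 by (auto intro: low high)
      show ?thesis
        unfolding periodic_def mods
        using ptolemaicD[OF V_ptolemaic, of a b c d] abcd 1
        by (simp add: mult.commute add.commute)
    next
      case 2
      have mods: "a mod ?N = a" "b mod ?N = b" "c mod ?N = c" "d mod ?N = d - ?N"
        using abcd 2 by (auto intro: low high)
      show ?thesis
        unfolding periodic_def mods
        using ptolemaicD[OF V_ptolemaic, of "d - ?N" a b c] abcd 2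
          V_commute[of "d - ?N" a] V_commute[of "d - ?N" b] V_commute[of "d - ?N" c]
        by (simp add: mult.commute add.commute)
    next
      case 3
      have mods: "a mod ?N = a" "b mod ?N = b" "c mod ?N = c - ?N" "d mod ?N = d - ?N"
        using abcd 3 by (auto intro: low high)
      show ?thesis
        unfolding periodic_def mods
        using ptolemaicD[OF V_ptolemaic, of "c - ?N" "d - ?N" a b] abcd 3
          V_commute[of "c - ?N" a] V_commute[of "d - ?N" a] V_commute[of "c - ?N" b] V_commute[of "d - ?N" b]
        by (simp add: mult.commute add.commute)
    next
      case 4
      have mods: "a mod ?N = a" "b mod ?N = b - ?N" "c mod ?N = c - ?N" "d mod ?N = d - ?N"
        using abcd 4 by (auto intro: low high)
      show ?thesis
        unfolding periodic_def mods
        using ptolemaicD[OF V_ptolemaic, of "b - ?N" "c - ?N" "d - ?N" a] abcd 4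
          V_commute[of "b - ?N" a] V_commute[of "c - ?N" a] V_commute[of "d - ?N" a]
        by (simp add: mult.commute add.commute)
    qed
  qed
  define k where "k = a div ?N"
  have a: "a - k * ?N = a mod ?N"
    by (simp add: k_def minus_div_mult_eq_mod)
  consider "a = b" | "b = c" | "c = d" | "d = a + ?N" | "a < b" "b < c" "c < d" "d < a + ?N"
    using assms by linarith
  then show ?thesis
  proof cases
    case 4
    then have "periodic b d = periodic b a" "periodic c d = periodic c a" "periodic a d = 0"
      by (simp_all add: periodic_def V_refl)
    then show ?thesis
      by (simp add: periodic_commute mult.commute)
  next
    case 5
    have "0 \<le> a - k * ?N" "a - k * ?N < ?N"
      by (simp_all add: a)
    from strict[OF this, of "b - k * ?N" "c - k * ?N" "d - k * ?N"] 5 show ?thesis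
      unfolding periodic_shift by linarith
  qed (simp_all add: periodic_refl)
qed

lemma tame_frieze_periodic: "tame_frieze n periodic"
  unfolding tame_frieze_def
proof (intro conjI allI impI)
  fix i
  show "periodic i i = 0"
    by (rule periodic_refl) simp
  have "i + int n + 3 = i + (int n + 3)"
    by simp
  then show "periodic i (i + int n + 3) = 0"
    by (intro periodic_refl) (simp only: mod_add_self2)
  show "periodic i (i + 1) = 1"
    by (rule periodic_next)
  have "i + int n + 2 = (i - 1) + (int n + 3)"
    by simp
  then have "periodic i (i + int n + 2) = periodic i (i - 1)"
    unfolding periodic_def by (simp only: mod_add_self2)
  then show "periodic i (i + int n + 2) = 1"
    using periodic_next[of "i - 1"] by (simp add: periodic_commute)
next
  fix i j
  assume "in_array n i j \<and> in_array n (i + 1) (j + 1) \<and> in_array n (i + 1) j \<and> in_array n i (j + 1)"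
  then show "periodic i j * periodic (i + 1) (j + 1) - periodic (i + 1) j * periodic i (j + 1) = 1"
    using periodic_ptolemy[of i "i + 1" j "j + 1"] by (simp add: in_array_def periodic_next)
next
  fix i j :: int
  assume arr: "\<forall>p\<in>{0..2}. \<forall>q\<in>{0..2}. in_array n (i + p) (j + q)"
  have "in_array n (i + 2) (j + 0)" "in_array n (i + 0) (j + 2)"
    using arr by (metis atLeastAtMost_iff order_refl zero_le_numeral)+
  then have bounds: "i + 2 \<le> j" "j + 2 \<le> i + int n + 3"
    by (auto simp: in_array_def)
  \<comment> \<open>The Ptolemy relation for \<open>r, j, j + 1, j + 2\<close>, in which two sides
    equal 1. The coefficient does not depend on \<open>r\<close>, so the three columns are linearly
    dependent.\<close>
  have row: "periodic r (j + 2) = periodic j (j + 2) * periodic r (j + 1) - periodic r j"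
    if "r \<le> j" "j + 2 \<le> r + int n + 3" for r
    using periodic_ptolemy[of r j "j + 1" "j + 2"] that periodic_next[of j] periodic_next[of "j + 1"]
    by (simp add: algebra_simps)
  show "det (vector [vector [periodic i j, periodic i (j + 1), periodic i (j + 2)],
      vector [periodic (i + 1) j, periodic (i + 1) (j + 1), periodic (i + 1) (j + 2)],
      vector [periodic (i + 2) j, periodic (i + 2) (j + 1), periodic (i + 2) (j + 2)]] :: int^3^3) = 0"
    unfolding row[of i, OF _ bounds(2)] using bounds row[of i] row[of "i + 1"] row[of "i + 2"]
    by (simp only: det_recurrence)
qed

end

section \<open>From tame friezes to Ptolemy relations\<close>

locale tame =
  fixes n :: nat and m :: "int \<Rightarrow> int \<Rightarrow> int"
  assumes tame: "tame_frieze n m"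
begin

lemma boundary [simp]: "m i i = 0" "m i (i + 1) = 1"
  using tame by (simp_all add: tame_frieze_def)

lemma boundary_end: "m i (i + int n + 3) = 0" "m i (i + int n + 2) = 1"
  using tame by (simp_all add: tame_frieze_def)

lemma diamond:
  assumes "i + 1 \<le> j" "j + 1 \<le> i + int n + 3"
  shows "m i j * m (i + 1) (j + 1) - m (i + 1) j * m i (j + 1) = 1"
proof -
  have "in_array n i j \<and> in_array n (i + 1) (j + 1) \<and> in_array n (i + 1) j \<and> in_array n i (j + 1)"
    using assms by (simp add: in_array_def)
  then show ?thesis
    using tame unfolding tame_frieze_def by blast
qed

lemma det_zero:
  assumes "i + 2 \<le> j" "j + 2 \<le> i + int n + 3"
  shows "det (vector [vector [m i j, m i (j + 1), m i (j + 2)],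
      vector [m (i + 1) j, m (i + 1) (j + 1), m (i + 1) (j + 2)],
      vector [m (i + 2) j, m (i + 2) (j + 1), m (i + 2) (j + 2)]] :: int^3^3) = 0"
proof -
  have "\<forall>p\<in>{0..2}. \<forall>q\<in>{0..2}. in_array n (i + p) (j + q)"
    using assms by (auto simp: in_array_def)
  then show ?thesis
    using tame unfolding tame_frieze_def by blast
qed

text \<open>The induction moves away from the boundary: \<open>k = 0\<close> uses boundary values
  and \<open>k = 1\<close> a diamond. From \<open>k = 2\<close> on the vanishing determinant
  transfers the recurrence from the two rows already known, whose minor is 1 by the diamond
  rule.\<close>

lemma recurrence_aux:
  "j + 2 \<le> j - int k + int n + 3 \<Longrightarrow>
    m (j - int k) (j + 2) = m j (j + 2) * m (j - int k) (j + 1) - m (j - int k) j"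
proof (induction k rule: less_induct)
  case (less k)
  consider "k = 0" | "k = 1" | l where "k = l + 2"
    by (metis One_nat_def Suc_1 add_2_eq_Suc' less_2_cases_iff not_less_eq old.nat.exhaust)
  then show ?case
  proof cases
    case 2
    have shift: "j - 1 + 1 = j" "j + 1 + 1 = j + 2"
      by simp_all
    show ?thesis
      using diamond[of "j - 1" "j + 1", unfolded shift] boundary(2)[of "j - 1", unfolded shift] 2 less.prems
      by (simp add: mult.commute)
  next
    case 3
    define i where "i = j - int k"
    have i: "j - int (l + 1) = i + 1" "j - int l = i + 2"
      using 3 by (auto simp: i_def)
    have rows: "m (i + 1) (j + 2) = m j (j + 2) * m (i + 1) (j + 1) - m (i + 1) j"
      "m (i + 2) (j + 2) = m j (j + 2) * m (i + 2) (j + 1) - m (i + 2) j"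
      using less.IH[of "l + 1", unfolded i] less.IH[of l, unfolded i] 3 less.prems by (simp_all add: i_def)
    have minor: "m (i + 1) j * m (i + 2) (j + 1) - m (i + 2) j * m (i + 1) (j + 1) = 1"
      using diamond[of "i + 1" j] 3 less.prems by (simp add: i_def add.assoc)
    have "det (vector [vector [m i j, m i (j + 1), m i (j + 2)],
      vector [m (i + 1) j, m (i + 1) (j + 1), m (i + 1) (j + 2)],
      vector [m (i + 2) j, m (i + 2) (j + 1), m (i + 2) (j + 2)]] :: int^3^3) = 0"
      by (rule det_zero) (use 3 less.prems in \<open>simp_all add: i_def\<close>)
    then show ?thesis
      unfolding rows det_recurrence_iff[OF minor] by (simp add: i_def)
  qed simp
qed

lemma recurrence:
  assumes "i + 1 \<le> j" "j + 1 \<le> i + int n + 3"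
  shows "m i (j + 1) = m (j - 1) (j + 1) * m i j - m i (j - 1)"
proof -
  have shift: "j - 1 + 1 = j" "j - 1 + 2 = j + 1"
    by simp_all
  show ?thesis
    using recurrence_aux[of "j - 1" "nat (j - 1 - i)", unfolded shift] assms by simp
qed

text \<open>Rows \<open>s\<close> and \<open>s + 1\<close>, the latter extended to the left by -1, serve as coordinates of
  the columns.\<close>
lemma entry_det:
  assumes "s \<le> i" "i \<le> j" "j \<le> s + int n + 3"
  defines "q \<equiv> \<lambda>j. if j = s then - 1 else m (s + 1) j"
  shows "m i j = m s i * q j - q i * m s j"
proof (cases "i = s")
  case True
  then show ?thesis
    by (simp add: q_def)
next
  case False
  then have i: "s + 1 \<le> i"
    using assms by simp
  have step: "m i (i + int k) = m s i * m (s + 1) (i + int k) - m (s + 1) i * m s (i + int k)"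
    if "i + int k \<le> s + int n + 3" for k
    using that
  proof (induction k rule: less_induct)
    case (less k)
    consider "k = 0" | "k = 1" | l where "k = l + 2"
      by (metis One_nat_def Suc_1 add_2_eq_Suc' less_2_cases_iff not_less_eq old.nat.exhaust)
    then show ?case
    proof cases
      case 2
      then show ?thesis
        using diamond[of s i] i less.prems by simp
    next
      case 3
      \<comment> \<open>Rows \<open>i\<close>, \<open>s\<close> and \<open>s + 1\<close> obey one
        and the same recurrence in the column, so the identity passes from columns
        \<open>c - 1\<close> and \<open>c\<close> to \<open>c + 1\<close>.\<close>
      define c where "c = i + int l + 1"
      have c: "i + int k = c + 1" "i + int (l + 1) = c" "i + int l = c - 1"
        using 3 by (auto simp: c_def)
      have IH: "m i c = m s i * m (s + 1) c - m (s + 1) i * m s c"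
        "m i (c - 1) = m s i * m (s + 1) (c - 1) - m (s + 1) i * m s (c - 1)"
        using less.IH[of "l + 1", unfolded c] less.IH[of l, unfolded c] 3 less.prems c by simp_all
      have bounds: "s + 2 \<le> c" "i + 1 \<le> c" "c + 1 \<le> s + int n + 3"
        using i less.prems 3 by (simp_all add: c_def)
      have "m i (c + 1) = m (c - 1) (c + 1) * m i c - m i (c - 1)"
        "m s (c + 1) = m (c - 1) (c + 1) * m s c - m s (c - 1)"
        "m (s + 1) (c + 1) = m (c - 1) (c + 1) * m (s + 1) c - m (s + 1) (c - 1)"
        by (rule recurrence; use bounds i in linarith)+
      then show ?thesis
        unfolding c(1) by (simp only: IH) (simp only: algebra_simps)
    qed simp
  qed
  show ?thesis
    using step[of "nat (j - i)"] assms i by simp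
qed

lemma entry_ptolemy:
  assumes "a \<le> b" "b \<le> c" "c \<le> d" "d \<le> a + int n + 3"
  shows "m a c * m b d = m a b * m c d + m a d * m b c"
proof -
  define q where "q j = (if j = a then - 1 else m (a + 1) j)" for j
  have det: "m i j = m a i * q j - q i * m a j" if "a \<le> i" "i \<le> j" "j \<le> d" for i j
    using entry_det[of a i j] that assms(4) unfolding q_def by simp
  have dets: "m b d = m a b * q d - q b * m a d" "m c d = m a c * q d - q c * m a d"
    "m b c = m a b * q c - q b * m a c"
    using assms by (auto intro: det)
  show ?thesis
    unfolding dets by (simp add: algebra_simps)
qed

text \<open>The glide symmetry of friezes: by the boundary values the Ptolemy relation for
  \<open>a, b, a + n + 2, a + n + 3\<close> collapses to it. Used twice it gives the period.\<close>

lemma glide: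
  assumes "a \<le> b" "b \<le> a + int n + 3"
  shows "m b (a + int n + 3) = m a b"
proof (cases "b = a + int n + 3")
  case True
  then show ?thesis
    by (simp add: boundary_end)
next
  case False
  have "m (a + int n + 2) (a + int n + 3) = 1"
    using boundary(2)[of "a + int n + 2"] by (simp add: add.assoc)
  then show ?thesis
    using entry_ptolemy[of a b "a + int n + 2" "a + int n + 3"] boundary_end[of a] assms False by simp
qed

lemma period: "a \<le> b \<Longrightarrow> b \<le> a + int n + 3 \<Longrightarrow> m (a + int n + 3) (b + int n + 3) = m a b"
  using glide[of b "a + int n + 3"] glide[of a b] by simp

lemma period_nat:
  "a \<le> b \<Longrightarrow> b \<le> a + int n + 3 \<Longrightarrow> m (a + int k * (int n + 3)) (b + int k * (int n + 3)) = m a b"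
proof (induction k)
  case (Suc k)
  then show ?case
    using period[of "a + int k * (int n + 3)" "b + int k * (int n + 3)"] by (simp add: algebra_simps)
qed simp

lemma period_int:
  assumes "a \<le> b" "b \<le> a + int n + 3"
  shows "m (a - k * (int n + 3)) (b - k * (int n + 3)) = m a b"
proof (cases "0 \<le> k")
  case True
  then show ?thesis
    using period_nat[of "a - k * (int n + 3)" "b - k * (int n + 3)" "nat k"] assms by simp
next
  case False
  then show ?thesis
    using period_nat[of a b "nat (- k)"] assms by simp
qed

lemma m_ptolemaic: "ptolemaic n m"
  unfolding ptolemaic_def using entry_ptolemy by simp

text \<open>A translation by periods moves \<open>i\<close> into the polygon. If \<open>j\<close>
  then lies beyond it, the glide symmetry exchanges the two ends, which matches the symmetry of
  \<open>V\<close>.\<close>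

lemma eq_polygon_values:
  assumes commute: "\<And>a b. 0 \<le> a \<Longrightarrow> a < int n + 3 \<Longrightarrow> 0 \<le> b \<Longrightarrow> b < int n + 3 \<Longrightarrow> V a b = V b a"
    and refl: "\<And>a. 0 \<le> a \<Longrightarrow> a < int n + 3 \<Longrightarrow> V a a = 0"
    and eq: "\<And>a b. 0 \<le> a \<Longrightarrow> a < b \<Longrightarrow> b < int n + 3 \<Longrightarrow> V a b = m a b"
    and ij: "in_array n i j"
  shows "m i j = V (i mod (int n + 3)) (j mod (int n + 3))"
proof -
  let ?N = "int n + 3"
  define a where "a = i mod ?N"
  define b where "b = j - i div ?N * ?N"
  have a: "a = i - i div ?N * ?N" "0 \<le> a" "a < ?N"
    by (simp_all add: a_def minus_div_mult_eq_mod)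
  have b: "a \<le> b" "b \<le> a + int n + 3"
    using ij by (simp_all add: a(1) b_def in_array_def)
  have m: "m i j = m a b"
    unfolding a(1) b_def by (rule period_int[symmetric]) (use ij in \<open>simp_all add: in_array_def\<close>)
  have mod_b: "j mod ?N = b mod ?N"
    by (simp add: b_def mod_diff_eq[symmetric])
  show ?thesis
  proof (cases "b < ?N")
    case True
    then show ?thesis
      unfolding mod_b m a_def[symmetric] using a b eq[of a b] refl[of a] by (cases "a = b") simp_all
  next
    case False
    define c where "c = b - ?N"
    have c: "0 \<le> c" "c \<le> a" "b mod ?N = c"
    proof -
      show "0 \<le> c" "c \<le> a"
        using False b by (simp_all add: c_def)
      then show "b mod ?N = c"
        using a(3) mod_pos_pos_trivial[of c ?N] minus_mod_self2[of b ?N] by (simp add: c_def)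
    qed
    have "m a b = m c a"
      using glide[of c a] c a by (simp add: c_def)
    then show ?thesis
      unfolding mod_b m a_def[symmetric] c(3)
      using a c eq[of c a] refl[of a] commute[of a c] by (cases "a = c") simp_all
  qed
qed

end

section \<open>Dissections by diagonals of value 1 and -1\<close>

text \<open>Cutting leaves polygons on arbitrary subsets of the vertices, so a diagonal is
  recognised by vertices of \<open>V\<close> on both sides and not, as in \<open>diagonals\<close>,
  by arithmetic on the labels.\<close>

definition diagonals_of :: "int set \<Rightarrow> (int \<times> int) set" where
  "diagonals_of V = {(a, b). a \<in> V \<and> b \<in> V \<and> a < b \<and> (\<exists>c\<in>V. a < c \<and> c < b) \<and> (\<exists>c\<in>V. c < a \<or> b < c)}"

definition sides_of :: "int set \<Rightarrow> (int \<times> int) set" where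
  "sides_of V = {(a, b). a \<in> V \<and> b \<in> V \<and> a < b} - diagonals_of V"

lemma sides_ofI:
  "a \<in> V \<Longrightarrow> b \<in> V \<Longrightarrow> a < b \<Longrightarrow> (\<And>c. c \<in> V \<Longrightarrow> \<not> (a < c \<and> c < b)) \<Longrightarrow> (a, b) \<in> sides_of V"
  by (auto simp: sides_of_def diagonals_of_def)

text \<open>The opposite diagonal has value 0, so the Ptolemy relation of the quadrilateral puts no
  condition on the value of \<open>d\<close>.\<close>

definition free_diagonal ::
  "(int \<Rightarrow> int \<Rightarrow> int) \<Rightarrow> (int \<times> int) set \<Rightarrow> int \<times> int \<Rightarrow> bool" where
  "free_diagonal f S d \<longleftrightarrow> (\<exists>p q r s. p < q \<and> q < r \<and> r < s \<and> {(p, q), (q, r), (r, s), (p, s)} \<subseteq> S \<and>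
     (d = (q, s) \<and> f p r = 0 \<or> d = (p, r) \<and> f q s = 0))"

text \<open>The dissection proper is \<open>S\<close>. Since a cluster needs a full triangulation,
  \<open>T\<close> completes it by free diagonals of quadrilaterals.\<close>

definition sign_dissection ::
  "(int \<Rightarrow> int \<Rightarrow> int) \<Rightarrow> int set \<Rightarrow> (int \<times> int) set \<Rightarrow> (int \<times> int) set \<Rightarrow> bool" where
  "sign_dissection f V T S \<longleftrightarrow> S \<subseteq> T \<and> T \<subseteq> diagonals_of V \<and> (\<forall>d\<in>T. \<forall>e\<in>T. \<not> crossing d e) \<and>
     (\<forall>d\<in>diagonals_of V - T. \<exists>e\<in>T. crossing d e) \<and> (\<forall>(a, b)\<in>S. \<bar>f a b\<bar> = 1) \<and>
     (\<forall>d\<in>T - S. free_diagonal f (S \<union> sides_of V) d)"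

lemma free_diagonal_mono:
  assumes "free_diagonal f S d" "S \<subseteq> S'"
  shows "free_diagonal f S' d"
proof -
  obtain p q r s where "p < q \<and> q < r \<and> r < s \<and> {(p, q), (q, r), (r, s), (p, s)} \<subseteq> S \<and>
     (d = (q, s) \<and> f p r = 0 \<or> d = (p, r) \<and> f q s = 0)"
    using assms(1) unfolding free_diagonal_def by blast
  then show ?thesis
    unfolding free_diagonal_def using assms(2)
    by (intro exI[of _ p] exI[of _ q] exI[of _ r] exI[of _ s]) auto
qed

text \<open>Common to both cuts: \<open>W\<close> consists of the vertices cut off beyond
  \<open>(i, k)\<close>, one for an ear and two for a quadrilateral; \<open>U\<close> is empty for
  an ear and holds the free diagonal of a quadrilateral.\<close>

lemma sign_dissection_glue:
  assumes V': "sign_dissection f V' T' S'" and ik: "i \<in> V'" "k \<in> V'" "i < k" "\<bar>f i k\<bar> = 1"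
    and outside: "\<And>x. x \<in> V' \<Longrightarrow> x \<le> i \<or> k \<le> x" and inside: "\<And>x. x \<in> W \<Longrightarrow> i < x \<and> x < k"
    and inner: "\<And>d. d \<in> U \<Longrightarrow> d \<in> diagonals_of (V' \<union> W) \<and> i \<le> fst d \<and> snd d \<le> k"
      "\<And>d e. d \<in> U \<Longrightarrow> e \<in> U \<Longrightarrow> \<not> crossing d e"
      "\<And>a b. (a, b) \<in> diagonals_of (V' \<union> W) \<Longrightarrow> i \<le> a \<Longrightarrow> b \<le> k \<Longrightarrow> (a, b) \<noteq> (i, k) \<Longrightarrow> (a, b) \<notin> U \<Longrightarrow>
        \<exists>e\<in>U. crossing (a, b) e"
      "\<And>d. d \<in> U \<Longrightarrow> free_diagonal f (sides_of (V' \<union> W) \<union> {(i, k)}) d"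
  shows "\<exists>T S. sign_dissection f (V' \<union> W) T S"
proof -
  define V where "V = V' \<union> W"
  \<comment> \<open>Empty if \<open>(i, k)\<close> is still a side of the larger polygon, as happens
    when \<open>V'\<close> is just \<open>{i, k}\<close>.\<close>
  define N where "N = {(i, k)} \<inter> diagonals_of V"
  define T where "T = T' \<union> N \<union> U"
  define S where "S = S' \<union> N"
  have S': "S' \<subseteq> T'" "T' \<subseteq> diagonals_of V'" "\<And>d e. d \<in> T' \<Longrightarrow> e \<in> T' \<Longrightarrow> \<not> crossing d e"
    "\<And>d. d \<in> diagonals_of V' - T' \<Longrightarrow> \<exists>e\<in>T'. crossing d e" "\<And>a b. (a, b) \<in> S' \<Longrightarrow> \<bar>f a b\<bar> = 1"
    "\<And>d. d \<in> T' - S' \<Longrightarrow> free_diagonal f (S' \<union> sides_of V') d"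
    using V' by (auto simp: sign_dissection_def)
  have mono: "diagonals_of V' \<subseteq> diagonals_of V"
    by (auto simp: diagonals_of_def V_def)
  \<comment> \<open>The vertices of \<open>W\<close> lie between \<open>i\<close> and
    \<open>k\<close>, so a pair of \<open>V'\<close> other than \<open>(i, k)\<close> that has one
    of them on some side also has \<open>i\<close> or \<open>k\<close> on that side.\<close>
  have old: "(a, b) \<in> diagonals_of V' \<or> (a, b) = (i, k)"
    if ab: "(a, b) \<in> diagonals_of V" "a \<in> V'" "b \<in> V'" for a b
  proof (cases "(a, b) = (i, k)")
    case False
    obtain c where c: "c \<in> V" "a < c" "c < b"
      using ab(1) by (auto simp: diagonals_of_def)
    have "\<exists>c\<in>V'. a < c \<and> c < b"
    proof (cases "c \<in> V'")
      case False
      then have "i < c" "c < k"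
        using c(1) inside by (auto simp: V_def)
      then have "a \<le> i" "k \<le> b"
        using outside[OF ab(2)] outside[OF ab(3)] c by auto
      then show ?thesis
        using \<open>(a, b) \<noteq> (i, k)\<close> ik by (metis order.strict_trans1 order.strict_trans2 order_le_imp_less_or_eq)
    qed (use c in auto)
    moreover obtain c' where c': "c' \<in> V" "c' < a \<or> b < c'"
      using ab(1) by (auto simp: diagonals_of_def)
    have "\<exists>c\<in>V'. c < a \<or> b < c"
    proof (cases "c' \<in> V'")
      case False
      then have "i < c'" "c' < k"
        using c'(1) inside by (auto simp: V_def)
      then show ?thesis
        using c'(2) ik by (metis order.strict_trans)
    qed (use c' in auto)
    ultimately show ?thesis
      using ab by (auto simp: diagonals_of_def)
  qed simp
  have not_crossed: "\<not> crossing (a, b) e" "\<not> crossing e (a, b)" if "e \<in> T'" "i \<le> a" "b \<le> k" for a b e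
  proof -
    obtain x y where e: "e = (x, y)"
      by (cases e)
    have "x \<in> V'" "y \<in> V'"
      using that(1) S'(2) by (auto simp: e diagonals_of_def)
    then show "\<not> crossing (a, b) e" "\<not> crossing e (a, b)"
      using outside[of x] outside[of y] that(2,3) by (auto simp: e crossing_pair)
  qed
  have N_sub: "N \<subseteq> {(i, k)}"
    by (simp add: N_def)
  have within: "i \<le> fst d \<and> snd d \<le> k" if "d \<in> N \<union> U" for d
    using that inner(1)[of d] by (auto simp: N_def)
  have N_crossing: "\<not> crossing (i, k) d" "\<not> crossing d (i, k)" if "d \<in> N \<union> U" for d
    using within[OF that] by (cases d; auto simp: crossing_pair)+
  have sides: "sides_of V' \<subseteq> sides_of V \<union> N"
  proof
    fix d assume d: "d \<in> sides_of V'"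
    obtain a b where ab: "d = (a, b)"
      by (cases d)
    show "d \<in> sides_of V \<union> N"
      using old[of a b] d unfolding ab sides_of_def N_def V_def by auto
  qed
  have ik_side: "(i, k) \<in> S \<union> sides_of V"
    using ik by (auto simp: S_def N_def sides_of_def V_def)
  have "\<not> crossing d e" if de: "d \<in> T" "e \<in> T" for d e
  proof -
    consider "d \<in> T'" "e \<in> T'" | "d \<in> T'" "e \<in> N \<union> U" | "d \<in> N \<union> U" "e \<in> T'"
      | "d \<in> U" "e \<in> U" | "d = (i, k)" "e \<in> N \<union> U" | "d \<in> N \<union> U" "e = (i, k)"
      using de N_sub unfolding T_def by blast
    then show ?thesis
    proof cases
      case 2
      then show ?thesis
        using not_crossed(2)[of d "fst e" "snd e"] within[of e] by simp
    next
      case 3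
      then show ?thesis
        using not_crossed(1)[of e "fst d" "snd d"] within[of d] by simp
    qed (use S'(3) inner(2) N_crossing in auto)
  qed
  moreover have "\<exists>e\<in>T. crossing d e" if d: "d \<in> diagonals_of V - T" for d
  proof -
    obtain a b where ab: "d = (a, b)"
      by (cases d)
    have neq: "(a, b) \<noteq> (i, k)"
      using d unfolding ab T_def N_def by blast
    show ?thesis
    proof (cases "a \<in> V' \<and> b \<in> V'")
      case True
      then have "d \<in> diagonals_of V' - T'"
        using old[of a b] neq d unfolding ab T_def by blast
      then show ?thesis
        using S'(4) unfolding T_def by blast
    next
      case False
      have in_V: "a \<in> V' \<union> W" "b \<in> V' \<union> W" "a < b"
        using d unfolding ab V_def[symmetric] by (auto simp: diagonals_of_def)
      show ?thesis
      proof (cases "i \<le> a \<and> b \<le> k")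
        case True
        then show ?thesis
          using inner(3)[of a b] d neq unfolding ab T_def V_def by blast
      next
        case F: False
        have "crossing (a, b) (i, k)"
          using False F in_V inside[of a] inside[of b] outside[of a] outside[of b]
          unfolding crossing_pair by auto
        moreover have "a < i \<or> k < b"
          using F by auto
        then have "\<exists>c\<in>V. c < i \<or> k < c"
          using in_V unfolding V_def by blast
        moreover have "\<exists>c\<in>V. i < c \<and> c < k"
          using False in_V inside unfolding V_def by blast
        moreover have "i \<in> V" "k \<in> V"
          using ik by (auto simp: V_def)
        ultimately have "(i, k) \<in> T"
          using ik(3) by (auto simp: T_def N_def diagonals_of_def)
        then show ?thesis
          using \<open>crossing (a, b) (i, k)\<close> unfolding ab by blast
      qed
    qed
  qed
  moreover have "free_diagonal f (S \<union> sides_of V) d" if d: "d \<in> T - S" for d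
  proof -
    consider "d \<in> T' - S'" | "d \<in> U"
      using d unfolding T_def S_def by blast
    then show ?thesis
    proof cases
      case 1
      then show ?thesis
        using free_diagonal_mono[OF S'(6)[OF 1], of "S \<union> sides_of V"] sides by (auto simp: S_def)
    next
      case 2
      then show ?thesis
        using free_diagonal_mono[OF inner(4)[OF 2], of "S \<union> sides_of V"] ik_side by (simp add: V_def)
    qed
  qed
  moreover have "S \<subseteq> T" "T \<subseteq> diagonals_of V"
    using S'(1,2) mono inner(1) by (auto simp: S_def T_def N_def V_def)
  moreover have "\<bar>f a b\<bar> = 1" if "(a, b) \<in> S" for a b
    using that S'(5) ik(4) by (auto simp: S_def N_def)
  ultimately have "sign_dissection f V T S"
    unfolding sign_dissection_def by blast
  then show ?thesis
    unfolding V_def by blast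
qed

section \<open>Small ears and the construction of the dissection\<close>

locale integer_values =
  fixes n :: nat and f :: "int \<Rightarrow> int \<Rightarrow> int"
  assumes f_ptolemaic: "ptolemaic n f"
begin

abbreviation unit_value :: "int \<Rightarrow> int \<Rightarrow> bool" where
  "unit_value a b \<equiv> \<bar>f a b\<bar> = 1"

text \<open>A convexity argument: with unit sides and an ear of absolute value at least 2, the
  Ptolemy relation gives \<open>\<bar>f p c''\<bar> \<ge> 2 * \<bar>f p c'\<bar> - \<bar>f p
  c\<bar>\<close>, so a strict increase persists.\<close>

lemma row_growth:
  assumes "sorted_wrt (<) (p # c # c' # zs)" "set (p # c # c' # zs) \<subseteq> {0..<int n + 3}"
    "successively unit_value (c # c' # zs)"
    "\<And>ys i j k ws. c # c' # zs = ys @ [i, j, k] @ ws \<Longrightarrow> 2 \<le> \<bar>f i k\<bar>"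
    "\<bar>f p c\<bar> < \<bar>f p c'\<bar>"
  shows "\<bar>f p c\<bar> < \<bar>f p (last (c' # zs))\<bar>"
  using assms
proof (induction zs arbitrary: c c')
  case (Cons c'' zs)
  have "f p c' * f c c'' = f p c * f c' c'' + f p c'' * f c c'"
    using ptolemaicD[OF f_ptolemaic, of p c c' c''] Cons.prems(1,2) by simp
  then have eq: "\<bar>f p c'' * f c c'\<bar> = \<bar>f p c' * f c c'' - f p c * f c' c''\<bar>"
    by simp
  have units: "unit_value c c'" "unit_value c' c''"
    using Cons.prems(3) by simp_all
  have ear: "2 \<le> \<bar>f c c''\<bar>"
    using Cons.prems(4)[of "[]" c c' c'' zs] by simp
  have "\<bar>f p c'\<bar> * 2 - \<bar>f p c\<bar> \<le> \<bar>f p c'\<bar> * \<bar>f c c''\<bar> - \<bar>f p c\<bar>"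
    using mult_left_mono[OF ear, of "\<bar>f p c'\<bar>"] by simp
  also have "\<dots> \<le> \<bar>f p c' * f c c'' - f p c * f c' c''\<bar>"
    using abs_triangle_ineq2[of "f p c' * f c c''" "f p c * f c' c''"] units by (simp add: abs_mult)
  also have "\<dots> = \<bar>f p c''\<bar>"
    using eq units by (simp add: abs_mult)
  finally have grow: "\<bar>f p c'\<bar> < \<bar>f p c''\<bar>"
    using Cons.prems(5) by simp
  have "\<bar>f p c'\<bar> < \<bar>f p (last (c'' # zs))\<bar>"
  proof (rule Cons.IH[OF _ _ _ _ grow])
    show "2 \<le> \<bar>f i k\<bar>" if "c' # c'' # zs = ys @ [i, j, k] @ ws" for ys i j k ws
      using Cons.prems(4)[of "c # ys" i j k ws] that by simp
  qed (use Cons.prems in auto)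
  then show ?case
    using Cons.prems(5) by simp
qed simp

text \<open>If all ears were large, the absolute values seen from the first vertex would rise from 1
  at its neighbour to at least 2 at the next vertex and stay above 1, contradicting the closing
  side.\<close>

lemma small_ear:
  assumes "sorted_wrt (<) xs" "set xs \<subseteq> {0..<int n + 3}" "3 \<le> length xs"
    "successively unit_value xs" "unit_value (hd xs) (last xs)"
  obtains ys i j k zs where "xs = ys @ [i, j, k] @ zs" "\<bar>f i k\<bar> \<le> 1"
proof (rule ccontr)
  assume "\<not> thesis"
  note small = that
  have large: "2 \<le> \<bar>f i k\<bar>" if "xs = ys @ [i, j, k] @ zs" for ys i j k zs
  proof (rule ccontr)
    assume "\<not> 2 \<le> \<bar>f i k\<bar>"
    then have thesis
      by (intro small[OF that]) simp
    with \<open>\<not> thesis\<close> show False ..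
  qed
  obtain p c c' zs where xs: "xs = p # c # c' # zs"
    using assms(3) by (metis Suc_le_length_iff numeral_3_eq_3)
  have "\<bar>f p c\<bar> < \<bar>f p c'\<bar>"
    using large[of "[]" p c c' zs] assms(4) by (simp add: xs)
  then have "\<bar>f p c\<bar> < \<bar>f p (last (c' # zs))\<bar>"
  proof (rule row_growth[rotated -1])
    show "2 \<le> \<bar>f i k\<bar>" if "c # c' # zs = ys @ [i, j, k] @ ws" for ys i j k ws
      using large[of "p # ys" i j k ws] that by (simp add: xs)
  qed (use assms xs in auto)
  then show False
    using assms(4,5) by (simp add: xs)
qed

text \<open>An ear of value 1 or -1 is cut off. If an ear has value 0, the Ptolemy relation gives
  the adjacent diagonal spanning two vertices the value 1 or -1, and a quadrilateral is cut off.\<close>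
lemma sign_dissection_exists:
  "sorted_wrt (<) xs \<Longrightarrow> set xs \<subseteq> {0..<int n + 3} \<Longrightarrow> 2 \<le> length xs \<Longrightarrow> successively unit_value xs \<Longrightarrow>
    unit_value (hd xs) (last xs) \<Longrightarrow> \<exists>T S. sign_dissection f (set xs) T S"
proof (induction "length xs" arbitrary: xs rule: less_induct)
  case less
  have remove: "\<exists>T S. sign_dissection f (set (ys @ [i, k] @ zs)) T S"
    if "xs = ys @ [i] @ ws @ [k] @ zs" "ws \<noteq> []" "unit_value i k" for ys i ws k zs
  proof (rule less.hyps)
    show "length (ys @ [i, k] @ zs) < length xs"
      using that(2) by (simp add: that(1))
    show "sorted_wrt (<) (ys @ [i, k] @ zs)" "set (ys @ [i, k] @ zs) \<subseteq> {0..<int n + 3}"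
      using less.prems(1,2) by (auto simp: that(1) sorted_wrt_append)
    show "successively unit_value (ys @ [i, k] @ zs)"
      using less.prems(4) that(3) by (auto simp: that(1) successively_append_iff successively_Cons)
    show "unit_value (hd (ys @ [i, k] @ zs)) (last (ys @ [i, k] @ zs))"
      using less.prems(5) unfolding that(1) by (cases "ys = []"; cases "zs = []") simp_all
  qed simp
  have quad: ?case
    if xs: "xs = ys @ [p, q, r, s] @ zs" and zero: "f p r = 0 \<or> f q s = 0" for ys p q r s zs
  proof -
    have order: "p < q" "q < r" "r < s" "\<And>x. x \<in> set ys \<Longrightarrow> x < p" "\<And>x. x \<in> set zs \<Longrightarrow> s < x"
      using less.prems(1) by (auto simp: xs sorted_wrt_append)
    have units: "unit_value p q" "unit_value q r" "unit_value r s"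
      using less.prems(4) by (auto simp: xs successively_append_iff successively_Cons)
    have "f p r * f q s = f p q * f r s + f p s * f q r"
      using ptolemaicD[OF f_ptolemaic, of p q r s] less.prems(2) order by (simp add: xs)
    then have "\<bar>f p s * f q r\<bar> = \<bar>f p q * f r s\<bar>"
      using zero by auto
    then have ps: "unit_value p s"
      using units by (simp add: abs_mult)
    obtain T S where TS: "sign_dissection f (set (ys @ [p, s] @ zs)) T S"
      using remove[of ys p "[q, r]" s zs] ps by (auto simp: xs)
    have set_xs: "set xs = set (ys @ [p, s] @ zs) \<union> {q, r}"
      by (auto simp: xs)
    have mem: "x \<in> set xs \<Longrightarrow> x < p \<or> x = p \<or> x = q \<or> x = r \<or> x = s \<or> s < x" for x
      using order by (auto simp: xs)
    have in_xs: "p \<in> set xs" "q \<in> set xs" "r \<in> set xs" "s \<in> set xs"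
      by (auto simp: xs)
    have gap: "\<not> (p < c \<and> c < q)" "\<not> (q < c \<and> c < r)" "\<not> (r < c \<and> c < s)" if "c \<in> set xs" for c
      using mem[OF that] order(1-3) by auto
    have sides: "(p, q) \<in> sides_of (set xs)" "(q, r) \<in> sides_of (set xs)" "(r, s) \<in> sides_of (set xs)"
      using sides_ofI[OF in_xs(1,2) order(1) gap(1)] sides_ofI[OF in_xs(2,3) order(2) gap(2)]
        sides_ofI[OF in_xs(3,4) order(3) gap(3)] by simp_all
    have diagonals: "(q, s) \<in> diagonals_of (set xs)" "(p, r) \<in> diagonals_of (set xs)"
      using in_xs order(1-3) by (auto simp: diagonals_of_def)
    have inner: "(a, b) \<in> {(q, s), (p, r)}"
      if "(a, b) \<in> diagonals_of (set xs)" "p \<le> a" "b \<le> s" "(a, b) \<noteq> (p, s)" for a b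
    proof -
      have ab: "a \<in> set xs" "b \<in> set xs" "a < b"
        using that(1) by (auto simp: diagonals_of_def)
      have "a = p \<or> a = q \<or> a = r \<or> a = s" "b = p \<or> b = q \<or> b = r \<or> b = s"
        using mem[OF ab(1)] mem[OF ab(2)] that(2,3) ab(3) by linarith+
      moreover have "\<not> (a = p \<and> b = q)" "\<not> (a = q \<and> b = r)" "\<not> (a = r \<and> b = s)" "\<not> (a = p \<and> b = s)"
        using that(1,4) sides by (auto simp: sides_of_def)
      ultimately have "a = q \<and> b = s \<or> a = p \<and> b = r"
        using order(1-3) ab(3) by (smt (verit))
      then show ?thesis
        by simp
    qed
    \<comment> \<open>The diagonal opposite to a zero; if both diagonals vanish, either would
      do.\<close>
    define d where "d = (if f p r = 0 then (q, s) else (p, r))"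
    have "\<exists>T S. sign_dissection f (set (ys @ [p, s] @ zs) \<union> {q, r}) T S"
    proof (rule sign_dissection_glue[OF TS, where U = "{d}" and i = p and k = s])
      show "e \<in> diagonals_of (set (ys @ [p, s] @ zs) \<union> {q, r}) \<and> p \<le> fst e \<and> snd e \<le> s" if "e \<in> {d}" for e
        using that diagonals order(1-3) unfolding set_xs[symmetric] by (auto simp: d_def)
      show "\<not> crossing e e'" if "e \<in> {d}" "e' \<in> {d}" for e e'
        using that crossing_irrefl by auto
      show "\<exists>e\<in>{d}. crossing (a, b) e"
        if "(a, b) \<in> diagonals_of (set (ys @ [p, s] @ zs) \<union> {q, r})" "p \<le> a" "b \<le> s"
          "(a, b) \<noteq> (p, s)" "(a, b) \<notin> {d}" for a b
      proof -
        have "(a, b) \<in> {(q, s), (p, r)}"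
          using inner[of a b] that unfolding set_xs[symmetric] by blast
        then show ?thesis
          using that(5) order(1-3) by (auto simp: d_def crossing_pair)
      qed
      show "free_diagonal f (sides_of (set (ys @ [p, s] @ zs) \<union> {q, r}) \<union> {(p, s)}) e" if "e \<in> {d}" for e
        unfolding free_diagonal_def set_xs[symmetric]
        by (rule exI[of _ p], rule exI[of _ q], rule exI[of _ r], rule exI[of _ s])
          (use that zero order(1-3) sides in \<open>auto simp: d_def\<close>)
    qed (use order ps in \<open>auto intro: less_imp_le\<close>)
    then show ?thesis
      unfolding set_xs .
  qed
  show ?case
  proof (cases "length xs = 2")
    \<comment> \<open>The recursion ends with a digon: in a triangle the ear is the closing side,
      and cutting along it leaves two vertices.\<close>
    case True
    then obtain a b where "xs = [a, b]"
      by (metis length_0_conv length_Suc_conv numeral_2_eq_2)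
    then have "diagonals_of (set xs) = {}"
      by (auto simp: diagonals_of_def)
    then have "sign_dissection f (set xs) {} {}"
      by (simp add: sign_dissection_def)
    then show ?thesis
      by blast
  next
    case False
    then have "3 \<le> length xs"
      using less.prems(3) by simp
    then obtain ys i j k zs where xs: "xs = ys @ [i, j, k] @ zs" and ear: "\<bar>f i k\<bar> \<le> 1"
      using small_ear less.prems by metis
    have order: "i < j" "j < k" "\<And>x. x \<in> set ys \<Longrightarrow> x < i" "\<And>x. x \<in> set zs \<Longrightarrow> k < x"
      using less.prems(1) by (auto simp: xs sorted_wrt_append)
    consider "unit_value i k" | "f i k = 0"
      using ear by linarith
    then show ?thesis
    proof cases
      case 1
      obtain T S where TS: "sign_dissection f (set (ys @ [i, k] @ zs)) T S"
        using remove[of ys i "[j]" k zs] 1 by (auto simp: xs)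
      have set_xs: "set xs = set (ys @ [i, k] @ zs) \<union> {j}"
        by (auto simp: xs)
      have mem: "x \<in> set xs \<Longrightarrow> x < i \<or> x = i \<or> x = j \<or> x = k \<or> k < x" for x
        using order by (auto simp: xs)
      have "\<exists>T S. sign_dissection f (set (ys @ [i, k] @ zs) \<union> {j}) T S"
      proof (rule sign_dissection_glue[OF TS, where U = "{}" and i = i and k = k])
        show "\<exists>e\<in>{}. crossing (a, b) e"
          if ab: "(a, b) \<in> diagonals_of (set (ys @ [i, k] @ zs) \<union> {j})" "i \<le> a" "b \<le> k" "(a, b) \<noteq> (i, k)"
          for a b
        proof -
          have "(a, b) \<in> diagonals_of (set xs)"
            using ab(1) unfolding set_xs .
          then obtain c where "a \<in> set xs" "b \<in> set xs" "c \<in> set xs" "a < c" "c < b"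
            by (auto simp: diagonals_of_def)
          then show ?thesis
            using mem[of a] mem[of b] mem[of c] ab(2-4) order(1,2) by auto
        qed
      qed (use order 1 in \<open>auto intro: less_imp_le\<close>)
      then show ?thesis
        unfolding set_xs .
    next
      case 2
      \<comment> \<open>In a triangle the ear would be the closing side, which is a unit; so an ear
        of value 0 has a further vertex next to it.\<close>
      have "ys \<noteq> [] \<or> zs \<noteq> []"
        using less.prems(5) 2 by (auto simp: xs)
      then consider l zs' where "zs = l # zs'" | l ys' where "ys = ys' @ [l]"
        by (metis neq_Nil_conv rev_exhaust)
      then show ?thesis
      proof cases
        case 1
        then show ?thesis
          using quad[of ys i j k l zs'] 2 by (simp add: xs)
      next
        case l: 2
        then show ?thesis
          using quad[of ys' l i j k zs] 2 by (simp add: xs)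
      qed
    qed
  qed
qed

lemma triangulation_exists:
  assumes "\<And>a b. (a, b) \<in> sides n \<Longrightarrow> unit_value a b"
  shows "\<exists>T S. triangulation n T \<and> S \<subseteq> T \<and> (\<forall>(a, b)\<in>S. unit_value a b) \<and>
    (\<forall>d\<in>T - S. free_diagonal f (S \<union> sides n) d)"
proof -
  let ?xs = "[0..int n + 2]"
  have "\<exists>T S. sign_dissection f (set ?xs) T S"
  proof (rule sign_dissection_exists)
    show "sorted_wrt (<) ?xs"
      by (simp add: strict_sorted_iff)
    show "successively unit_value ?xs"
      unfolding successively_conv_nth using assms by (auto simp: nth_upto sides_def)
    have "hd ?xs = 0" "last ?xs = int n + 2"
      by (simp_all add: hd_conv_nth last_conv_nth nth_upto)
    then show "unit_value (hd ?xs) (last ?xs)"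
      using assms[of 0 "int n + 2"] by (simp add: sides_def)
  qed auto
  then obtain T S where TS: "sign_dissection f {0..int n + 2} T S"
    by auto
  have dia: "diagonals_of {0..int n + 2} = diagonals n"
  proof -
    have "(a, b) \<in> diagonals_of {0..int n + 2} \<longleftrightarrow> (a, b) \<in> diagonals n" for a b
    proof
      assume "(a, b) \<in> diagonals n"
      then have ab: "0 \<le> a" "a + 2 \<le> b" "b < int n + 3" "(a, b) \<noteq> (0, int n + 2)"
        by (auto simp: diagonals_def)
      have "\<exists>c\<in>{0..int n + 2}. a < c \<and> c < b"
        by (rule bexI[of _ "a + 1"]) (use ab in auto)
      moreover have "\<exists>c\<in>{0..int n + 2}. c < a \<or> b < c"
        using ab by (cases "a = 0") (auto intro: bexI[of _ "int n + 2"] bexI[of _ 0])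
      ultimately show "(a, b) \<in> diagonals_of {0..int n + 2}"
        using ab unfolding diagonals_of_def by simp
    qed (auto simp: diagonals_of_def diagonals_def)
    then show ?thesis
      by (intro set_eqI) (metis surj_pair)
  qed
  have sides: "sides_of {0..int n + 2} \<subseteq> sides n"
  proof -
    have "sides_of {0..int n + 2} \<subseteq> pairs n - diagonals n"
      unfolding sides_of_def dia pairs_def by auto
    then show ?thesis
      unfolding pairs_eq by blast
  qed
  note TS' = TS[unfolded sign_dissection_def dia]
  show ?thesis
  proof (intro exI conjI ballI)
    show "triangulation n T"
      using TS' by (simp add: triangulation_def)
    show "S \<subseteq> T"
      using TS' by simp
    show "case d of (a, b) \<Rightarrow> unit_value a b" if "d \<in> S" for d
      using TS' that by auto
    show "free_diagonal f (S \<union> sides n) d" if "d \<in> T - S" for d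
    proof (rule free_diagonal_mono)
      show "free_diagonal f (S \<union> sides_of {0..int n + 2}) d"
        using TS' that by simp
    qed (use sides in auto)
  qed
qed

end

section \<open>Friezes from specialised clusters\<close>

lemma seed_triangulation:
  assumes path: "path_quiver n Q" and X: "polygon_model n Q X" and seed: "(R, y) \<in> seeds n Q"
  obtains T where "polygon_seed n Q R y X T"
proof -
  have "y ` {..<n} \<in> clusters n Q"
    using seed by (force simp: clusters_def)
  then obtain T where "triangulation n T" "y ` {..<n} = case_prod X ` T"
    using X by (auto simp: polygon_model_def)
  then have "polygon_seed n Q R y X T"
    by unfold_locales (use seed X path_quiver_loopless[OF path] in auto)
  then show ?thesis
    using that by blast
qed

lemma (in specialised_seed) polyamorous_tame:
  assumes "polyamorous n Q y \<sigma>"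
  shows "tame_frieze n (value_array n X (cluster_value n y \<sigma> t))"
proof -
  let ?V = "\<lambda>a b. cluster_value n y \<sigma> t (X a b)"
  have nonneg: "nonneg_exponents (special (X a b))"
    if "0 \<le> a" "a < int n + 3" "0 \<le> b" "b < int n + 3" for a b
    using assms cluster_algebra_X[OF that] by (simp add: polyamorous_iff)
  have mult: "poly_eval t (special (X a b) * special (X c d)) = ?V a b * ?V c d"
    if "0 \<le> a" "a < int n + 3" "0 \<le> b" "b < int n + 3" "0 \<le> c" "c < int n + 3" "0 \<le> d" "d < int n + 3"
    for a b c d
    using nonneg that by (simp add: cluster_value_special poly_eval_mult)
  interpret polygon_values n ?V
  proof
    show "ptolemaic n ?V"
      unfolding ptolemaic_def
    proof (intro allI impI)
      fix p q r s assume "0 \<le> p \<and> p < q \<and> q < r \<and> r < s \<and> s < int n + 3"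
      then have pqrs: "0 \<le> p" "p < q" "q < r" "r < s" "s < int n + 3"
        by auto
      have "poly_eval t (special (X p r) * special (X q s)) =
          poly_eval t (special (X p q) * special (X r s) + special (X p s) * special (X q r))"
        using special_ptolemy[OF pqrs] by simp
      then show "?V p r * ?V q s = ?V p q * ?V r s + ?V p s * ?V q r"
        using pqrs by (simp add: poly_eval_add mult)
    qed
    show "?V a b = ?V b a" if "0 \<le> a" "a < int n + 3" "0 \<le> b" "b < int n + 3" for a b
      using X_commute[OF that] by simp
    show "?V a a = 0" if "0 \<le> a" "a < int n + 3" for a
      using X_refl[OF that] by (simp add: cluster_value_special special_0 poly_eval_lin_ext)
    show "?V a ((a + 1) mod (int n + 3)) = 1" if "0 \<le> a" "a < int n + 3" for a
      using X_next[OF that] by (simp add: cluster_value_special special_1 poly_eval_1)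
  qed
  have "value_array n X (cluster_value n y \<sigma> t) = periodic"
    by (simp add: fun_eq_iff value_array_def periodic_def)
  then show ?thesis
    using tame_frieze_periodic by simp
qed

section \<open>The specialisation attached to a dissection\<close>

locale sign_seed = polygon_seed n Q R y X T + tame n m for n Q R y X T m +
  fixes S :: "(int \<times> int) set"
  assumes S_subset: "S \<subseteq> T"
    and unit: "\<And>a b. (a, b) \<in> S \<Longrightarrow> \<bar>m a b\<bar> = 1"
    and free: "\<And>d. d \<in> T - S \<Longrightarrow> free_diagonal m (S \<union> sides n) d"
begin

definition label :: "nat \<Rightarrow> int \<times> int" where
  "label i = (SOME d. d \<in> T \<and> y i = case_prod X d)"

definition sign :: "nat \<rightharpoonup> int" where
  "sign i = (if i < n \<and> label i \<in> S then Some (case_prod m (label i)) else None)"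

definition free_value :: "nat \<Rightarrow> int" where
  "free_value i = case_prod m (label i)"

lemma T_diagonals: "T \<subseteq> diagonals n"
  using triangulation by (simp add: triangulation_def)

lemma label_eq:
  assumes "i < n" "(a, b) \<in> T" "y i = X a b"
  shows "label i = (a, b)"
proof -
  have "label i \<in> T \<and> y i = case_prod X (label i)"
    unfolding label_def by (rule someI[of _ "(a, b)"]) (use assms in simp)
  moreover have "inj_on (case_prod X) (diagonals n)"
    using model by (simp add: polygon_model_def bij_betw_def)
  ultimately show ?thesis
    using assms(2,3) T_diagonals by (auto dest!: inj_onD[of _ _ "label i" "(a, b)"])
qed

sublocale specialised_seed n Q R y X T sign
proof
  have "s \<in> {1, - 1}" if "sign i = Some s" for i s
    using that unit[of "fst (label i)" "snd (label i)"]
    by (auto simp: sign_def case_prod_beta split: if_splits)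
  moreover have "dom sign \<subseteq> {..<n}"
    by (auto simp: sign_def split: if_splits)
  ultimately show "specialisation n sign"
    by (auto simp: specialisation_def ran_def)
qed

lemma special_sign:
  assumes "(a, b) \<in> S \<union> sides n"
  shows "special (X a b) = of_int (m a b)"
proof (cases "(a, b) \<in> sides n")
  case True
  have "m a b = 1"
    using True boundary_end(2)[of 0] by (auto simp: sides_def)
  then show ?thesis
    using X_side[OF True] by (simp add: special_1)
next
  case False
  then have S: "(a, b) \<in> S"
    using assms by simp
  then obtain i where i: "i < n" "y i = X a b"
    using T_index S_subset by blast
  have "label i = (a, b)"
    using label_eq[OF i(1) _ i(2)] S S_subset by blast
  then show ?thesis
    using special_var[OF i(1)] i S by (simp add: special_power_def sign_def)
qed

lemma special_free:
  assumes "(a, b) \<in> T - S"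
  obtains i where "special (X a b) = Poly_Mapping.single (Poly_Mapping.single i 1) 1" "free_value i = m a b"
proof -
  obtain i where i: "i < n" "y i = X a b"
    using T_index assms by blast
  have "label i = (a, b)"
    using label_eq[OF i(1) _ i(2)] assms by blast
  then show ?thesis
    using that[of i] special_var[OF i(1)] i assms by (simp add: special_power_def sign_def free_value_def)
qed

text \<open>Both properties go through one induction, since \<open>poly_eval\<close> is
  multiplicative only in the absence of negative exponents.\<close>

definition has_value :: "int \<Rightarrow> int \<Rightarrow> bool" where
  "has_value a b \<longleftrightarrow> nonneg_exponents (special (X a b)) \<and> poly_eval free_value (special (X a b)) = m a b"

lemma has_value_sign: "(a, b) \<in> S \<union> sides n \<Longrightarrow> has_value a b"
  by (simp add: has_value_def special_sign nonneg_exponents_of_int poly_eval_of_int)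

text \<open>As \<open>e\<close> is its own inverse, the division in the Ptolemy relation is a
  multiplication by \<open>e\<close> and creates no denominator.\<close>

lemma has_value_divide:
  assumes "special (X a b) * of_int e = special (X p q) * special (X r s) + special (X p s) * special (X q r)"
    and "has_value p q" "has_value q r" "has_value r s" "has_value p s"
    and "m a b * e = m p q * m r s + m p s * m q r" "\<bar>e\<bar> = 1"
  shows "has_value a b"
proof -
  let ?P = "special (X p q) * special (X r s) + special (X p s) * special (X q r)"
  have e: "e * e = 1"
    using assms(7) by (metis abs_mult_self_eq mult_1)
  have "special (X a b) = special (X a b) * of_int e * of_int e"
    using e by (simp add: mult.assoc flip: of_int_mult)
  also have "\<dots> = ?P * of_int e"
    by (simp add: assms(1))
  finally have eq: "special (X a b) = ?P * of_int e" .
  have P: "nonneg_exponents ?P" "poly_eval free_value ?P = m a b * e"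
    using assms(2-6)
    by (simp_all add: has_value_def nonneg_exponents_add nonneg_exponents_mult poly_eval_add poly_eval_mult)
  show ?thesis
    unfolding has_value_def eq using P e
    by (simp add: nonneg_exponents_mult nonneg_exponents_of_int poly_eval_mult poly_eval_of_int mult.assoc)
qed

text \<open>The free variable is a nonzero monomial and Laurent polynomials have no zero divisors,
  so the opposite diagonal specialises to 0, whatever integer the variable is given.\<close>

lemma has_value_zero:
  assumes "(u, v) \<in> T - S" "special (X a b) * special (X u v) = 0" "m a b = 0"
  shows "has_value a b"
proof -
  obtain i where "special (X u v) = Poly_Mapping.single (Poly_Mapping.single i 1) 1"
    using special_free[OF assms(1)] by blast
  then have "special (X u v) \<noteq> 0"
    by simp
  then have "special (X a b) = 0"
    using assms(2) by simp
  then show ?thesis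
    by (simp add: has_value_def assms(3) nonneg_exponents_0 poly_eval_lin_ext)
qed

text \<open>All four sides specialise to their values in \<open>m\<close>, which turns the
  right-hand side of the specialised Ptolemy relation into the integer
  \<open>m p r * m q s\<close>.\<close>

lemma special_quad_zero:
  assumes "0 \<le> p" "p < q" "q < r" "r < s" "s < int n + 3"
    and "{(p, q), (q, r), (r, s), (p, s)} \<subseteq> S \<union> sides n" "m p r * m q s = 0"
  shows "special (X p r) * special (X q s) = 0"
proof -
  have "special (X p r) * special (X q s) = of_int (m p q * m r s + m p s * m q r)"
    unfolding special_ptolemy[OF assms(1-5)] using assms(6) by (simp add: special_sign)
  also have "m p q * m r s + m p s * m q r = 0"
    using ptolemaicD[OF m_ptolemaic assms(1-5)] assms(7) by simp
  finally show ?thesis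
    by simp
qed

text \<open>Crossings are resolved with \<open>S\<close> and not with \<open>T\<close>, so that all
  divisors are units. A pair left over that is neither a side nor in \<open>T\<close> crosses a free
  diagonal, and staying within its quadrilateral it must be the opposite diagonal.\<close>

lemma has_value_all: "(a, b) \<in> pairs n \<Longrightarrow> has_value a b"
proof (rule crossing_induct[of S n a b])
  show "S \<subseteq> pairs n"
    using S_subset T_pairs by blast
  show "\<not> crossing d e" if "d \<in> S" "e \<in> S" for d e
    using that S_subset triangulation unfolding triangulation_def by blast
next
  fix a b assume ab: "(a, b) \<in> pairs n" and no_S: "\<And>e. e \<in> S \<Longrightarrow> \<not> crossing (a, b) e"
  have no_side: "\<not> crossing (a, b) e" if "e \<in> S \<union> sides n" for e
    using no_S side_not_crossing[OF _ ab, of e] crossing_commute that by blast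
  consider "(a, b) \<in> S \<union> sides n" | "(a, b) \<in> T - S" | e where "e \<in> T" "crossing (a, b) e"
    using not_crossing_T[OF ab] by blast
  then show "has_value a b"
  proof cases
    case 1
    then show ?thesis
      by (rule has_value_sign)
  next
    case 2
    then show ?thesis
      using special_free[OF 2]
      by (metis has_value_def nonneg_exponents_var poly_eval_var)
  next
    case e: (3 e)
    then have eS: "e \<in> T - S"
      using no_S by blast
    obtain p q r s where pqrs: "p < q" "q < r" "r < s" "{(p, q), (q, r), (r, s), (p, s)} \<subseteq> S \<union> sides n"
      and zero: "e = (q, s) \<and> m p r = 0 \<or> e = (p, r) \<and> m q s = 0"
      using free[OF eS] unfolding free_diagonal_def by blast
    have "(p, s) \<in> pairs n"
      using pqrs(4) S_subset T_pairs pairs_eq(1)[of n] by blast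
    then have bounds: "0 \<le> p" "s < int n + 3"
      by (auto simp: pairs_def)
    have no: "\<not> crossing (a, b) (p, q)" "\<not> crossing (a, b) (q, r)" "\<not> crossing (a, b) (r, s)"
      "\<not> crossing (a, b) (p, s)"
      using no_side pqrs(4) by auto
    have "m p r * m q s = 0"
      using zero by auto
    then have prod: "special (X p r) * special (X q s) = 0"
      using special_quad_zero[OF bounds(1) pqrs(1-3) bounds(2) pqrs(4)] by blast
    have less: "a < b"
      using ab by (simp add: pairs_def)
    from zero show ?thesis
    proof
      assume qs: "e = (q, s) \<and> m p r = 0"
      \<comment> \<open>A chord that crosses \<open>(q, s)\<close> but no side of the quadrilateral
        joins the other two corners.\<close>
      then have "a = p \<and> b = r"
        using e(2) no pqrs(1-3) less unfolding crossing_pair by (smt (verit) crossing_pair)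
      then show ?thesis
        using has_value_zero[of q s p r] eS prod qs by simp
    next
      assume pr: "e = (p, r) \<and> m q s = 0"
      then have "a = q \<and> b = s"
        using e(2) no pqrs(1-3) less unfolding crossing_pair by (smt (verit) crossing_pair)
      then show ?thesis
        using has_value_zero[of p r q s] eS prod pr by (simp add: mult.commute)
    qed
  qed
next
  fix p q r s
  assume pqrs: "0 \<le> p" "p < q" "q < r" "r < s" "s < int n + 3" and S: "(q, s) \<in> S"
    and vals: "has_value p q" "has_value q r" "has_value r s" "has_value p s"
  show "has_value p r"
  proof (rule has_value_divide[OF _ vals])
    show "special (X p r) * of_int (m q s) =
        special (X p q) * special (X r s) + special (X p s) * special (X q r)"
      using special_ptolemy[OF pqrs] special_sign[of q s] S by simp
  qed (use ptolemaicD[OF m_ptolemaic pqrs] unit[OF S] in auto)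
next
  fix p q r s
  assume pqrs: "0 \<le> p" "p < q" "q < r" "r < s" "s < int n + 3" and S: "(p, r) \<in> S"
    and vals: "has_value p q" "has_value q r" "has_value r s" "has_value p s"
  show "has_value q s"
  proof (rule has_value_divide[OF _ vals])
    show "special (X q s) * of_int (m p r) =
        special (X p q) * special (X r s) + special (X p s) * special (X q r)"
      using special_ptolemy[OF pqrs] special_sign[of p r] S by (simp add: mult.commute)
  qed (use ptolemaicD[OF m_ptolemaic pqrs] unit[OF S] in \<open>auto simp: mult.commute\<close>)
qed auto

lemma polyamorous_sign: "polyamorous n Q y sign"
proof (rule polyamorousI)
  fix a b assume "(a, b) \<in> diagonals n"
  then show "nonneg_exponents (special (X a b))"
    using has_value_all[of a b] pairs_eq(1)[of n] by (simp add: has_value_def)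
qed

lemma value_array_sign:
  assumes "in_array n i j"
  shows "m i j = value_array n X (cluster_value n y sign free_value) i j"
  unfolding value_array_def
proof (rule eq_polygon_values[OF _ _ _ assms])
  let ?v = "cluster_value n y sign free_value"
  show "?v (X a b) = ?v (X b a)" if "0 \<le> a" "a < int n + 3" "0 \<le> b" "b < int n + 3" for a b
    using X_commute[OF that] by simp
  show "?v (X a a) = 0" if "0 \<le> a" "a < int n + 3" for a
    using X_refl[OF that] by (simp add: cluster_value_special special_0 poly_eval_lin_ext)
  show "?v (X a b) = m a b" if "0 \<le> a" "a < b" "b < int n + 3" for a b
    using has_value_all[of a b] that by (simp add: has_value_def cluster_value_special pairs_def)
qed

end

lemma tame_frieze_arises:
  assumes path: "path_quiver n Q" and X: "polygon_model n Q X" and m: "tame_frieze n m"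
  shows "\<exists>R y \<sigma> t. (R, y) \<in> seeds n Q \<and> specialisation n \<sigma> \<and> polyamorous n Q y \<sigma> \<and>
    (\<forall>i j. in_array n i j \<longrightarrow> m i j = value_array n X (cluster_value n y \<sigma> t) i j)"
proof -
  interpret tame n m
    by unfold_locales (fact m)
  interpret integer_values n m
    by unfold_locales (fact m_ptolemaic)
  have units: "\<bar>m a b\<bar> = 1" if "(a, b) \<in> sides n" for a b
    using that boundary_end(2)[of 0] by (auto simp: sides_def)
  obtain T S where T: "triangulation n T" and S: "S \<subseteq> T" "\<forall>(a, b)\<in>S. \<bar>m a b\<bar> = 1"
    "\<forall>d\<in>T - S. free_diagonal m (S \<union> sides n) d"
    using triangulation_exists[OF units] by blast
  have "case_prod X ` T \<in> clusters n Q"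
    using X T by (auto simp: polygon_model_def)
  then obtain R y where seed: "(R, y) \<in> seeds n Q" "y ` {..<n} = case_prod X ` T"
    by (auto simp: clusters_def)
  interpret sign_seed n Q R y X T m S
    by unfold_locales (use seed X T S path_quiver_loopless[OF path] in auto)
  show ?thesis
    using seed(1) specialisation polyamorous_sign value_array_sign by blast
qed

theorem theorem2:
  fixes n :: nat and Q :: quiver
  assumes "n \<ge> 1" and "path_quiver n Q"
  shows "(\<exists>X. polygon_model n Q X) \<and>
    (\<forall>X. polygon_model n Q X \<longrightarrow>
       (\<forall>R y \<sigma> t.
          (R, y) \<in> seeds n Q \<and> specialisation n \<sigma> \<and> polyamorous n Q y \<sigma> \<longrightarrow>
          tame_frieze n (value_array n X (cluster_value n y \<sigma> t))) \<and>
       (\<forall>m. tame_frieze n m \<longrightarrow>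
          (\<exists>R y \<sigma> t.
             (R, y) \<in> seeds n Q \<and> specialisation n \<sigma> \<and> polyamorous n Q y \<sigma> \<and>
             (\<forall>i j. in_array n i j \<longrightarrow>
                m i j = value_array n X (cluster_value n y \<sigma> t) i j))))"
proof (intro conjI allI impI)
  show "\<exists>X. polygon_model n Q X"
    by (rule polygon_model_exists[OF assms(2)])
next
  fix X R y \<sigma> t
  assume X: "polygon_model n Q X"
    and asm: "(R, y) \<in> seeds n Q \<and> specialisation n \<sigma> \<and> polyamorous n Q y \<sigma>"
  obtain T where "polygon_seed n Q R y X T"
    using seed_triangulation[OF assms(2) X] asm by blast
  then interpret polygon_seed n Q R y X T .
  interpret specialised_seed n Q R y X T \<sigma>
    by unfold_locales (use asm in simp)
  show "tame_frieze n (value_array n X (cluster_value n y \<sigma> t))"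
    by (rule polyamorous_tame) (use asm in simp)
next
  fix X m assume "polygon_model n Q X" "tame_frieze n m"
  then show "\<exists>R y \<sigma> t. (R, y) \<in> seeds n Q \<and> specialisation n \<sigma> \<and> polyamorous n Q y \<sigma> \<and>
      (\<forall>i j. in_array n i j \<longrightarrow> m i j = value_array n X (cluster_value n y \<sigma> t) i j)"
    by (rule tame_frieze_arises[OF assms(2)])
qed

end
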